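(* Let $K$ be an algebraically closed field endowed with a complete non-archimedean absolute value. Let $\varphi:\mathbb{A}^1\to\mathbb{A}^r$ be a linear embedding and $\varphi':\mathbb{A}^1\to\mathbb{A}^{r+1}$ a linear refinement of $\varphi$, so that $\varphi=\pi\circ\varphi'$ for the projection $\pi:\mathbb{A}^{r+1}\to\mathbb{A}^r$. Consider the map $\mathrm{Trop}(\pi):\mathrm{Trop}_{\varphi'}(\mathbb{A}^1)\to\mathrm{Trop}_\varphi(\mathbb{A}^1)$ induced by the projection $\mathbb{T}^{r+1}\to\mathbb{T}^r$. Then $\mathrm{Trop}(\pi)$ is a tropical modification.
   Context: A closed embedding $\varphi:\mathbb{A}^1\to\mathbb{A}^r$ over $K$ is a linear embedding if it is given by linear polynomials $x-a_1,\dots,x-a_r$ with $a_i\in K$. A linear embedding $\varphi':\mathbb{A}^1\to\mathbb{A}^{r'}$ is a linear refinement of $\varphi$ if $\varphi=\pi\circ\varphi'$ with $\pi$ the projection to a set of coordinates. $\mathbb{A}^{1,\mathrm{an}}$ is the Berkovich affine line (multiplicative seminorms on $K[x]$ extending the absolute value of $K$). $\mathbb{T}:=[-\infty,\infty)$ with the topology of a half-open interval, and $\mathbb{T}^r$ has the product topology; $\log0:=-\infty$. $\varphi_{\mathrm{trop}}:\mathbb{A}^{1,\mathrm{an}}\to\mathbb{T}^r$, $\rho\mapsto(\log\rho(x-a_1),\dots,\log\rho(x-a_r))$, and $\mathrm{Trop}_\varphi(\mathbb{A}^1):=\varphi_{\mathrm{trop}}(\mathbb{A}^{1,\mathrm{an}})$.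 A one-dimensional polyhedral complex $\mathcal{C}$ in $\mathbb{R}^r$ is a finite set of closed intervals, half lines and lines (edges) and points (vertices), not consisting of vertices only, such that endpoints of edges are vertices and two distinct edges meet in the empty set or a vertex. For an edge $\sigma$ let $\mathbb{L}(\sigma)$ be the linear line spanned by differences of its points; $\mathcal{C}$ is $\mathbb{R}$-rational if $\mathbb{L}(\sigma)\cap\mathbb{Z}^r\neq\{0\}$ for all edges. An $\mathbb{R}$-rational polyhedral curve $Y$ in $\mathbb{T}^r$ is the closure of the support of such a complex; a polyhedral structure on $Y$ is such a complex with support $Y\cap\mathbb{R}^r$, plus the points of $Y\setminus\mathbb{R}^r$ as vertices at infinity. It is weighted if each edge $\sigma$ carries a weight $m_\sigma\in\mathbb{Z}$ and balanced if $\sum_{\sigma\ni z}m_\sigma\nu_{z,\sigma}=0$ for every vertex $z$ not at infinity, where $\nu_{z,\sigma}$ is the primitive vector in $\mathbb{Z}^r\cap\mathbb{L}(\sigma)$ pointing outwards of $\sigma$ at $z$. A tropical curve is an $\mathbb{R}$-rational polyhedral curve with a balanced weighted polyhedral structure, up to weight-preserving subdivision. $\mathrm{Trop}_\varphi(\mathbb{A}^1)$ is a tropical curve with the canonical tropical multiplicities as weights (sum of multiplicities of the irreducible components of the initial degeneration of $\varphi(\mathbb{A}^1)\cap\mathbb{G}_m^r$ at a relative interior point of the edge, after extension of the valued field if necessary). Tropical modification: let $X\subset\mathbb{T}^r$ be a tropical curve and $P:X\to\mathbb{R}$ a continuous, piecewise affine function with integer slopes. Choose a polyhedral structure $\mathcal{C}$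 on $X$ such that $P$ is affine on every edge, and give the graph $\Gamma_X(P)\subset\mathbb{T}^{r+1}$ the weights $m_{\Gamma_\sigma(P)}:=m_\sigma$. For each $z\in X$ at which $P$ is not affine add the line $\sigma_z:=[(z,P(z)),(z,-\infty)]$ with the unique weight making the result balanced at $(z,P(z))$. This gives a tropical curve $Y\subset\mathbb{T}^{r+1}$, and the restriction $\delta:Y\to X$ of the projection $\mathbb{T}^{r+1}\to\mathbb{T}^r$ is called a tropical modification.
   Formalization: The new linear polynomial of the refinement is required to differ from all those of the original embedding; if it repeats x − a_i, the only point over y_i = −∞ has last coordinate −∞, so the projection is not a modification along a real-valued function. *)

theory Defs
  imports
    "HOL-Analysis.Analysis"
    "HOL-Algebra.QuotRing"
    "HOL-Library.Poly_Mapping"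
    "HOL-Library.Extended_Nat"
    "HOL-Computational_Algebra.Polynomial"
begin

section \<open>Valued fields\<close>

definition nonarch_absolute_value :: "('k::field \<Rightarrow> real) \<Rightarrow> bool" where
  "nonarch_absolute_value v \<longleftrightarrow>
     (\<forall>x. 0 \<le> v x) \<and> (\<forall>x. v x = 0 \<longleftrightarrow> x = 0) \<and>
     (\<forall>x y. v (x * y) = v x * v y) \<and> (\<forall>x y. v (x + y) \<le> max (v x) (v y))"

definition complete_absolute_value :: "('k::field \<Rightarrow> real) \<Rightarrow> bool" where
  "complete_absolute_value v \<longleftrightarrow> Metric_space.mcomplete UNIV (\<lambda>x y. v (x - y))"

definition nontrivial_absolute_value :: "('k::field \<Rightarrow> real) \<Rightarrow> bool" where
  "nontrivial_absolute_value v \<longleftrightarrow> (\<exists>x. x \<noteq> 0 \<and> v x \<noteq> 1)"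

definition valued_extension ::
  "('k::field \<Rightarrow> real) \<Rightarrow> ('l::field \<Rightarrow> real) \<Rightarrow> ('k \<Rightarrow> 'l) \<Rightarrow> bool" where
  "valued_extension v vL j \<longleftrightarrow>
     nonarch_absolute_value v \<and> nonarch_absolute_value vL \<and>
     (\<forall>x y. j (x + y) = j x + j y) \<and> (\<forall>x y. j (x * y) = j x * j y) \<and> j 1 = 1 \<and>
     (\<forall>x. vL (j x) = v x)"


section \<open>The Berkovich line and tropicalization of morphisms to affine space\<close>

definition berkovich_line :: "('k::field \<Rightarrow> real) \<Rightarrow> ('k poly \<Rightarrow> real) set" where
  "berkovich_line v = {\<rho>. (\<forall>f. 0 \<le> \<rho> f) \<and> (\<forall>f g. \<rho> (f + g) \<le> \<rho> f + \<rho> g) \<and>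
     (\<forall>f g. \<rho> (f * g) = \<rho> f * \<rho> g) \<and> (\<forall>c. \<rho> [:c:] = v c)}"

text \<open>Coordinates of affine space, of \<open>\<real>\<^sup>r\<close> and of \<open>\<T>\<^sup>r\<close> are indexed by a finite type \<open>'r\<close>
  (nonempty, so \<open>r \<ge> 1\<close>).  A morphism from the affine line to affine space is the family of its
  coordinate polynomials; if these are linear, it is automatically a closed embedding.\<close>

definition linear_embedding :: "('r::finite \<Rightarrow> 'k::field poly) \<Rightarrow> bool" where
  "linear_embedding \<phi> \<longleftrightarrow> (\<exists>a. \<forall>i. \<phi> i = [:- a i, 1:])"

text \<open>\<open>\<iota>\<close> selects the coordinates that are kept by the projection \<open>\<pi>\<close>.\<close>

definition linear_refinement ::
  "('r::finite \<Rightarrow> 's::finite) \<Rightarrow> ('s \<Rightarrow> 'k::field poly) \<Rightarrow> ('r \<Rightarrow> 'k poly) \<Rightarrow> bool" where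
  "linear_refinement \<iota> \<phi>' \<phi> \<longleftrightarrow>
     linear_embedding \<phi>' \<and> inj \<iota> \<and> (\<forall>i. \<phi> i = \<phi>' (\<iota> i))"

text \<open>\<open>\<T> = [-\<infinity>, \<infinity>)\<close> is realised inside \<^typ>\<open>ereal\<close>, and \<open>\<T>\<^sup>r\<close> as the following subspace.\<close>

definition tropical_space :: "(ereal ^ 'n::finite) set" where
  "tropical_space = {y. \<forall>i. y $ i \<noteq> \<infinity>}"

definition finite_point :: "real ^ 'n::finite \<Rightarrow> ereal ^ 'n" where
  "finite_point x = (\<chi> i. ereal (x $ i))"

definition trop_log :: "real \<Rightarrow> ereal" where
  "trop_log x = (if x = 0 then - \<infinity> else ereal (ln x))"

definition trop_map :: "('r::finite \<Rightarrow> 'k::field poly) \<Rightarrow> ('k poly \<Rightarrow> real) \<Rightarrow> ereal ^ 'r" where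
  "trop_map \<phi> \<rho> = (\<chi> i. trop_log (\<rho> (\<phi> i)))"

definition Trop :: "('k::field \<Rightarrow> real) \<Rightarrow> ('r::finite \<Rightarrow> 'k poly) \<Rightarrow> (ereal ^ 'r) set" where
  "Trop v \<phi> = trop_map \<phi> ` berkovich_line v"

definition trop_proj :: "('r::finite \<Rightarrow> 's::finite) \<Rightarrow> ereal ^ 's \<Rightarrow> ereal ^ 'r" where
  "trop_proj \<iota> y = (\<chi> i. y $ \<iota> i)"


section \<open>Weighted polyhedral complexes of dimension one and tropical curves\<close>

record 'n weighted_complex =
  verts :: "(real ^ 'n) set"
  edges :: "(real ^ 'n) set set"
  weight :: "(real ^ 'n) set \<Rightarrow> int"

definition is_edge :: "(real ^ 'n::finite) set \<Rightarrow> bool" where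
  "is_edge \<sigma> \<longleftrightarrow>
     (\<exists>a b. a \<noteq> b \<and> \<sigma> = closed_segment a b) \<or>
     (\<exists>a u. u \<noteq> 0 \<and> \<sigma> = {a + t *\<^sub>R u | t. 0 \<le> t}) \<or>
     (\<exists>a u. u \<noteq> 0 \<and> \<sigma> = range (\<lambda>t::real. a + t *\<^sub>R u))"

definition support :: "'n::finite weighted_complex \<Rightarrow> (real ^ 'n) set" where
  "support C = verts C \<union> \<Union>(edges C)"

text \<open>The endpoints of an edge are its extreme points.  The last condition is the usual requirement
  that a vertex lying on an edge is a face of it.\<close>

definition polyhedral_complex :: "'n::finite weighted_complex \<Rightarrow> bool" where
  "polyhedral_complex C \<longleftrightarrow>
     finite (verts C) \<and> finite (edges C) \<and> edges C \<noteq> {} \<and>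
     (\<forall>\<sigma>\<in>edges C. is_edge \<sigma>) \<and>
     (\<forall>\<sigma>\<in>edges C. \<forall>z. z extreme_point_of \<sigma> \<longrightarrow> z \<in> verts C) \<and>
     (\<forall>\<sigma>\<in>edges C. \<forall>\<tau>\<in>edges C. \<sigma> \<noteq> \<tau> \<longrightarrow> \<sigma> \<inter> \<tau> = {} \<or> (\<exists>z\<in>verts C. \<sigma> \<inter> \<tau> = {z})) \<and>
     (\<forall>\<sigma>\<in>edges C. \<forall>z\<in>verts C \<inter> \<sigma>. z extreme_point_of \<sigma>)"

definition integral_vectors :: "(real ^ 'n::finite) set" where
  "integral_vectors = {u. \<forall>i. u $ i \<in> \<int>}"

definition direction_space :: "(real ^ 'n::finite) set \<Rightarrow> (real ^ 'n) set" where
  "direction_space \<sigma> = span {x - y | x y. x \<in> \<sigma> \<and> y \<in> \<sigma>}"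

definition rational_complex :: "'n::finite weighted_complex \<Rightarrow> bool" where
  "rational_complex C \<longleftrightarrow>
     (\<forall>\<sigma>\<in>edges C. direction_space \<sigma> \<inter> integral_vectors \<noteq> {0})"

text \<open>The generator of \<open>\<int>\<^sup>n \<inter> \<L>(\<sigma>)\<close> that points outwards of \<open>\<sigma>\<close> at its endpoint \<open>z\<close>.\<close>

definition outward_primitive :: "real ^ 'n::finite \<Rightarrow> (real ^ 'n) set \<Rightarrow> real ^ 'n" where
  "outward_primitive z \<sigma> = (THE w. w \<in> integral_vectors \<inter> direction_space \<sigma> \<and>
     (\<forall>u\<in>integral_vectors \<inter> direction_space \<sigma>. \<exists>k::int. u = of_int k *\<^sub>R w) \<and>
     (\<exists>t>0. z - t *\<^sub>R w \<in> \<sigma>))"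

definition balanced :: "'n::finite weighted_complex \<Rightarrow> bool" where
  "balanced C \<longleftrightarrow> (\<forall>z\<in>verts C.
     (\<Sum>\<sigma> | \<sigma> \<in> edges C \<and> z \<in> \<sigma>. of_int (weight C \<sigma>) *\<^sub>R outward_primitive z \<sigma>) = 0)"

definition tropical_structure :: "'n::finite weighted_complex \<Rightarrow> bool" where
  "tropical_structure C \<longleftrightarrow> polyhedral_complex C \<and> rational_complex C \<and> balanced C"

text \<open>The underlying curve in \<open>\<T>\<^sup>n\<close>: the closure in \<open>\<T>\<^sup>n\<close> of the support.\<close>

definition curve :: "'n::finite weighted_complex \<Rightarrow> (ereal ^ 'n) set" where
  "curve C = closure (finite_point ` support C) \<inter> tropical_space"

definition subdivision :: "'n::finite weighted_complex \<Rightarrow> 'n weighted_complex \<Rightarrow> bool" where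
  "subdivision F C \<longleftrightarrow> polyhedral_complex F \<and> polyhedral_complex C \<and>
     support F = support C \<and> verts C \<subseteq> verts F \<and>
     (\<forall>\<sigma>\<in>edges F. \<exists>\<tau>\<in>edges C. \<sigma> \<subseteq> \<tau> \<and> weight F \<sigma> = weight C \<tau>)"

text \<open>A tropical curve is a class of balanced weighted structures up to weight-preserving
  subdivision; two structures define the same tropical curve iff they have a common one.\<close>

definition same_tropical_curve :: "'n::finite weighted_complex \<Rightarrow> 'n weighted_complex \<Rightarrow> bool" where
  "same_tropical_curve C D \<longleftrightarrow> tropical_structure C \<and> tropical_structure D \<and>
     (\<exists>F. subdivision F C \<and> subdivision F D)"


section \<open>Tropical modifications\<close>

definition integral_affine_on_edge ::
  "(ereal ^ 'n::finite \<Rightarrow> real) \<Rightarrow> (real ^ 'n) set \<Rightarrow> bool" where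
  "integral_affine_on_edge P \<sigma> \<longleftrightarrow> (\<exists>l b. linear l \<and>
     (\<forall>x\<in>\<sigma>. P (finite_point x) = l x + b) \<and>
     (\<forall>u\<in>integral_vectors \<inter> direction_space \<sigma>. l u \<in> \<int>))"

definition affine_at ::
  "(ereal ^ 'n::finite \<Rightarrow> real) \<Rightarrow> 'n weighted_complex \<Rightarrow> real ^ 'n \<Rightarrow> bool" where
  "affine_at P C z \<longleftrightarrow> (\<exists>U l b. open U \<and> z \<in> U \<and> linear l \<and>
     (\<forall>x\<in>U \<inter> support C. P (finite_point x) = l x + b))"

text \<open>For injective \<open>\<iota>\<close> missing exactly one index of \<open>'s\<close>, the space \<open>\<real>\<^sup>s\<close> is \<open>\<real>\<^sup>r \<times> \<real>\<close>, the extra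
  factor being the coordinate forgotten by the projection.\<close>

definition add_coordinate ::
  "('r::finite \<Rightarrow> 's::finite) \<Rightarrow> real ^ 'r \<Rightarrow> real \<Rightarrow> real ^ 's" where
  "add_coordinate \<iota> x t = (\<chi> k. if k \<in> range \<iota> then x $ inv_into UNIV \<iota> k else t)"

definition graph_point ::
  "('r::finite \<Rightarrow> 's::finite) \<Rightarrow> (ereal ^ 'r \<Rightarrow> real) \<Rightarrow> real ^ 'r \<Rightarrow> real ^ 's" where
  "graph_point \<iota> P x = add_coordinate \<iota> x (P (finite_point x))"

definition vertical_ray ::
  "('r::finite \<Rightarrow> 's::finite) \<Rightarrow> (ereal ^ 'r \<Rightarrow> real) \<Rightarrow> real ^ 'r \<Rightarrow> (real ^ 's) set" where
  "vertical_ray \<iota> P z = {add_coordinate \<iota> z t | t. t \<le> P (finite_point z)}"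

text \<open>\<open>D'\<close> is the graph of \<open>P\<close> over \<open>D\<close> completed by vertical rays.  The weights of the rays are
  determined by balancing.  Only finite points can carry a ray: \<open>P\<close> is continuous and real
  valued, hence locally constant near the points of the curve at infinity.\<close>

definition graph_completion ::
  "('r::finite \<Rightarrow> 's::finite) \<Rightarrow> (ereal ^ 'r \<Rightarrow> real) \<Rightarrow>
   'r weighted_complex \<Rightarrow> 's weighted_complex \<Rightarrow> bool" where
  "graph_completion \<iota> P D D' \<longleftrightarrow>
     verts D' = graph_point \<iota> P ` verts D \<and>
     edges D' = (\<lambda>\<sigma>. graph_point \<iota> P ` \<sigma>) ` edges D \<union>
       {vertical_ray \<iota> P z | z. z \<in> support D \<and> \<not> affine_at P D z} \<and>
     (\<forall>\<sigma>\<in>edges D. weight D' (graph_point \<iota> P ` \<sigma>) = weight D \<sigma>) \<and>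
     balanced D'"

text \<open>The map \<open>\<delta>\<close> from the tropical curve represented by \<open>Y\<close> to that represented by \<open>X\<close> is a
  tropical modification.\<close>

definition tropical_modification ::
  "(ereal ^ 's::finite \<Rightarrow> ereal ^ 'r::finite) \<Rightarrow>
   's weighted_complex \<Rightarrow> 'r weighted_complex \<Rightarrow> bool" where
  "tropical_modification \<delta> Y X \<longleftrightarrow>
     (\<exists>\<iota> P D D'. CARD('s) = CARD('r) + 1 \<and> inj \<iota> \<and>
        continuous_on (curve X) P \<and>
        same_tropical_curve D X \<and> (\<forall>\<sigma>\<in>edges D. integral_affine_on_edge P \<sigma>) \<and>
        graph_completion \<iota> P D D' \<and> same_tropical_curve D' Y \<and>
        \<delta> \<in> curve Y \<rightarrow> curve X \<and> (\<forall>y\<in>curve Y. \<delta> y = trop_proj \<iota> y))"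


section \<open>Sum of the multiplicities of the irreducible components of an affine scheme\<close>

text \<open>The class of \<open>a/s\<close> in the localization of \<open>A\<close> at the prime ideal \<open>p\<close>.\<close>

definition frac_class :: "('a, 'm) ring_scheme \<Rightarrow> 'a set \<Rightarrow> 'a \<Rightarrow> 'a \<Rightarrow> ('a \<times> 'a) set" where
  "frac_class A p a s = {(b, t). b \<in> carrier A \<and> t \<in> carrier A - p \<and>
     (\<exists>u\<in>carrier A - p. u \<otimes>\<^bsub>A\<^esub> (a \<otimes>\<^bsub>A\<^esub> t) = u \<otimes>\<^bsub>A\<^esub> (b \<otimes>\<^bsub>A\<^esub> s))}"

text \<open>The unions below are over equal sets, by independence of representatives.\<close>

definition localization :: "('a, 'm) ring_scheme \<Rightarrow> 'a set \<Rightarrow> ('a \<times> 'a) set ring" where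
  "localization A p =
    \<lparr>carrier = {frac_class A p a s | a s. a \<in> carrier A \<and> s \<in> carrier A - p},
     mult = (\<lambda>x y. \<Union>(a, s)\<in>x. \<Union>(b, t)\<in>y. frac_class A p (a \<otimes>\<^bsub>A\<^esub> b) (s \<otimes>\<^bsub>A\<^esub> t)),
     one = frac_class A p \<one>\<^bsub>A\<^esub> \<one>\<^bsub>A\<^esub>,
     zero = frac_class A p \<zero>\<^bsub>A\<^esub> \<one>\<^bsub>A\<^esub>,
     add = (\<lambda>x y. \<Union>(a, s)\<in>x. \<Union>(b, t)\<in>y.
       frac_class A p ((a \<otimes>\<^bsub>A\<^esub> t) \<oplus>\<^bsub>A\<^esub> (b \<otimes>\<^bsub>A\<^esub> s)) (s \<otimes>\<^bsub>A\<^esub> t))\<rparr>"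

text \<open>Length of a ring as a module over itself.\<close>

definition ring_length :: "('a, 'm) ring_scheme \<Rightarrow> enat" where
  "ring_length B = Sup {enat n | n.
     \<exists>c :: nat \<Rightarrow> 'a set. (\<forall>i\<le>n. ideal (c i) B) \<and> (\<forall>i<n. c i \<subset> c (Suc i))}"

definition minimal_primes :: "('a, 'm) ring_scheme \<Rightarrow> 'a set set" where
  "minimal_primes A =
     {p. primeideal p A \<and> (\<forall>q. primeideal q A \<longrightarrow> q \<subseteq> p \<longrightarrow> q = p)}"

definition component_multiplicity_sum :: "('a, 'm) ring_scheme \<Rightarrow> enat" where
  "component_multiplicity_sum A = (\<Sum>p\<in>minimal_primes A. ring_length (localization A p))"


section \<open>Initial degenerations and tropical multiplicities\<close>

text \<open>Laurent polynomials in variables indexed by \<open>'n\<close> are finitely supported functions on the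
  exponents \<^typ>\<open>int ^ 'n\<close>, with the convolution product.\<close>

definition laurent_eval :: "((int ^ 'n::finite) \<Rightarrow>\<^sub>0 'l::field) \<Rightarrow> ('n \<Rightarrow> 'l) \<Rightarrow> 'l" where
  "laurent_eval f y =
     (\<Sum>u\<in>Poly_Mapping.keys f. Poly_Mapping.lookup f u * (\<Prod>i\<in>UNIV. y i powi (u $ i)))"

definition laurent_valuation_ring ::
  "('l::field \<Rightarrow> real) \<Rightarrow> ((int ^ 'n::finite) \<Rightarrow>\<^sub>0 'l) ring" where
  "laurent_valuation_ring v =
    \<lparr>carrier = {f. \<forall>u. v (Poly_Mapping.lookup f u) \<le> 1},
     mult = (*), one = 1, zero = 0, add = (+)\<rparr>"

text \<open>The points of \<open>\<phi>(\<A>\<^sup>1) \<inter> \<G>\<^sub>m\<^sup>n\<close> over the algebraically closed field \<open>'l\<close>.\<close>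

definition torus_points :: "('n::finite \<Rightarrow> 'l::alg_closed_field poly) \<Rightarrow> ('n \<Rightarrow> 'l) set" where
  "torus_points \<phi> = {y. \<exists>c. \<forall>i. y i = poly (\<phi> i) c \<and> y i \<noteq> 0}"

text \<open>For the reduced closed subscheme of the torus with set of points \<open>X\<close> and a point \<open>t\<close> of the
  torus, the closure of \<open>t\<^sup>-\<^sup>1 X\<close> in the torus over the valuation ring is defined by the integral
  Laurent polynomials vanishing on \<open>t\<^sup>-\<^sup>1 X\<close>.  Adding the Laurent polynomials with coefficients in
  the maximal ideal gives the ideal of the special fibre.\<close>

definition special_fibre_ideal ::
  "('l::alg_closed_field \<Rightarrow> real) \<Rightarrow> ('n::finite \<Rightarrow> 'l) set \<Rightarrow> ('n \<Rightarrow> 'l) \<Rightarrow>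
   ((int ^ 'n) \<Rightarrow>\<^sub>0 'l) set" where
  "special_fibre_ideal v X t =
     {f + g | f g. f \<in> carrier (laurent_valuation_ring v) \<and>
        (\<forall>y\<in>X. laurent_eval f (\<lambda>i. y i / t i) = 0) \<and>
        (\<forall>u. v (Poly_Mapping.lookup g u) < 1)}"

text \<open>The coordinate ring of the initial degeneration of \<open>X\<close> at the point \<open>(log |t\<^sub>i|)\<^sub>i\<close>.\<close>

definition initial_degeneration ::
  "('l::alg_closed_field \<Rightarrow> real) \<Rightarrow> ('n::finite \<Rightarrow> 'l) set \<Rightarrow> ('n \<Rightarrow> 'l) \<Rightarrow>
   ((int ^ 'n) \<Rightarrow>\<^sub>0 'l) set ring" where
  "initial_degeneration v X t = laurent_valuation_ring v Quot special_fibre_ideal v X t"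

definition tropical_multiplicity ::
  "('l::alg_closed_field \<Rightarrow> real) \<Rightarrow> ('n::finite \<Rightarrow> 'l) set \<Rightarrow> ('n \<Rightarrow> 'l) \<Rightarrow> enat" where
  "tropical_multiplicity v X t = component_multiplicity_sum (initial_degeneration v X t)"

definition log_abs :: "('l::field \<Rightarrow> real) \<Rightarrow> ('n::finite \<Rightarrow> 'l) \<Rightarrow> real ^ 'n" where
  "log_abs v t = (\<chi> i. ln (v (t i)))"

text \<open>\<open>C\<close> represents \<open>Trop\<^sub>\<phi>(\<A>\<^sup>1)\<close> as a tropical curve with its canonical weights.  These are computed
  over an extension \<open>j\<close> of the ground field to \<open>'l\<close>, at the relative interior points of the edges
  with coordinates in \<open>log |'l\<^sup>\<times>|\<close>.  For the trivial absolute value on \<open>'k\<close> one cannot take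
  \<open>'l = 'k\<close>, as no edge need have such a point; a nontrivially valued algebraically closed \<open>'l\<close>
  always has a dense group \<open>log |'l\<^sup>\<times>|\<close>.\<close>

definition represents_Trop ::
  "('k::field \<Rightarrow> real) \<Rightarrow> ('l::alg_closed_field \<Rightarrow> real) \<Rightarrow> ('k \<Rightarrow> 'l) \<Rightarrow>
   ('r::finite \<Rightarrow> 'k poly) \<Rightarrow> 'r weighted_complex \<Rightarrow> bool" where
  "represents_Trop v vL j \<phi> C \<longleftrightarrow> tropical_structure C \<and> curve C = Trop v \<phi> \<and>
     (\<forall>\<sigma>\<in>edges C. 0 \<le> weight C \<sigma> \<and>
        (\<exists>t. (\<forall>i. t i \<noteq> 0) \<and> log_abs vL t \<in> rel_interior \<sigma>) \<and>
        (\<forall>t. (\<forall>i. t i \<noteq> 0) \<and> log_abs vL t \<in> rel_interior \<sigma> \<longrightarrow>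
           enat (nat (weight C \<sigma>)) =
             tropical_multiplicity vL (torus_points (\<lambda>i. map_poly j (\<phi> i))) t))"

end

theory Submission
  imports Defs
begin

text \<open>Write \<open>d i j = |a\<^sub>i - a\<^sub>j|\<close>.  By the ultrametric inequality a point of the Berkovich line is
  nearest to some \<open>a\<^sub>i\<close>, at distance \<open>s\<close> say, and is mapped to the point with \<open>j\<close>-th coordinate
  \<open>log (max s (d i j))\<close>; Gauss norms realise all these points.  So the tropicalization is the union
  of the paths \<open>p\<^sub>i(t) = (max t (log (d i j)))\<^sub>j\<close>, and \<open>p\<^sub>i\<close> and \<open>p\<^sub>j\<close> coincide exactly from
  \<open>log (d i j)\<close> upwards.  Balancing at a vertex says that a closed ball is the disjoint union of the
  open balls of the same radius.

  All weights are \<open>1\<close>: at an interior point of an edge on \<open>p\<^sub>i\<close>, every Laurent monomial is congruent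
  modulo the ideal of the special fibre to a unit times a power of the \<open>i\<close>-th variable.  Because the
  field is algebraically closed, the maximum of the absolute values of the coefficients of a
  polynomial is attained as its value at some element of absolute value \<open>1\<close>, for two polynomials
  simultaneously; hence the ideal is prime.

  A new point whose nearest old point \<open>a\<^sub>i\<close> is at distance \<open>\<delta>\<close> adds the coordinate
  \<open>P = max x\<^sub>i (log \<delta>)\<close> and the path that leaves the graph of \<open>P\<close> vertically at \<open>p\<^sub>i(log \<delta>)\<close>,
  which is the only point where \<open>P\<close> is not affine.\<close>

section \<open>Gauss norms and the image of the Berkovich line\<close>

text \<open>A modification is tested edge by edge: the edges upstairs must be exactly the graphs of
  the edges downstairs together with undivided rays. Both trees therefore need matching
  subdivisions, and the old one is cut at the logarithms of all distances, including those to the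
  new point. Paths are parametrised by the logarithm of the radius because the \<open>i\<close>-th
  coordinate of \<open>p_i(t)\<close> is then \<open>t\<close> itself. So a point determines its
  parameter, and every direction vector has an entry 1, hence is primitive. The residue field is
  never constructed. Reduction modulo the maximal ideal is replaced by the condition
  \<open>v (f z) < 1\<close> at elements \<open>z\<close> with \<open>v z = 1\<close>; algebraic
  closedness supplies enough of them. Algebraic closedness also makes the value group of the
  nontrivially valued extension divisible, hence dense, so that each edge has an interior point at
  which its multiplicity can be computed. The new point differs from the old ones, so \<delta> is
  positive; this keeps P finite even at the points of the curve at infinity.\<close>

locale nonarch_valuation =
  fixes v :: "'k::field \<Rightarrow> real"
  assumes nonarch: "nonarch_absolute_value v"
begin

lemma nonneg [simp]: "0 \<le> v x"
  and eq_0_iff [simp]: "v x = 0 \<longleftrightarrow> x = 0"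
  and mult: "v (x * y) = v x * v y"
  and ultra: "v (x + y) \<le> max (v x) (v y)"
  using nonarch by (auto simp: nonarch_absolute_value_def)

lemma zero [simp]: "v 0 = 0"
  by simp

lemma pos_iff [simp]: "0 < v x \<longleftrightarrow> x \<noteq> 0"
  using nonneg[of x] eq_0_iff[of x] by linarith

lemma one [simp]: "v 1 = 1"
  using mult[of 1 1] eq_0_iff[of 1] by simp

lemma minus [simp]: "v (- x) = v x"
proof -
  have "(v (- 1))\<^sup>2 = 1"
    by (simp add: power2_eq_square flip: mult)
  then have "v (- 1) = 1"
    using nonneg[of "- 1"] by (simp add: power2_eq_1_iff)
  then show ?thesis
    using mult[of "- 1" x] by simp
qed

lemma minus_commute: "v (x - y) = v (y - x)"
  using minus[of "x - y"] by simp

lemma ultra_diff: "v (x - y) \<le> max (v x) (v y)"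
  using ultra[of x "- y"] by simp

lemma power: "v (x ^ n) = v x ^ n"
  by (induction n) (auto simp: mult)

lemma inverse: "v (inverse x) = inverse (v x)"
proof (cases "x = 0")
  case False
  then have "v x * v (inverse x) = 1"
    by (simp flip: mult)
  then show ?thesis
    by (metis inverse_unique)
qed auto

lemma divide: "v (x / y) = v x / v y"
  by (simp add: divide_inverse mult inverse)

lemma power_int: "v (x powi n) = v x powi n"
  by (simp add: power_int_def power inverse)

lemma prod: "v (\<Prod>i\<in>A. f i) = (\<Prod>i\<in>A. v (f i))"
  by (induction A rule: infinite_finite_induct) (auto simp: mult)

lemma sum_le:
  assumes "\<And>i. i \<in> A \<Longrightarrow> v (f i) \<le> B" "0 \<le> B"
  shows "v (\<Sum>i\<in>A. f i) \<le> B"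
  using assms
proof (induction A rule: infinite_finite_induct)
  case (insert x A)
  then show ?case
    using ultra[of "f x" "sum f A"] by fastforce
qed auto

lemma sum_less:
  assumes "\<And>i. i \<in> A \<Longrightarrow> v (f i) < B" "0 < B"
  shows "v (\<Sum>i\<in>A. f i) < B"
  using assms
proof (induction A rule: infinite_finite_induct)
  case (insert x A)
  then show ?case
    using ultra[of "f x" "sum f A"] by fastforce
qed auto

lemma of_nat_le_1: "v (of_nat n) \<le> 1"
proof (induction n)
  case (Suc n)
  then show ?case
    using ultra[of 1 "of_nat n"] by simp
qed simp

lemma add_eq_left:
  assumes "v y < v x"
  shows "v (x + y) = v x"
  using ultra[of x y] ultra_diff[of "x + y" y] assms by auto

lemma add_eq_max:
  assumes "v x \<noteq> v y"
  shows "v (x + y) = max (v x) (v y)"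
  using add_eq_left[of y x] add_eq_left[of x y] assms by (auto simp: max_def add.commute)

lemma dist_triangle: "v (x - z) \<le> max (v (x - y)) (v (y - z))"
  using ultra[of "x - y" "y - z"] by simp

section \<open>Gauss norms and their multiplicativity\<close>

text \<open>For \<open>s = 0\<close> only the constant term survives, since
  \<open>0 ^ 0 = 1\<close>; evaluation at a point is thus included among these norms.\<close>

definition gauss_norm :: "real \<Rightarrow> 'k poly \<Rightarrow> real" where
  "gauss_norm s p = Max ((\<lambda>k. v (coeff p k) * s ^ k) ` {..degree p})"

lemma gauss_norm_ge:
  assumes "0 \<le> s"
  shows "v (coeff p k) * s ^ k \<le> gauss_norm s p"
proof (cases "k \<le> degree p")
  case True
  then show ?thesis
    unfolding gauss_norm_def by (intro Max_ge) auto
next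
  case False
  then have "v (coeff p k) * s ^ k = 0"
    by (simp add: coeff_eq_0)
  also have "0 \<le> v (coeff p 0) * s ^ 0"
    by simp
  also have "\<dots> \<le> gauss_norm s p"
    unfolding gauss_norm_def by (intro Max_ge) (auto intro!: image_eqI[where x = 0])
  finally show ?thesis .
qed

lemma gauss_norm_nonneg: "0 \<le> gauss_norm s p" if "0 \<le> s"
  using gauss_norm_ge[OF that, of p 0] by (auto intro: order_trans[rotated])

lemma gauss_norm_leI:
  assumes "\<And>k. v (coeff p k) * s ^ k \<le> B"
  shows "gauss_norm s p \<le> B"
  unfolding gauss_norm_def using assms by (intro Max.boundedI) auto

lemma gauss_norm_attained: "\<exists>k. v (coeff p k) * s ^ k = gauss_norm s p"
proof -
  have "gauss_norm s p \<in> (\<lambda>k. v (coeff p k) * s ^ k) ` {..degree p}"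
    unfolding gauss_norm_def by (intro Max_in) auto
  then show ?thesis
    by auto
qed

lemma gauss_norm_add_le:
  assumes "0 \<le> s"
  shows "gauss_norm s (p + q) \<le> max (gauss_norm s p) (gauss_norm s q)"
proof (rule gauss_norm_leI)
  fix k
  have "v (coeff (p + q) k) * s ^ k \<le> max (v (coeff p k)) (v (coeff q k)) * s ^ k"
    using assms by (auto intro: mult_right_mono ultra)
  also have "\<dots> \<le> max (gauss_norm s p) (gauss_norm s q)"
    using gauss_norm_ge[OF assms, of p k] gauss_norm_ge[OF assms, of q k]
    by (auto simp: max_def)
  finally show "v (coeff (p + q) k) * s ^ k \<le> max (gauss_norm s p) (gauss_norm s q)" .
qed

lemma term_mult_eq:
  assumes "i \<le> n"
  shows "v (coeff p i * coeff q (n - i)) * s ^ n =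
    (v (coeff p i) * s ^ i) * (v (coeff q (n - i)) * s ^ (n - i))"
  using assms by (simp add: mult flip: power_add)

lemma gauss_norm_mult_le:
  assumes "0 \<le> s"
  shows "gauss_norm s (p * q) \<le> gauss_norm s p * gauss_norm s q"
proof (rule gauss_norm_leI)
  fix n
  let ?B = "gauss_norm s p * gauss_norm s q"
  show "v (coeff (p * q) n) * s ^ n \<le> ?B"
  \<comment> \<open>The bound is proved after division by \<open>s ^ n\<close>. For
    \<open>s = 0\<close> and positive \<open>n\<close> this is impossible, but the left-hand side
    vanishes.\<close>
  proof (cases "s ^ n = 0")
    case True
    then show ?thesis
      using gauss_norm_nonneg[OF assms] by (auto simp: zero_power)
  next
    case False
    then have pos: "0 < s ^ n"
      using zero_le_power[OF assms, of n] by linarith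
    have "v (coeff (p * q) n) \<le> ?B / s ^ n"
      unfolding coeff_mult
    proof (rule sum_le)
      fix i assume "i \<in> {..n}"
      then have "v (coeff p i * coeff q (n - i)) * s ^ n \<le> ?B"
        by (subst term_mult_eq) (auto intro!: mult_mono gauss_norm_ge gauss_norm_nonneg mult_nonneg_nonneg zero_le_power
              assms)
      then show "v (coeff p i * coeff q (n - i)) \<le> ?B / s ^ n"
        using pos by (simp add: field_simps)
    qed (use pos gauss_norm_nonneg[OF assms] in auto)
    then show ?thesis
      using pos by (simp add: field_simps)
  qed
qed

text \<open>The terms of lowest degree at which the two maxima are attained produce a coefficient
  of the product that cannot be cancelled.\<close>

lemma gauss_norm_mult_ge:
  assumes "0 \<le> s"
  shows "gauss_norm s p * gauss_norm s q \<le> gauss_norm s (p * q)"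
proof (cases "gauss_norm s p = 0 \<or> gauss_norm s q = 0")
  case True
  then show ?thesis
    using gauss_norm_nonneg[OF assms] by auto
next
  case False
  let ?P = "\<lambda>i. v (coeff p i) * s ^ i" and ?Q = "\<lambda>i. v (coeff q i) * s ^ i"
  let ?p = "gauss_norm s p" and ?q = "gauss_norm s q"
  have pos: "0 < ?p" "0 < ?q"
    using False gauss_norm_nonneg[OF assms, of p] gauss_norm_nonneg[OF assms, of q] by linarith+
  define k where "k = (LEAST k. ?P k = ?p)"
  define l where "l = (LEAST l. ?Q l = ?q)"
  define n where "n = k + l"
  have k: "?P k = ?p" "\<And>i. i < k \<Longrightarrow> ?P i < ?p"
    using LeastI_ex[OF gauss_norm_attained[of p s]] not_less_Least[of _ "\<lambda>k. ?P k = ?p"]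
      gauss_norm_ge[OF assms, of p] unfolding k_def by (blast, metis less_le)
  have l: "?Q l = ?q" "\<And>i. i < l \<Longrightarrow> ?Q i < ?q"
    using LeastI_ex[OF gauss_norm_attained[of q s]] not_less_Least[of _ "\<lambda>k. ?Q k = ?q"]
      gauss_norm_ge[OF assms, of q] unfolding l_def by (blast, metis less_le)
  let ?t = "\<lambda>i. coeff p i * coeff q (n - i)"
  \<comment> \<open>Nonzero maxima force \<open>s ^ k\<close> and \<open>s ^ l\<close> to be
    nonzero, so division by \<open>s ^ n\<close> is legitimate also for
    \<open>s = 0\<close>.\<close>
  have "?P k * ?Q l \<noteq> 0"
    unfolding k(1) l(1) using pos by simp
  then have "s ^ n \<noteq> 0"
    by (auto simp: n_def power_add)
  then have sn: "0 < s ^ n"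
    using zero_le_power[OF assms, of n] by linarith
  have "v (?t k) * s ^ n = ?p * ?q"
    using term_mult_eq[of k n p q s] k(1) l(1) by (simp add: n_def)
  then have main: "v (?t k) = ?p * ?q / s ^ n"
    using sn by (metis nonzero_eq_divide_eq less_irrefl)
  have "v (\<Sum>i\<in>{..n} - {k}. ?t i) < ?p * ?q / s ^ n"
  proof (rule sum_less)
    fix i assume i: "i \<in> {..n} - {k}"
    have "?P i * ?Q (n - i) < ?p * ?q"
    \<comment> \<open>For \<open>i\<close> different from \<open>k\<close>, either
      \<open>i < k\<close> or \<open>n - i < l\<close>; minimality of \<open>k\<close> or
      \<open>l\<close> makes one of the two factors strictly smaller than its maximum.\<close>
    proof (cases "i < k")
      case True
      then have "?P i * ?Q (n - i) \<le> ?P i * ?q"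
        using gauss_norm_ge[OF assms] assms by (intro mult_left_mono) auto
      also have "\<dots> < ?p * ?q"
        using k(2)[OF True] pos by simp
      finally show ?thesis .
    next
      case False
      then have "n - i < l"
        using i by (auto simp: n_def)
      have "?P i * ?Q (n - i) \<le> ?p * ?Q (n - i)"
        using gauss_norm_ge[OF assms] assms by (intro mult_right_mono) auto
      also have "\<dots> < ?p * ?q"
        using l(2)[OF \<open>n - i < l\<close>] pos by simp
      finally show ?thesis .
    qed
    then show "v (?t i) < ?p * ?q / s ^ n"
      using term_mult_eq[of i n p q s] i sn by (simp add: field_simps)
  qed (use pos sn in auto)
  then have "v (?t k + (\<Sum>i\<in>{..n} - {k}. ?t i)) = ?p * ?q / s ^ n"
    using add_eq_left[of "\<Sum>i\<in>{..n} - {k}. ?t i" "?t k"] main by simp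
  moreover have "coeff (p * q) n = ?t k + (\<Sum>i\<in>{..n} - {k}. ?t i)"
    unfolding coeff_mult by (subst sum.remove[of _ k]) (auto simp: n_def)
  ultimately have "v (coeff (p * q) n) * s ^ n = ?p * ?q"
    using sn by (metis nonzero_eq_divide_eq less_irrefl)
  then show ?thesis
    using gauss_norm_ge[OF assms, of "p * q" n] by simp
qed

lemma gauss_norm_mult: "gauss_norm s (p * q) = gauss_norm s p * gauss_norm s q" if "0 \<le> s"
  using gauss_norm_mult_le[OF that] gauss_norm_mult_ge[OF that] by (rule order_antisym)

lemma gauss_norm_const: "gauss_norm s [:c:] = v c"
  by (simp add: gauss_norm_def)

lemma gauss_norm_linear: "gauss_norm s [:c, 1:] = max s (v c)"
proof -
  have "{..Suc 0} = {0, 1}"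
    by auto
  then show ?thesis
    by (simp add: gauss_norm_def max.commute)
qed

text \<open>Substituting \<open>x + a\<close> moves the centre of the disc from 0 to
  \<open>a\<close>.\<close>

lemma gauss_norm_in_berkovich_line:
  assumes "0 \<le> s"
  shows "(\<lambda>f. gauss_norm s (pcompose f [:a, 1:])) \<in> berkovich_line v"
  unfolding berkovich_line_def
proof (intro CollectI conjI allI)
  fix f g :: "'k poly"
  show "gauss_norm s (pcompose (f + g) [:a, 1:])
    \<le> gauss_norm s (pcompose f [:a, 1:]) + gauss_norm s (pcompose g [:a, 1:])"
    using gauss_norm_add_le[OF assms, of "pcompose f [:a, 1:]" "pcompose g [:a, 1:]"]
      gauss_norm_nonneg[OF assms, of "pcompose f [:a, 1:]"]
      gauss_norm_nonneg[OF assms, of "pcompose g [:a, 1:]"]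
    by (simp add: pcompose_add)
qed (auto simp: gauss_norm_nonneg[OF assms] gauss_norm_mult[OF assms] pcompose_mult
      pcompose_const gauss_norm_const)

section \<open>Points of the Berkovich line and their tropicalization\<close>

text \<open>Points of the line are only required to satisfy the ordinary triangle inequality.
  Integers have absolute value at most 1, so the binomial expansion bounds the \<open>n\<close>-th
  power of the left-hand side by \<open>n + 1\<close> times the \<open>n\<close>-th power of the
  maximum, and large \<open>n\<close> removes the factor.\<close>

lemma berkovich_ultrametric:
  assumes "\<rho> \<in> berkovich_line v"
  shows "\<rho> (f + g) \<le> max (\<rho> f) (\<rho> g)"
proof (rule ccontr)
  have nn: "0 \<le> \<rho> f" and add: "\<rho> (f + g) \<le> \<rho> f + \<rho> g" and mul: "\<rho> (f * g) = \<rho> f * \<rho> g"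
    and const: "\<rho> [:c:] = v c" for f g c
    using assms by (auto simp: berkovich_line_def)
  have \<rho>_power: "\<rho> (h ^ n) = \<rho> h ^ n" for h n
    using const[of 1] by (induction n) (auto simp: mul one_pCons)
  have \<rho>_of_nat: "\<rho> (of_nat n) \<le> 1" for n
    using const[of "of_nat n"] of_nat_le_1[of n] by (simp add: of_nat_poly)
  have \<rho>_sum: "\<rho> (sum h A) \<le> (\<Sum>i\<in>A. \<rho> (h i))" for h and A :: "nat set"
  proof (induction A rule: infinite_finite_induct)
    case (insert x A)
    then show ?case
      using add[of "h x" "sum h A"] by simp
  qed (use const[of 0] in auto)
  let ?M = "max (\<rho> f) (\<rho> g)"
  assume "\<not> \<rho> (f + g) \<le> ?M"
  then have less: "?M < \<rho> (f + g)"
    by (simp add: not_le)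
  have M: "0 \<le> ?M"
    using nn[of f] by auto
  have bound: "\<rho> (f + g) ^ n \<le> (real n + 1) * ?M ^ n" for n
  proof -
    have "\<rho> (f + g) ^ n = \<rho> (\<Sum>k\<le>n. of_nat (n choose k) * f ^ k * g ^ (n - k))"
      by (simp add: binomial_ring flip: \<rho>_power)
    also have "\<dots> \<le> (\<Sum>k\<le>n. \<rho> (of_nat (n choose k) * f ^ k * g ^ (n - k)))"
      by (rule \<rho>_sum)
    also have "\<dots> \<le> (\<Sum>k\<le>n. ?M ^ n)"
    proof (rule sum_mono)
      fix k assume "k \<in> {..n}"
      have "\<rho> (of_nat (n choose k) * f ^ k * g ^ (n - k))
        = \<rho> (of_nat (n choose k)) * (\<rho> f ^ k * \<rho> g ^ (n - k))"
        by (simp add: mul \<rho>_power)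
      also have "\<dots> \<le> 1 * (?M ^ k * ?M ^ (n - k))"
        using nn \<rho>_of_nat M by (intro mult_mono power_mono) (auto simp: zero_le_power)
      also have "\<dots> = ?M ^ n"
        using \<open>k \<in> {..n}\<close> by (simp flip: power_add)
      finally show "\<rho> (of_nat (n choose k) * f ^ k * g ^ (n - k)) \<le> ?M ^ n" .
    qed
    finally show ?thesis
      by (simp add: add.commute)
  qed
  show False
  proof (cases "?M = 0")
    case True
    then show False
      using bound[of 1] less by auto
  next
    case False
    then have Mpos: "0 < ?M"
      using M by linarith
    \<comment> \<open>A ratio above 1 would make \<open>q ^ n\<close> grow exponentially, against
      the bound \<open>n + 1\<close>.\<close>
    define q where "q = \<rho> (f + g) / ?M"
    have "1 < q"
      using less Mpos by (simp add: q_def)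
    then have "(\<lambda>n. real n / q ^ n) \<longlonglongrightarrow> 0" "(\<lambda>n. inverse (q ^ n)) \<longlonglongrightarrow> 0"
      using lim_n_over_pown[of q] LIMSEQ_inverse_realpow_zero[of q] by simp_all
    then have "(\<lambda>n. real n / q ^ n + inverse (q ^ n)) \<longlonglongrightarrow> 0 + 0"
      by (rule tendsto_add)
    then have "\<forall>\<^sub>F n in sequentially. real n / q ^ n + inverse (q ^ n) < 1"
      by (rule order_tendstoD) auto
    then obtain n where "real n / q ^ n + inverse (q ^ n) < 1"
      by (auto simp: eventually_sequentially)
    then have "real n + 1 < q ^ n"
      using \<open>1 < q\<close> by (simp add: field_simps)
    then show False
      using bound[of n] Mpos by (simp add: q_def field_simps)
  qed
qed

text \<open>The ultrametric inequality for \<open>x - b = (x - a) + (a - b)\<close> and for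
  \<open>a - b = (x - b) - (x - a)\<close>.\<close>

lemma berkovich_linear_le:
  assumes "\<rho> \<in> berkovich_line v"
  shows "\<rho> [:- b, 1:] \<le> max (\<rho> [:- a, 1:]) (v (a - b))"
    and "v (a - b) \<le> max (\<rho> [:- a, 1:]) (\<rho> [:- b, 1:])"
proof -
  have const: "\<rho> [:c:] = v c" and mul: "\<rho> (f * g) = \<rho> f * \<rho> g" for c f g
    using assms by (auto simp: berkovich_line_def)
  have neg: "\<rho> (- f) = \<rho> f" for f
    using const[of "- 1"] mul[of "[:- 1:]" f] by simp
  show "\<rho> [:- b, 1:] \<le> max (\<rho> [:- a, 1:]) (v (a - b))"
    using berkovich_ultrametric[OF assms, of "[:- a, 1:]" "[:a - b:]"] const by simp
  show "v (a - b) \<le> max (\<rho> [:- a, 1:]) (\<rho> [:- b, 1:])"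
    using berkovich_ultrametric[OF assms, of "- [:- a, 1:]" "[:- b, 1:]"] const[of "a - b"]
    by (simp only: neg) simp
qed

lemma Trop_linear:
  fixes a :: "'r::finite \<Rightarrow> 'k"
  assumes "\<And>i. \<phi> i = [:- a i, 1:]"
  shows "Trop v \<phi> = {\<chi> j. trop_log (max s (v (a i - a j))) | i s. 0 \<le> s}"
proof (intro equalityI subsetI)
  fix y assume "y \<in> Trop v \<phi>"
  then obtain \<rho> where \<rho>: "\<rho> \<in> berkovich_line v" and y: "y = trop_map \<phi> \<rho>"
    by (auto simp: Trop_def)
  have nn: "0 \<le> \<rho> f" for f
    using \<rho> by (auto simp: berkovich_line_def)
  obtain i where i: "\<rho> (\<phi> i) \<le> \<rho> (\<phi> j)" for j
  proof -
    have "Min (range (\<lambda>i. \<rho> (\<phi> i))) \<in> range (\<lambda>i. \<rho> (\<phi> i))"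
      by (intro Min_in) auto
    then obtain i where "Min (range (\<lambda>i. \<rho> (\<phi> i))) = \<rho> (\<phi> i)"
      by (rule rangeE)
    then show ?thesis
      using that[of i] by (metis Min_le finite rangeI finite_imageI)
  qed
  \<comment> \<open>Ultrametric triangles are isosceles: the two longest of the three sides
    \<open>x\<close>, \<open>y\<close>, \<open>d\<close> are equal, and \<open>x\<close> does not
    exceed \<open>y\<close>.\<close>
  have max_eq: "y = max x d" if "x \<le> y" "y \<le> max x d" "d \<le> max x y" for x y d :: real
    using that by linarith
  define s where "s = \<rho> (\<phi> i)"
  have eq: "\<rho> (\<phi> j) = max s (v (a i - a j))" for j
    using i[of j] berkovich_linear_le[OF \<rho>, where a = "a i" and b = "a j"]
    unfolding s_def assms by (rule max_eq)
  have "y = (\<chi> j. trop_log (max s (v (a i - a j))))"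
    by (simp add: y trop_map_def eq)
  then show "y \<in> {\<chi> j. trop_log (max s (v (a i - a j))) | i s. 0 \<le> s}"
    using nn[of "\<phi> i"] unfolding s_def[symmetric] by blast
next
  fix y assume "y \<in> {\<chi> j. trop_log (max s (v (a i - a j))) | i s. 0 \<le> s}"
  then obtain i s where s: "0 \<le> s" and y: "y = (\<chi> j. trop_log (max s (v (a i - a j))))"
    by blast
  let ?\<rho> = "\<lambda>f. gauss_norm s (pcompose f [:a i, 1:])"
  have "y = trop_map \<phi> ?\<rho>"
    by (simp add: y trop_map_def assms pcompose_pCons gauss_norm_linear vec_eq_iff)
  then show "y \<in> Trop v \<phi>"
    using gauss_norm_in_berkovich_line[OF s] by (auto simp: Trop_def)
qed

end

section \<open>The polyhedral complex of a finite ultrametric space\<close>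

lemma le_exp_iff: "0 < x \<Longrightarrow> x \<le> exp y \<longleftrightarrow> ln x \<le> y" for x y :: real
  by (metis exp_le_cancel_iff exp_ln)

text \<open>For finite \<open>T\<close> and \<open>x \<notin> T\<close>, this is the closure of the component of \<open>x\<close> in the complement of
  \<open>T\<close>.\<close>

definition cell :: "real set \<Rightarrow> real \<Rightarrow> real set" where
  "cell T x = {y. \<forall>\<tau>\<in>T. (x < \<tau> \<longrightarrow> y \<le> \<tau>) \<and> (\<tau> < x \<longrightarrow> \<tau> \<le> y)}"

lemma self_in_cell [simp]: "x \<in> cell T x"
  by (auto simp: cell_def)

lemma convex_cell: "convex (cell T x)"
proof -
  have "is_interval (cell T x)"
    unfolding is_interval_1 cell_def by (auto intro: order_trans)
  then show ?thesis
    by (rule is_interval_convex)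
qed

lemma cell_no_between:
  assumes "x \<notin> T" "a \<in> cell T x" "b \<in> cell T x" "\<tau> \<in> T" "a < \<tau>" "\<tau> < b"
  shows False
  using assms by (auto simp: cell_def) (metis linorder_neqE_linordered_idom not_le)

lemma cell_cong:
  assumes "x \<notin> T" "y \<notin> T" "\<And>\<tau>. \<tau> \<in> T \<Longrightarrow> \<tau> < x \<longleftrightarrow> \<tau> < y"
  shows "cell T x = cell T y"
proof -
  have "x < \<tau> \<longleftrightarrow> y < \<tau>" if "\<tau> \<in> T" for \<tau>
    using assms that by (metis linorder_neqE_linordered_idom order_less_asym)
  then show ?thesis
    using assms(3) by (auto simp: cell_def)
qed

lemma cell_eq_of_mem:
  assumes "x \<notin> T" "y \<notin> T" "y \<in> cell T x"
  shows "cell T y = cell T x"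
proof (rule cell_cong)
  fix \<tau> assume "\<tau> \<in> T"
  then have "x < \<tau> \<Longrightarrow> y \<le> \<tau>" "\<tau> < x \<Longrightarrow> \<tau> \<le> y" "\<tau> \<noteq> x" "\<tau> \<noteq> y"
    using assms by (auto simp: cell_def)
  then show "\<tau> < y \<longleftrightarrow> \<tau> < x"
    by (cases \<tau> x rule: linorder_cases) auto
qed (use assms in auto)

text \<open>A cell depends only on the set of elements of \<open>T\<close> to the left of
  \<open>x\<close>, so there are at most as many cells as subsets of \<open>T\<close>.\<close>

lemma finite_cells:
  assumes "finite T"
  shows "finite {cell T x | x. x \<notin> T}"
proof (rule finite_subset)
  let ?F = "\<lambda>S. {y. \<forall>\<tau>\<in>T. (\<tau> \<notin> S \<longrightarrow> y \<le> \<tau>) \<and> (\<tau> \<in> S \<longrightarrow> \<tau> \<le> y)}"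
  show "{cell T x | x. x \<notin> T} \<subseteq> ?F ` Pow T"
  proof clarify
    fix x assume "x \<notin> T"
    then have "x < \<tau> \<longleftrightarrow> \<tau> \<notin> {\<tau>\<in>T. \<tau> < x}" "\<tau> < x \<longleftrightarrow> \<tau> \<in> {\<tau>\<in>T. \<tau> < x}"
      if "\<tau> \<in> T" for \<tau>
      using that by (cases \<tau> x rule: linorder_cases; auto)+
    then have "cell T x = ?F {\<tau>\<in>T. \<tau> < x}"
      unfolding cell_def by blast
    then show "cell T x \<in> ?F ` Pow T"
      by (rule image_eqI) blast
  qed
qed (use assms in auto)

text \<open>The endpoints are the neighbours of \<open>x\<close> in \<open>T\<close> as far as they
  exist. Bounded cells become segments, half-bounded ones half lines, and the full line occurs only
  for empty \<open>T\<close>.\<close>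

lemma cell_cases:
  assumes "finite T" "x \<notin> T"
  obtains (Icc) a b where "a < x" "x < b" "cell T x = {a..b}"
    | (Ici) a where "a < x" "cell T x = {a..}"
    | (Iic) b where "x < b" "cell T x = {..b}"
    | (UNIV) "cell T x = UNIV"
proof -
  let ?L = "{\<tau>\<in>T. \<tau> < x}" and ?U = "{\<tau>\<in>T. x < \<tau>}"
  have fin: "finite ?L" "finite ?U"
    using assms by auto
  have L: "Max ?L < x" "(\<forall>\<tau>\<in>T. \<tau> < x \<longrightarrow> \<tau> \<le> y) \<longleftrightarrow> Max ?L \<le> y" if "?L \<noteq> {}" for y
    using fin(1) that Max_in[OF fin(1) that] by (auto simp: Max_le_iff[OF fin(1) that])
  have U: "x < Min ?U" "(\<forall>\<tau>\<in>T. x < \<tau> \<longrightarrow> y \<le> \<tau>) \<longleftrightarrow> y \<le> Min ?U" if "?U \<noteq> {}" for y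
    using fin(2) that Min_in[OF fin(2) that] by (auto simp: Min_ge_iff[OF fin(2) that])
  have c: "cell T x = {y. (\<forall>\<tau>\<in>T. x < \<tau> \<longrightarrow> y \<le> \<tau>) \<and> (\<forall>\<tau>\<in>T. \<tau> < x \<longrightarrow> \<tau> \<le> y)}"
    by (auto simp: cell_def)
  show thesis
  proof (cases "?L = {}"; cases "?U = {}")
    assume "?L = {}" "?U = {}"
    then have "cell T x = UNIV"
      unfolding c by blast
    then show thesis
      by (rule UNIV)
  next
    assume "?L = {}" "?U \<noteq> {}"
    then have "cell T x = {..Min ?U}"
      unfolding c U(2)[OF \<open>?U \<noteq> {}\<close>] by blast
    then show thesis
      by (rule Iic[OF U(1)[OF \<open>?U \<noteq> {}\<close>]])
  next
    assume "?L \<noteq> {}" "?U = {}"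
    then have "cell T x = {Max ?L..}"
      unfolding c L(2)[OF \<open>?L \<noteq> {}\<close>] by blast
    then show thesis
      by (rule Ici[OF L(1)[OF \<open>?L \<noteq> {}\<close>]])
  next
    assume "?L \<noteq> {}" "?U \<noteq> {}"
    then have "cell T x = {Max ?L..Min ?U}"
      unfolding c L(2)[OF \<open>?L \<noteq> {}\<close>] U(2)[OF \<open>?U \<noteq> {}\<close>] by auto
    then show thesis
      by (rule Icc[OF L(1)[OF \<open>?L \<noteq> {}\<close>] U(1)[OF \<open>?U \<noteq> {}\<close>]])
  qed
qed

lemma cell_interior:
  assumes "finite T" "x \<notin> T" "w \<in> cell T x" "w \<notin> T"
  shows "w \<in> interior (cell T x)"
proof -
  have "w \<in> interior (cell T w)"
    using assms(1,4) by (cases rule: cell_cases) auto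
  then show ?thesis
    using cell_eq_of_mem[OF assms(2,4,3)] by simp
qed

lemma cell_not_interior:
  assumes "x \<notin> T" "w \<in> cell T x" "w \<in> T"
  shows "w \<notin> interior (cell T x)"
proof
  assume "w \<in> interior (cell T x)"
  then obtain e where e: "0 < e" "ball w e \<subseteq> cell T x"
    by (auto simp: mem_interior)
  then have "w - e / 2 \<in> cell T x" "w + e / 2 \<in> cell T x"
    by (auto simp: subset_eq dist_real_def)
  then show False
    using cell_no_between[OF assms(1) _ _ assms(3)] e(1) by fastforce
qed

section \<open>Paths, vertices and edges of the tree\<close>

lemma trop_log_max: "0 \<le> x \<Longrightarrow> 0 \<le> y \<Longrightarrow> trop_log (max x y) = max (trop_log x) (trop_log y)"
  by (auto simp: trop_log_def max_def)

text \<open>The argument of \<open>ln\<close> is positive even when \<open>d i j = 0\<close>, so no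
  value at infinity arises for real \<open>t\<close>.\<close>

definition tree_path :: "('r::finite \<Rightarrow> 'r \<Rightarrow> real) \<Rightarrow> 'r \<Rightarrow> real \<Rightarrow> real ^ 'r" where
  "tree_path d i t = (\<chi> j. ln (max (exp t) (d i j)))"

text \<open>This is the right derivative of the path at \<open>t\<close>, and the indicator vector
  of the closed ball of radius \<open>exp t\<close> around \<open>i\<close>.\<close>

definition tree_dir :: "('r::finite \<Rightarrow> 'r \<Rightarrow> real) \<Rightarrow> 'r \<Rightarrow> real \<Rightarrow> real ^ 'r" where
  "tree_dir d i t = (\<chi> j. if d i j \<le> exp t then 1 else 0)"

text \<open>Many pairs of an index and a parameter describe the same edge; collecting the edges as
  sets of points identifies them.\<close>

definition tree_complex ::
  "('r::finite \<Rightarrow> 'r \<Rightarrow> real) \<Rightarrow> ('r \<Rightarrow> real set) \<Rightarrow> 'r weighted_complex" where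
  "tree_complex d T =
    \<lparr>verts = {tree_path d i t | i t. t \<in> T i},
     edges = {tree_path d i ` cell (T i) t | i t. t \<notin> T i},
     weight = (\<lambda>_. 1)\<rparr>"

definition tree_path_ext ::
  "('r::finite \<Rightarrow> 'r \<Rightarrow> real) \<Rightarrow> 'r \<Rightarrow> ereal \<Rightarrow> ereal ^ 'r" where
  "tree_path_ext d i t = (\<chi> j. max t (trop_log (d i j)))"

text \<open>Meant for a closed ball \<open>B\<close> and the map sending a point to the edge below
  it: the fibres are the open balls into which \<open>B\<close> splits.\<close>

lemma sum_indicator_fibres:
  fixes f :: "'n::finite \<Rightarrow> 'b"
  shows "(\<Sum>y\<in>f ` B. (\<chi> k. if k \<in> B \<and> f k = y then 1 else (0::real))) =
    (\<chi> k. if k \<in> B then 1 else 0)"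
proof -
  have "(\<Sum>y\<in>f ` B. if k \<in> B \<and> f k = y then 1 else 0 :: real) = (if k \<in> B then 1 else 0)" for k
  proof (cases "k \<in> B")
    case True
    moreover have "finite (f ` B)"
      by simp
    ultimately show ?thesis
      by simp
  qed auto
  then show ?thesis
    by (simp add: vec_eq_iff)
qed

text \<open>The sets \<open>T i\<close> are the parameters of the vertices on the \<open>i\<close>-th path.  The compatibility
  condition says that the paths have the same vertices where they coincide.\<close>

locale ultrametric_tree =
  fixes d :: "'r::finite \<Rightarrow> 'r \<Rightarrow> real" and T :: "'r \<Rightarrow> real set"
  assumes d_nonneg: "0 \<le> d i j" and d_self [simp]: "d i i = 0" and d_sym: "d i j = d j i"
    and d_ultra: "d i k \<le> max (d i j) (d j k)"
    and finite_T: "finite (T i)"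
    and T_dist: "0 < d i j \<Longrightarrow> ln (d i j) \<in> T i"
    and T_compat: "t \<in> T i \<Longrightarrow> d i j \<le> exp t \<Longrightarrow> t \<in> T j"
begin

abbreviation "pt \<equiv> tree_path d"
abbreviation "dir \<equiv> tree_dir d"
abbreviation "edge i t \<equiv> tree_path d i ` cell (T i) t"

lemma path_nth_self [simp]: "pt i t $ i = t"
  by (simp add: tree_path_def)

text \<open>Every point of an ultrametric ball is a centre, so distances from \<open>i\<close> and
  from \<open>j\<close> differ only inside the ball.\<close>

lemma ball_eq:
  assumes "d i j \<le> r"
  shows "max r (d i k) = max r (d j k)"
  using assms d_ultra[of i k j] d_ultra[of j k i] d_sym[of i j] by linarith

text \<open>The \<open>i\<close>-th and the \<open>j\<close>-th coordinates alone give
  \<open>exp t = max (exp u) (d i j)\<close> and \<open>exp u = max (exp t) (d i j)\<close>, which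
  forces equal parameters above the merging height.\<close>

lemma path_eq_iff: "pt i t = pt j u \<longleftrightarrow> t = u \<and> d i j \<le> exp t"
proof
  assume "pt i t = pt j u"
  then have "pt i t $ i = pt j u $ i" "pt i t $ j = pt j u $ j"
    by simp_all
  then have t: "t = ln (max (exp u) (d i j))" and u: "u = ln (max (exp t) (d i j))"
    by (simp_all add: tree_path_def d_sym)
  have "exp (ln (max (exp a) b)) = max (exp a) b" for a b :: real
    by (simp add: less_max_iff_disj)
  then have "exp t = max (exp u) (d i j)" "exp u = max (exp t) (d i j)"
    using t u by metis+
  then have "exp t = exp u" "d i j \<le> exp t"
    by linarith+
  then show "t = u \<and> d i j \<le> exp t"
    by simp
next
  assume "t = u \<and> d i j \<le> exp t"
  then show "pt i t = pt j u"
    using ball_eq[of i j "exp t"] by (auto simp: tree_path_def fun_eq_iff)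
qed

text \<open>The path bends only at logarithms of distances from \<open>i\<close>, and these belong
  to \<open>T i\<close>; hence no bend lies inside a cell.\<close>

lemma d_le_exp_cell:
  assumes "t \<notin> T i" "w \<in> cell (T i) t"
  shows "d i j \<le> exp t \<Longrightarrow> d i j \<le> exp w" and "\<not> d i j \<le> exp t \<Longrightarrow> exp w \<le> d i j"
proof -
  assume *: "d i j \<le> exp t"
  show "d i j \<le> exp w"
  proof (cases "d i j = 0")
    case False
    then have pos: "0 < d i j"
      using d_nonneg[of i j] by linarith
    then have "ln (d i j) \<noteq> t" "ln (d i j) \<le> t"
      using assms(1) T_dist[OF pos] * by (auto simp: le_exp_iff)
    then show ?thesis
      using assms(2) T_dist[OF pos] pos by (auto simp: cell_def le_exp_iff)
  qed simp
next
  assume *: "\<not> d i j \<le> exp t"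
  then have pos: "0 < d i j"
    by (meson exp_gt_zero not_le order_less_trans)
  have "t < ln (d i j)"
    using * pos by (simp add: le_exp_iff)
  then have "w \<le> ln (d i j)"
    using assms(2) T_dist[OF pos] by (auto simp: cell_def)
  then show "exp w \<le> d i j"
    using pos by (simp add: ln_ge_iff)
qed

lemma path_affine:
  assumes "t \<notin> T i" "w \<in> cell (T i) t"
  shows "pt i w = pt i t + (w - t) *\<^sub>R dir i t"
proof -
  have "ln (max (exp w) (d i j)) = ln (max (exp t) (d i j)) + (w - t) * (if d i j \<le> exp t then 1 else 0)" for j
    using d_le_exp_cell[OF assms, of j] by (auto simp: max_def)
  then show ?thesis
    by (simp add: vec_eq_iff tree_path_def tree_dir_def)
qed

text \<open>From \<open>ln (d i j)\<close> upwards the two paths have the same vertices. The further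
  elements of \<open>T j\<close> lie below that height and therefore below the whole cell.\<close>

lemma edge_subset:
  assumes "t \<notin> T i" "d i j \<le> exp t"
  shows "edge i t \<subseteq> edge j t"
proof
  fix z assume "z \<in> edge i t"
  then obtain w where w: "w \<in> cell (T i) t" and z: "z = pt i w"
    by auto
  have dw: "d i j \<le> exp w"
    using d_le_exp_cell(1)[OF assms(1) w assms(2)] .
  have "w \<in> cell (T j) t"
    unfolding cell_def
  proof (intro CollectI ballI conjI impI)
    fix \<tau> assume "\<tau> \<in> T j" "t < \<tau>"
    then have "\<tau> \<in> T i"
      using T_compat[of \<tau> j i] assms(2) by (simp add: d_sym[of j i] order_trans[of _ "exp t"])
    then show "w \<le> \<tau>"
      using w \<open>t < \<tau>\<close> by (auto simp: cell_def)
  next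
    fix \<tau> assume \<tau>: "\<tau> \<in> T j" "\<tau> < t"
    show "\<tau> \<le> w"
    proof (cases "d i j \<le> exp \<tau>")
      case True
      then have "\<tau> \<in> T i"
        using T_compat[of \<tau> j i] \<tau> by (simp add: d_sym[of j i])
      then show ?thesis
        using w \<tau> by (auto simp: cell_def)
    next
      case False
      then have "exp \<tau> < exp w"
        using dw by linarith
      then show ?thesis
        by simp
    qed
  qed
  moreover have "z = pt j w"
    using dw by (simp add: z path_eq_iff)
  ultimately show "z \<in> edge j t"
    by blast
qed

lemma T_iff: "d i j \<le> exp t \<Longrightarrow> t \<in> T i \<longleftrightarrow> t \<in> T j"
  using T_compat[of t i j] T_compat[of t j i] d_sym[of i j] by auto

lemma edge_cong:
  assumes "t \<notin> T i" "d i j \<le> exp t"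
  shows "edge i t = edge j t"
  using assms edge_subset[of t i j] edge_subset[of t j i] T_iff[of i j t] d_sym[of i j] by auto

lemma edge_is_edge:
  assumes "t \<notin> T i"
  shows "is_edge (edge i t)"
proof -
  let ?u = "dir i t" and ?f = "\<lambda>w. pt i t + (w - t) *\<^sub>R dir i t"
  have "?u $ i = 1"
    by (simp add: tree_dir_def)
  then have u: "?u \<noteq> 0"
    by auto
  have E: "edge i t = ?f ` cell (T i) t"
    by (rule image_cong[OF refl], rule path_affine[OF assms])
  show ?thesis
    using finite_T[of i] assms
  proof (cases rule: cell_cases)
    case (Icc a b)
    have "edge i t = closed_segment (?f a) (?f b)"
    proof -
      have "?f ` closed_segment a b = closed_segment (?f a) (?f b)"
      proof (intro equalityI subsetI)
        fix z assume "z \<in> ?f ` closed_segment a b"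
        then obtain s where s: "0 \<le> s" "s \<le> 1" "z = ?f ((1 - s) *\<^sub>R a + s *\<^sub>R b)"
          by (auto simp: in_segment)
        then have "z = (1 - s) *\<^sub>R ?f a + s *\<^sub>R ?f b"
          by (simp add: algebra_simps)
        then show "z \<in> closed_segment (?f a) (?f b)"
          using s by (auto simp: in_segment)
      next
        fix z assume "z \<in> closed_segment (?f a) (?f b)"
        then obtain s where s: "0 \<le> s" "s \<le> 1" "z = (1 - s) *\<^sub>R ?f a + s *\<^sub>R ?f b"
          by (auto simp: in_segment)
        then have "z = ?f ((1 - s) *\<^sub>R a + s *\<^sub>R b)"
          by (simp add: algebra_simps)
        then show "z \<in> ?f ` closed_segment a b"
          using s by (auto simp: in_segment intro!: imageI)
      qed
      then show ?thesis
        using Icc(1,2) E by (simp only: Icc(3)) (simp add: closed_segment_eq_real_ivl)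
    qed
    moreover have "?f a \<noteq> ?f b"
      using Icc u by simp
    ultimately show ?thesis
      unfolding is_edge_def by blast
  next
    case (Ici a)
    have "edge i t = {?f a + s *\<^sub>R ?u | s. 0 \<le> s}"
    proof (intro equalityI subsetI)
      fix z assume "z \<in> edge i t"
      then obtain w where "w \<in> cell (T i) t" "z = ?f w"
        unfolding E by blast
      then have "a \<le> w" "z = ?f w"
        by (simp_all add: Ici)
      then show "z \<in> {?f a + s *\<^sub>R ?u | s. 0 \<le> s}"
        by (intro CollectI exI[of _ "w - a"]) (auto simp: algebra_simps)
    next
      fix z assume "z \<in> {?f a + s *\<^sub>R ?u | s. 0 \<le> s}"
      then obtain s where s: "0 \<le> s" "z = ?f a + s *\<^sub>R ?u"
        by auto
      have eq: "?f a + s *\<^sub>R ?u = ?f (a + s)"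
        by (simp add: algebra_simps)
      have "z = ?f (a + s)"
        using s(2) by (simp only: eq)
      moreover have "a + s \<in> cell (T i) t"
        using s(1) by (simp add: Ici)
      ultimately show "z \<in> edge i t"
        unfolding E by blast
    qed
    then show ?thesis
      using u unfolding is_edge_def by blast
  next
    case (Iic b)
    have "edge i t = {?f b + s *\<^sub>R (- ?u) | s. 0 \<le> s}"
    proof (intro equalityI subsetI)
      fix z assume "z \<in> edge i t"
      then obtain w where "w \<in> cell (T i) t" "z = ?f w"
        unfolding E by blast
      then have "w \<le> b" "z = ?f w"
        by (simp_all add: Iic)
      then show "z \<in> {?f b + s *\<^sub>R (- ?u) | s. 0 \<le> s}"
        by (intro CollectI exI[of _ "b - w"]) (auto simp: algebra_simps)
    next
      fix z assume "z \<in> {?f b + s *\<^sub>R (- ?u) | s. 0 \<le> s}"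
      then obtain s where s: "0 \<le> s" "z = ?f b + s *\<^sub>R (- ?u)"
        by auto
      have eq: "?f b + s *\<^sub>R (- ?u) = ?f (b - s)"
        by (simp add: algebra_simps)
      have "z = ?f (b - s)"
        using s(2) by (simp only: eq)
      moreover have "b - s \<in> cell (T i) t"
        using s(1) by (simp add: Iic)
      ultimately show "z \<in> edge i t"
        unfolding E by blast
    qed
    moreover have "- ?u \<noteq> 0"
      using u by simp
    ultimately show ?thesis
      unfolding is_edge_def by blast
  next
    case UNIV
    have "edge i t = range (\<lambda>s. ?f 0 + s *\<^sub>R ?u)"
      unfolding E by (subst UNIV, intro image_cong) (auto simp: algebra_simps)
    then show ?thesis
      using u unfolding is_edge_def by blast
  qed
qed

lemma dir_nth_self [simp]: "dir i t $ i = 1"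
  by (simp add: tree_dir_def)

lemma path_step:
  assumes "t \<notin> T i" "w \<in> cell (T i) t" "x \<in> cell (T i) t"
  shows "pt i x = pt i w + (x - w) *\<^sub>R dir i t"
  by (subst path_affine[OF assms(1,3)], subst path_affine[OF assms(1,2)]) (simp add: algebra_simps)

lemma edge_affine_image:
  assumes "t \<notin> T i"
  shows "edge i t = (\<lambda>w. (pt i t - t *\<^sub>R dir i t) + w *\<^sub>R dir i t) ` cell (T i) t"
proof (rule image_cong[OF refl])
  fix w assume "w \<in> cell (T i) t"
  then show "pt i w = (pt i t - t *\<^sub>R dir i t) + w *\<^sub>R dir i t"
    using path_affine[OF assms, of w] by (simp add: scaleR_left_diff_distrib)
qed

text \<open>The edge is the image of an interval under an injective affine map, and the elements of
  \<open>T i\<close> in the cell are exactly its endpoints.\<close>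

lemma rel_interior_edge:
  assumes "t \<notin> T i"
  shows "rel_interior (edge i t) = pt i ` (cell (T i) t - T i)"
proof -
  let ?u = "dir i t" and ?c = "pt i t - t *\<^sub>R dir i t"
  have u: "?u \<noteq> 0"
    using dir_nth_self[of i t] by (metis zero_index zero_neq_one)
  have int: "interior (cell (T i) t) = cell (T i) t - T i"
    using cell_interior[OF finite_T assms] cell_not_interior[OF assms] interior_subset by blast
  have lin: "bounded_linear (\<lambda>w. w *\<^sub>R ?u)" "inj (\<lambda>w. w *\<^sub>R ?u)"
    using u by (auto intro: bounded_linear_scaleR_left injI)
  have "edge i t = (+) ?c ` (\<lambda>w. w *\<^sub>R ?u) ` cell (T i) t"
    by (simp add: edge_affine_image[OF assms] image_image)
  then have "rel_interior (edge i t) = (+) ?c ` (\<lambda>w. w *\<^sub>R ?u) ` rel_interior (cell (T i) t)"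
    by (simp only: rel_interior_translation rel_interior_injective_linear_image[OF lin])
  also have "rel_interior (cell (T i) t) = cell (T i) t - T i"
    using rel_interior_nonempty_interior[of "cell (T i) t"] unfolding int
    using self_in_cell[of t "T i"] assms by blast
  also have "(+) ?c ` (\<lambda>w. w *\<^sub>R ?u) ` (cell (T i) t - T i) = pt i ` (cell (T i) t - T i)"
    unfolding image_image
  proof (rule image_cong[OF refl])
    fix w assume "w \<in> cell (T i) t - T i"
    then show "?c + w *\<^sub>R ?u = pt i w"
      using path_affine[OF assms, of w] by (simp add: scaleR_left_diff_distrib)
  qed
  finally show ?thesis .
qed

text \<open>The \<open>i\<close>-th coordinate maps the edge affinely and bijectively onto the cell,
  so extreme points correspond to endpoints of an interval.\<close>

lemma extreme_point_edge_iff: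
  assumes "t \<notin> T i"
  shows "z extreme_point_of edge i t \<longleftrightarrow> z \<in> pt i ` (cell (T i) t \<inter> T i)"
proof
  assume z: "z extreme_point_of edge i t"
  \<comment> \<open>A singleton is its own relative interior; it has to be excluded before an
    extreme point can be placed on the relative boundary.\<close>
  have "edge i t \<noteq> {z}"
  proof
    assume *: "edge i t = {z}"
    obtain e where e: "0 < e" "ball t e \<subseteq> cell (T i) t"
      using cell_interior[OF finite_T assms self_in_cell assms] by (auto simp: mem_interior)
    then have "t + e / 2 \<in> cell (T i) t"
      by (auto simp: subset_eq dist_real_def)
    then have "pt i (t + e / 2) = pt i t"
      using * self_in_cell[of t "T i"] by (metis image_eqI singletonD)
    then show False
      using e(1) by (simp add: path_eq_iff)
  qed
  then have "z \<notin> rel_interior (edge i t)"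
    using extreme_point_not_in_REL_INTERIOR[OF z] by simp
  then show "z \<in> pt i ` (cell (T i) t \<inter> T i)"
    using z unfolding rel_interior_edge[OF assms] by (auto simp: extreme_point_of_def)
next
  assume "z \<in> pt i ` (cell (T i) t \<inter> T i)"
  then obtain w where w: "w \<in> cell (T i) t" "w \<in> T i" "z = pt i w"
    by auto
  show "z extreme_point_of edge i t"
    unfolding extreme_point_of_def
  proof (intro conjI ballI notI)
    show "z \<in> edge i t"
      using w by auto
  next
    fix a b assume "a \<in> edge i t" "b \<in> edge i t" and z: "z \<in> open_segment a b"
    then obtain x y where x: "x \<in> cell (T i) t" "a = pt i x" and y: "y \<in> cell (T i) t" "b = pt i y"
      by auto
    obtain s where s: "0 < s" "s < 1" "a \<noteq> b" "z = (1 - s) *\<^sub>R a + s *\<^sub>R b"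
      using z by (auto simp: in_segment)
    have "z $ i = (1 - s) * a $ i + s * b $ i"
      by (simp add: s(4))
    then have "w = (1 - s) * x + s * y"
      by (simp add: w x y)
    then have ws: "w - x = s * (y - x)" "y - w = (1 - s) * (y - x)"
      by (simp_all add: algebra_simps)
    have "x \<noteq> y"
      using s(3) x y by auto
    show False
    proof (cases "x < y")
      case True
      then have "x < w" "w < y"
        using ws s(1,2) by (smt (verit) mult_pos_pos)+
      then show False
        using cell_no_between[OF assms x(1) y(1) w(2)] by simp
    next
      case False
      then have "y < x"
        using \<open>x \<noteq> y\<close> by simp
      then have "0 < s * (x - y)" "0 < (1 - s) * (x - y)"
        using s by simp_all
      then have "y < w" "w < x"
        using ws by (auto simp: algebra_simps)
      then show False
        using cell_no_between[OF assms y(1) x(1) w(2)] by simp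
    qed
  qed
qed

lemma direction_space_edge:
  assumes "t \<notin> T i"
  shows "direction_space (edge i t) = span {dir i t}"
proof -
  have diff: "pt i x - pt i y = (x - y) *\<^sub>R dir i t"
    if "x \<in> cell (T i) t" "y \<in> cell (T i) t" for x y
    by (subst path_affine[OF assms that(1)], subst path_affine[OF assms that(2)])
      (simp add: algebra_simps)
  obtain e where e: "0 < e" "ball t e \<subseteq> cell (T i) t"
    using cell_interior[OF finite_T assms self_in_cell assms] by (auto simp: mem_interior)
  then have "t + e / 2 \<in> cell (T i) t"
    by (auto simp: subset_eq dist_real_def)
  then have "(e / 2) *\<^sub>R dir i t \<in> {x - y |x y. x \<in> edge i t \<and> y \<in> edge i t}"
    using diff[of "t + e / 2" t] self_in_cell[of t "T i"]
    by (intro CollectI exI[of _ "pt i (t + e / 2)"] exI[of _ "pt i t"] conjI imageI) simp_all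
  then have "(2 / e) *\<^sub>R ((e / 2) *\<^sub>R dir i t) \<in> direction_space (edge i t)"
    unfolding direction_space_def by (intro span_mul span_base)
  then have "dir i t \<in> direction_space (edge i t)"
    using e(1) by simp
  then have "span {dir i t} \<subseteq> direction_space (edge i t)"
    unfolding direction_space_def by (intro span_minimal) (auto simp: subspace_span)
  moreover have "{x - y |x y. x \<in> edge i t \<and> y \<in> edge i t} \<subseteq> span {dir i t}"
    using diff by (auto simp: span_singleton)
  then have "direction_space (edge i t) \<subseteq> span {dir i t}"
    unfolding direction_space_def by (intro span_minimal) (auto simp: subspace_span)
  ultimately show ?thesis
    by blast
qed

text \<open>The \<open>i\<close>-th entry of the direction vector is 1, so the scalar can be read
  off from an integral multiple.\<close>

lemma integral_direction_iff:
  assumes "t \<notin> T i"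
  shows "x \<in> integral_vectors \<inter> direction_space (edge i t) \<longleftrightarrow> (\<exists>k::int. x = of_int k *\<^sub>R dir i t)"
proof
  assume x: "x \<in> integral_vectors \<inter> direction_space (edge i t)"
  then obtain c where c: "x = c *\<^sub>R dir i t"
    by (auto simp: direction_space_edge[OF assms] span_singleton)
  have "x $ i \<in> \<int>"
    using x by (auto simp: integral_vectors_def)
  then have "c \<in> \<int>"
    by (simp add: c)
  then show "\<exists>k::int. x = of_int k *\<^sub>R dir i t"
    using c by (auto elim: Ints_cases)
next
  assume "\<exists>k::int. x = of_int k *\<^sub>R dir i t"
  then show "x \<in> integral_vectors \<inter> direction_space (edge i t)"
    by (auto simp: direction_space_edge[OF assms] span_singleton integral_vectors_def tree_dir_def)
qed

text \<open>Here \<open>t\<close> is an interior parameter and \<open>w\<close> an end of the cell.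
  The sign records whether the path leaves the edge at \<open>w\<close> upwards or
  downwards.\<close>

lemma outward_primitive_edge:
  assumes "t \<notin> T i" "w \<in> cell (T i) t" "w \<in> T i"
  shows "outward_primitive (pt i w) (edge i t) = sgn (w - t) *\<^sub>R dir i t"
  unfolding outward_primitive_def
proof (rule the_equality)
  let ?u = "dir i t" and ?s = "sgn (w - t)"
  have "w \<noteq> t"
    using assms by auto
  then have s: "?s = 1 \<or> ?s = - 1" "(w - t) = \<bar>w - t\<bar> * ?s"
    by (auto simp: sgn_real_def)
  obtain s' :: int where s': "?s = of_int s'" "s' * s' = 1"
    using s(1) by (metis of_int_1 of_int_minus mult_1 mult_minus1 minus_minus)
  have "pt i w - \<bar>w - t\<bar> *\<^sub>R (?s *\<^sub>R ?u) = pt i t"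
    using path_affine[OF assms(1,2)] s(2) by simp
  then have in_edge: "pt i w - \<bar>w - t\<bar> *\<^sub>R (?s *\<^sub>R ?u) \<in> edge i t"
    by simp
  show "?s *\<^sub>R ?u \<in> integral_vectors \<inter> direction_space (edge i t) \<and>
    (\<forall>x\<in>integral_vectors \<inter> direction_space (edge i t). \<exists>k::int. x = of_int k *\<^sub>R (?s *\<^sub>R ?u)) \<and>
    (\<exists>r>0. pt i w - r *\<^sub>R (?s *\<^sub>R ?u) \<in> edge i t)"
  proof (intro conjI ballI)
    show "?s *\<^sub>R ?u \<in> integral_vectors \<inter> direction_space (edge i t)"
      unfolding integral_direction_iff[OF assms(1)] s' by blast
  next
    fix x assume "x \<in> integral_vectors \<inter> direction_space (edge i t)"
    then obtain k :: int where "x = of_int k *\<^sub>R ?u"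
      unfolding integral_direction_iff[OF assms(1)] by blast
    also have "\<dots> = of_int (k * s') *\<^sub>R (?s *\<^sub>R ?u)"
      using s'(2) by (simp add: s'(1) mult.assoc flip: of_int_mult)
    finally show "\<exists>k::int. x = of_int k *\<^sub>R (?s *\<^sub>R ?u)" ..
  next
    show "\<exists>r>0. pt i w - r *\<^sub>R (?s *\<^sub>R ?u) \<in> edge i t"
      using in_edge \<open>w \<noteq> t\<close> by (intro exI[of _ "\<bar>w - t\<bar>"]) auto
  qed
  fix x assume x: "x \<in> integral_vectors \<inter> direction_space (edge i t) \<and>
    (\<forall>y\<in>integral_vectors \<inter> direction_space (edge i t). \<exists>k::int. y = of_int k *\<^sub>R x) \<and>
    (\<exists>r>0. pt i w - r *\<^sub>R x \<in> edge i t)"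
  then obtain k :: int where k: "x = of_int k *\<^sub>R ?u"
    unfolding integral_direction_iff[OF assms(1)] by blast
  have "?u \<in> integral_vectors \<inter> direction_space (edge i t)"
    unfolding integral_direction_iff[OF assms(1)] by (intro exI[of _ 1]) simp
  \<comment> \<open>Two generators of the same rank one group are integer multiples of each other;
    comparing \<open>i\<close>-th entries gives \<open>k' * k = 1\<close>, so only the sign is
    open.\<close>
  then obtain k' :: int where "?u = of_int k' *\<^sub>R x"
    using x by blast
  then have "?u $ i = (of_int k' *\<^sub>R x) $ i"
    by simp
  then have "(1::real) = of_int (k' * k)"
    by (simp add: k)
  then have "k' * k = 1"
    by (metis of_int_eq_1_iff)
  then have k1: "k = 1 \<or> k = - 1"
    using zmult_eq_1_iff by blast
  obtain r y where r: "0 < r" "y \<in> cell (T i) t" "pt i w - r *\<^sub>R x = pt i y"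
    using x by (metis imageE)
  \<comment> \<open>The \<open>i\<close>-th coordinate gives the parameter \<open>y\<close> of the
    point reached from \<open>w\<close>. The edge does not continue beyond \<open>w\<close>, which
    settles the sign of \<open>k\<close>.\<close>
  have "(pt i w - r *\<^sub>R x) $ i = pt i y $ i"
    by (simp add: r)
  then have y: "y = w - r * of_int k"
    by (simp add: k)
  show "x = ?s *\<^sub>R ?u"
  proof (cases "t < w")
    case True
    then have "y \<le> w"
      using cell_no_between[OF assms(1) self_in_cell r(2) assms(3)] by fastforce
    then have "k = 1"
      using k1 y r(1) by auto
    then show ?thesis
      using True k by simp
  next
    case False
    then have "w < t"
      using \<open>w \<noteq> t\<close> by simp
    then have "w \<le> y"
      using cell_no_between[OF assms(1) r(2) self_in_cell assms(3)] by fastforce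
    then have "k = - 1"
      using k1 y r(1) by auto
    then show ?thesis
      using \<open>w < t\<close> k by simp
  qed
qed

lemma verts_iff: "pt i t \<in> verts (tree_complex d T) \<longleftrightarrow> t \<in> T i"
proof
  assume "pt i t \<in> verts (tree_complex d T)"
  then obtain j where "d i j \<le> exp t" "t \<in> T j"
    by (auto simp: tree_complex_def path_eq_iff)
  then show "t \<in> T i"
    using T_iff by simp
qed (auto simp: tree_complex_def)

lemma edgeI: "t \<notin> T i \<Longrightarrow> edge i t \<in> edges (tree_complex d T)"
  by (auto simp: tree_complex_def)

lemma edgeE:
  assumes "\<sigma> \<in> edges (tree_complex d T)"
  obtains i t where "t \<notin> T i" "\<sigma> = edge i t"
  using assms by (auto simp: tree_complex_def)

text \<open>Two different edges share no interior point, and the paths agree on an interval, so that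
  two common points would enclose a common interior point.\<close>

lemma edges_intersection:
  assumes "t \<notin> T i" "u \<notin> T j" "edge i t \<noteq> edge j u" "z \<in> edge i t" "z \<in> edge j u"
    and "y \<in> edge i t" "y \<in> edge j u"
  shows "z \<in> verts (tree_complex d T)" and "y = z"
proof -
  have vertex: "w \<in> T i" if w: "w \<in> cell (T i) t" "w \<in> cell (T j) u" "d i j \<le> exp w" for w
  proof (rule ccontr)
    assume "w \<notin> T i"
    then have "w \<notin> T j"
      using T_iff w(3) by blast
    have "edge i t = edge i w"
      using cell_eq_of_mem[OF assms(1) \<open>w \<notin> T i\<close> w(1)] by simp
    also have "\<dots> = edge j w"
      using edge_cong[OF \<open>w \<notin> T i\<close> w(3)] .
    also have "\<dots> = edge j u"
      using cell_eq_of_mem[OF assms(2) \<open>w \<notin> T j\<close> w(2)] by simp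
    finally show False
      using assms(3) by contradiction
  qed
  have common: "\<exists>w. w \<in> cell (T i) t \<and> w \<in> cell (T j) u \<and> d i j \<le> exp w \<and> x = pt i w"
    if "x \<in> edge i t" "x \<in> edge j u" for x
    using that by (auto simp: path_eq_iff)
  obtain w where w: "w \<in> cell (T i) t" "w \<in> cell (T j) u" "d i j \<le> exp w" "z = pt i w"
    using common[OF assms(4,5)] by blast
  obtain x where x: "x \<in> cell (T i) t" "x \<in> cell (T j) u" "d i j \<le> exp x" "y = pt i x"
    using common[OF assms(6,7)] by blast
  show "z \<in> verts (tree_complex d T)"
    using vertex[OF w(1,2,3)] w(4) by (simp add: verts_iff)
  have "x = w"
  proof (rule ccontr)
    assume "x \<noteq> w"
    define m where "m = (x + w) / 2"
    have m: "m \<in> cell S s" if "x \<in> cell S s" "w \<in> cell S s" for S s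
      using convexD[OF convex_cell[of S s] that, of "1/2" "1/2"] by (simp add: m_def add_divide_distrib)
    have "x \<le> m \<or> w \<le> m"
      by (auto simp: m_def)
    then have "d i j \<le> exp m"
      using w(3) x(3) by (meson exp_le_cancel_iff order_trans)
    then have "m \<in> T i"
      using vertex[OF m m] w x by blast
    moreover have "x < m \<and> m < w \<or> w < m \<and> m < x"
      using \<open>x \<noteq> w\<close> by (auto simp: m_def)
    ultimately show False
      using cell_no_between[OF assms(1)] w(1) x(1) by blast
  qed
  then show "y = z"
    by (simp add: w x)
qed

lemma finite_edges: "finite (edges (tree_complex d T))"
proof (rule finite_subset)
  show "edges (tree_complex d T) \<subseteq> (\<Union>i. (\<lambda>c. pt i ` c) ` {cell (T i) t | t. t \<notin> T i})"
    by (auto simp: tree_complex_def)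
qed (auto intro: finite_cells finite_T)

lemma polyhedral: "polyhedral_complex (tree_complex d T)"
  unfolding polyhedral_complex_def
proof (intro conjI ballI allI impI)
  have "verts (tree_complex d T) = (\<Union>i. pt i ` T i)"
    by (auto simp: tree_complex_def)
  then show "finite (verts (tree_complex d T))"
    by (auto intro: finite_T)
next
  show "edges (tree_complex d T) \<noteq> {}"
  proof -
    obtain t where "t \<notin> T undefined"
      using ex_new_if_finite[OF infinite_UNIV_char_0 finite_T] by blast
    then show ?thesis
      using edgeI by blast
  qed
next
  fix \<sigma> z assume "\<sigma> \<in> edges (tree_complex d T)" "z extreme_point_of \<sigma>"
  then show "z \<in> verts (tree_complex d T)"
    by (auto elim!: edgeE simp: extreme_point_edge_iff verts_iff)
next
  fix \<sigma> \<tau> assume \<sigma>: "\<sigma> \<in> edges (tree_complex d T)" and \<tau>: "\<tau> \<in> edges (tree_complex d T)"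
    and ne: "\<sigma> \<noteq> \<tau>"
  obtain i t where i: "t \<notin> T i" "\<sigma> = edge i t"
    using \<sigma> by (rule edgeE)
  obtain j u where j: "u \<notin> T j" "\<tau> = edge j u"
    using \<tau> by (rule edgeE)
  note * = edges_intersection[OF i(1) j(1), folded i(2) j(2), OF ne]
  show "\<sigma> \<inter> \<tau> = {} \<or> (\<exists>z\<in>verts (tree_complex d T). \<sigma> \<inter> \<tau> = {z})"
  proof (cases "\<sigma> \<inter> \<tau> = {}")
    case False
    then obtain z where z: "z \<in> \<sigma>" "z \<in> \<tau>"
      by blast
    have "\<sigma> \<inter> \<tau> = {z}"
      using *(2)[OF z] z by blast
    then show ?thesis
      using *(1)[OF z z] by blast
  qed simp
next
  fix \<sigma> z assume \<sigma>: "\<sigma> \<in> edges (tree_complex d T)" and z: "z \<in> verts (tree_complex d T) \<inter> \<sigma>"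
  obtain i t where *: "t \<notin> T i" "\<sigma> = edge i t"
    using \<sigma> by (rule edgeE)
  then obtain w where "w \<in> cell (T i) t" "z = pt i w"
    using z by auto
  then show "z extreme_point_of \<sigma>"
    using z * by (auto simp: extreme_point_edge_iff verts_iff)
qed (auto elim!: edgeE intro: edge_is_edge finite_edges)

lemma rational: "rational_complex (tree_complex d T)"
  unfolding rational_complex_def
proof
  fix \<sigma> assume "\<sigma> \<in> edges (tree_complex d T)"
  then obtain i t where *: "t \<notin> T i" "\<sigma> = edge i t"
    by (rule edgeE)
  have "dir i t \<in> direction_space \<sigma> \<inter> integral_vectors"
    using integral_direction_iff[OF *(1), of "dir i t"] *(2) by (auto intro: exI[of _ 1])
  moreover have "dir i t \<noteq> 0"
    using dir_nth_self[of i t] by (metis zero_index zero_neq_one)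
  ultimately show "direction_space \<sigma> \<inter> integral_vectors \<noteq> {0}"
    by auto
qed

lemma support_eq: "support (tree_complex d T) = {pt i t | i t. True}"
proof (intro equalityI subsetI)
  fix z assume "z \<in> {pt i t | i t. True}"
  then obtain i t where z: "z = pt i t"
    by blast
  show "z \<in> support (tree_complex d T)"
  proof (cases "t \<in> T i")
    case True
    then show ?thesis
      unfolding z support_def by (intro UnI1) (simp only: verts_iff)
  next
    case False
    then show ?thesis
      using edgeI[OF False] by (auto simp: z support_def intro!: bexI[of _ "edge i t"])
  qed
qed (auto simp: support_def tree_complex_def)

section \<open>Edges at a vertex and balancing\<close>

text \<open>The bounds separate \<open>w\<close> from the other vertex parameters of all paths at
  once. Thus \<open>lo\<close> and \<open>hi\<close> serve as interior parameters of the edges just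
  below and just above height \<open>w\<close>, whatever the path.\<close>

definition isolating :: "real \<Rightarrow> real \<Rightarrow> real \<Rightarrow> bool" where
  "isolating w lo hi \<longleftrightarrow> lo < w \<and> w < hi \<and>
    (\<forall>j. \<forall>\<tau>\<in>T j. lo \<le> \<tau> \<longrightarrow> \<tau> \<le> hi \<longrightarrow> \<tau> = w)"

lemma isolatingD: "isolating w lo hi \<Longrightarrow> lo < w" "isolating w lo hi \<Longrightarrow> w < hi"
  unfolding isolating_def by blast+

lemma isolating_exists: "\<exists>e>0. isolating w (w - e) (w + e)"
proof -
  have "finite ((\<Union>j. T j) - {w})"
    using finite_T by simp
  then obtain e where e: "0 < e" "\<And>\<tau>. \<tau> \<in> (\<Union>j. T j) - {w} \<Longrightarrow> e \<le> dist w \<tau>"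
    using finite_set_avoid[of "(\<Union>j. T j) - {w}" w] by (metis Diff_iff singletonI)
  \<comment> \<open>Half of \<open>e\<close> is needed because the interval in
    \<open>isolating\<close> is closed, whereas other parameters may be exactly at distance
    \<open>e\<close>.\<close>
  have "isolating w (w - e / 2) (w + e / 2)"
    unfolding isolating_def
  proof (intro conjI allI ballI impI)
    fix j \<tau> assume \<tau>: "\<tau> \<in> T j" "w - e / 2 \<le> \<tau>" "\<tau> \<le> w + e / 2"
    then have "dist w \<tau> < e"
      using e(1) by (auto simp: dist_real_def)
    then show "\<tau> = w"
      using e(2)[of \<tau>] \<tau> by auto
  qed (use e in auto)
  then show ?thesis
    using e(1) by (intro exI[of _ "e / 2"]) simp
qed

lemma isolating_not_mem: "isolating w lo hi \<Longrightarrow> lo \<notin> T j" "isolating w lo hi \<Longrightarrow> hi \<notin> T j"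
  unfolding isolating_def by fastforce+

lemma isolating_mem_cell:
  assumes "isolating w lo hi"
  shows "w \<in> cell (T j) lo" "w \<in> cell (T j) hi"
proof -
  have "\<tau> \<notin> {lo..hi} \<or> \<tau> = w" if "\<tau> \<in> T j" for \<tau>
    using assms that by (auto simp: isolating_def)
  then show "w \<in> cell (T j) lo" "w \<in> cell (T j) hi"
    using assms by (fastforce simp: cell_def isolating_def)+
qed

text \<open>A distance between \<open>exp lo\<close> and \<open>exp hi\<close> has its logarithm in
  some \<open>T i\<close>, hence equals \<open>exp w\<close>. So radius \<open>exp hi\<close> gives
  the closed ball of radius \<open>exp w\<close>, and radius \<open>exp lo\<close> the open
  one.\<close>

lemma isolating_d:
  assumes "isolating w lo hi"
  shows "d i j \<le> exp hi \<longleftrightarrow> d i j \<le> exp w" and "d i j \<le> exp lo \<longleftrightarrow> d i j < exp w"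
proof -
  have lh: "exp lo < exp w" "exp w < exp hi"
    using isolatingD[OF assms] by simp_all
  have *: "d i j = exp w" if "exp lo \<le> d i j" "d i j \<le> exp hi"
  proof -
    have pos: "0 < d i j"
      using that(1) exp_gt_zero[of lo] by linarith
    then have "ln (d i j) \<in> T i" "lo \<le> ln (d i j)" "ln (d i j) \<le> hi"
      using T_dist[OF pos] that by (auto simp: le_exp_iff ln_ge_iff)
    then have "ln (d i j) = w"
      using assms by (auto simp: isolating_def)
    then show ?thesis
      using pos by auto
  qed
  show "d i j \<le> exp hi \<longleftrightarrow> d i j \<le> exp w"
    using * lh by linarith
  show "d i j \<le> exp lo \<longleftrightarrow> d i j < exp w"
    using * lh by linarith
qed

text \<open>The paths through the vertex are those of the indices in the closed ball around
  \<open>i\<close>. They coincide from the vertex upwards, which leaves one upper edge, but may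
  separate below it.\<close>

lemma edges_at:
  assumes iso: "isolating w lo hi" and w: "w \<in> T i"
  shows "{\<sigma> \<in> edges (tree_complex d T). pt i w \<in> \<sigma>} =
    insert (edge i hi) ((\<lambda>j. edge j lo) ` {j. d i j \<le> exp w})" (is "?L = ?R")
proof (intro equalityI subsetI)
  fix \<sigma> assume "\<sigma> \<in> ?L"
  then obtain j t where t: "t \<notin> T j" "\<sigma> = edge j t" "pt i w \<in> edge j t"
    by (auto elim: edgeE)
  then have wj: "w \<in> cell (T j) t" "d i j \<le> exp w"
    by (auto simp: path_eq_iff)
  then have wT: "w \<in> T j"
    using w T_iff by blast
  then have "w \<noteq> t"
    using t(1) by auto
  have lh: "lo < w" "w < hi" "\<And>\<tau>. \<tau> \<in> T j \<Longrightarrow> lo \<le> \<tau> \<Longrightarrow> \<tau> \<le> hi \<Longrightarrow> \<tau> = w"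
    using iso by (auto simp: isolating_def)
  show "\<sigma> \<in> ?R"
  proof (cases "w < t")
    case True
    have "cell (T j) t = cell (T j) hi"
    proof (rule cell_cong)
      fix \<tau> assume "\<tau> \<in> T j"
      then have "\<tau> < t \<longrightarrow> \<tau> \<le> w" "lo \<le> \<tau> \<Longrightarrow> \<tau> \<le> hi \<Longrightarrow> \<tau> = w"
        using wj(1) lh(3) by (auto simp: cell_def)
      moreover have "\<tau> \<noteq> hi"
        using isolating_not_mem(2)[OF iso, of j] \<open>\<tau> \<in> T j\<close> by auto
      ultimately show "\<tau> < t \<longleftrightarrow> \<tau> < hi"
        using lh(1,2) True by linarith
    qed (use t isolating_not_mem[OF iso] in auto)
    then have "\<sigma> = edge j hi"
      by (simp add: t)
    also have "\<dots> = edge i hi"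
      using edge_cong[OF isolating_not_mem(2)[OF iso], of i j] isolating_d(1)[OF iso] wj(2) by simp
    finally show ?thesis
      by simp
  next
    case False
    then have "t < w"
      using \<open>w \<noteq> t\<close> by simp
    have "cell (T j) t = cell (T j) lo"
    proof (rule cell_cong)
      fix \<tau> assume "\<tau> \<in> T j"
      then have "t < \<tau> \<longrightarrow> w \<le> \<tau>" "lo \<le> \<tau> \<Longrightarrow> \<tau> \<le> hi \<Longrightarrow> \<tau> = w"
        using wj(1) lh(3) by (auto simp: cell_def)
      moreover have "\<tau> \<noteq> lo" "\<tau> \<noteq> t"
        using isolating_not_mem(1)[OF iso, of j] \<open>\<tau> \<in> T j\<close> t(1) by auto
      ultimately show "\<tau> < t \<longleftrightarrow> \<tau> < lo"
        using lh(1,2) \<open>t < w\<close> by linarith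
    qed (use t isolating_not_mem[OF iso] in auto)
    then have "\<sigma> = edge j lo"
      by (simp add: t)
    then show ?thesis
      using wj(2) by auto
  qed
next
  fix \<sigma> assume "\<sigma> \<in> ?R"
  then consider "\<sigma> = edge i hi" | j where "\<sigma> = edge j lo" "d i j \<le> exp w"
    by auto
  then show "\<sigma> \<in> ?L"
  proof cases
    case 1
    then show ?thesis
      using edgeI[OF isolating_not_mem(2)[OF iso]] isolating_mem_cell(2)[OF iso] by auto
  next
    case 2
    then have "pt i w = pt j w"
      by (simp add: path_eq_iff)
    then show ?thesis
      using 2 edgeI[OF isolating_not_mem(1)[OF iso]] isolating_mem_cell(1)[OF iso] by auto
  qed
qed

text \<open>Ensures that the upper edge contributes a separate summand to the balancing sum.\<close>

lemma upper_edge_not_lower: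
  assumes "isolating w lo hi" "w \<in> T i" "d i j \<le> exp w"
  shows "edge i hi \<noteq> edge j lo"
proof
  assume "edge i hi = edge j lo"
  moreover have "pt i hi \<in> edge i hi"
    by simp
  ultimately have "pt i hi \<in> edge j lo"
    by simp
  then have "hi \<in> cell (T j) lo"
    by (auto simp: path_eq_iff)
  moreover have "w \<in> T j"
    using assms T_iff by blast
  ultimately show False
    using assms(1) by (auto simp: cell_def isolating_def)
qed

lemma outward_upper:
  assumes "isolating w lo hi" "w \<in> T i"
  shows "outward_primitive (pt i w) (edge i hi) = - dir i w"
proof -
  have "w < hi"
    using isolatingD[OF assms(1)] by blast
  then have "outward_primitive (pt i w) (edge i hi) = - dir i hi"
    using outward_primitive_edge[OF isolating_not_mem(2)[OF assms(1)]
        isolating_mem_cell(2)[OF assms(1)] assms(2)] by simp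
  also have "dir i hi = dir i w"
    by (simp add: tree_dir_def isolating_d(1)[OF assms(1)])
  finally show ?thesis .
qed

lemma outward_lower:
  assumes iso: "isolating w lo hi" and "w \<in> T i" "d i j \<le> exp w"
  shows "outward_primitive (pt i w) (edge j lo) = dir j lo"
proof -
  have "lo < w"
    using isolatingD[OF iso] by blast
  moreover have "w \<in> T j"
    using assms T_iff by blast
  ultimately show ?thesis
    using outward_primitive_edge[OF isolating_not_mem(1)[OF iso] isolating_mem_cell(1)[OF iso], of j] assms(3)
    by (simp add: path_eq_iff[THEN iffD2])
qed

text \<open>The primitive vector of a lower edge is the indicator of an open ball. Lower edges agree
  exactly for indices in the same open ball, so a sum over edges, unlike one over indices, counts
  each ball once.\<close>

lemma lower_edges_sum:
  assumes iso: "isolating w lo hi" and w: "w \<in> T i"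
  shows "(\<Sum>\<sigma>\<in>(\<lambda>j. edge j lo) ` {j. d i j \<le> exp w}. outward_primitive (pt i w) \<sigma>) = dir i w"
proof -
  let ?B = "{j. d i j \<le> exp w}"
  have same: "edge j lo = edge k lo \<longleftrightarrow> d j k \<le> exp lo" for j k
  proof
    assume "edge j lo = edge k lo"
    then have "pt j lo \<in> edge k lo"
      using self_in_cell[of lo "T j"] by blast
    then show "d j k \<le> exp lo"
      by (auto simp: path_eq_iff)
  qed (rule edge_cong[OF isolating_not_mem(1)[OF iso]])
  have "outward_primitive (pt i w) (edge j lo) =
    (\<chi> k. if k \<in> ?B \<and> edge k lo = edge j lo then 1 else 0)" if j: "j \<in> ?B" for j
  proof -
    have "d j k \<le> exp lo \<longleftrightarrow> k \<in> ?B \<and> edge k lo = edge j lo" for k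
      using same[of k j] d_sym[of j k] d_ultra[of i k j] j isolating_d(2)[OF iso, of j k] by auto
    then show ?thesis
      using outward_lower[OF iso w, of j] j by (simp add: tree_dir_def)
  qed
  then have "(\<Sum>\<sigma>\<in>(\<lambda>j. edge j lo) ` ?B. outward_primitive (pt i w) \<sigma>) =
    (\<Sum>\<sigma>\<in>(\<lambda>j. edge j lo) ` ?B. (\<chi> k. if k \<in> ?B \<and> edge k lo = \<sigma> then 1 else 0))"
    by (intro sum.cong) auto
  also have "\<dots> = dir i w"
    unfolding sum_indicator_fibres by (simp add: tree_dir_def)
  finally show ?thesis .
qed

lemma balanced_tree: "balanced (tree_complex d T)"
  unfolding balanced_def
proof
  fix z assume "z \<in> verts (tree_complex d T)"
  then obtain i w where w: "w \<in> T i" "z = pt i w"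
    by (auto simp: tree_complex_def)
  obtain lo hi where iso: "isolating w lo hi"
    using isolating_exists by blast
  have "edge i hi \<notin> (\<lambda>j. edge j lo) ` {j. d i j \<le> exp w}"
    using upper_edge_not_lower[OF iso w(1)] by auto
  then have "(\<Sum>\<sigma> | \<sigma> \<in> edges (tree_complex d T) \<and> z \<in> \<sigma>. outward_primitive z \<sigma>) = 0"
    unfolding w(2) edges_at[OF iso w(1)]
    by (subst sum.insert) (auto simp: outward_upper[OF iso w(1)] lower_edges_sum[OF iso w(1)])
  then show "(\<Sum>\<sigma> | \<sigma> \<in> edges (tree_complex d T) \<and> z \<in> \<sigma>.
      of_int (weight (tree_complex d T) \<sigma>) *\<^sub>R outward_primitive z \<sigma>) = 0"
    by (simp add: tree_complex_def)
qed

lemma tropical_structure_tree: "tropical_structure (tree_complex d T)"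
  by (simp add: tropical_structure_def polyhedral rational balanced_tree)

section \<open>The closure of the tree in tropical affine space\<close>

lemma finite_point_path: "finite_point (pt i t) = tree_path_ext d i (ereal t)"
proof -
  have "ereal (ln (max (exp t) (d i j))) = max (ereal t) (trop_log (d i j))" for j
    using d_nonneg[of i j] by (auto simp: trop_log_def max_def ln_ge_iff le_exp_iff less_le)
  then show ?thesis
    by (simp add: vec_eq_iff finite_point_def tree_path_def tree_path_ext_def)
qed

lemma trop_paths_eq:
  "{\<chi> j. trop_log (max s (d i j)) | i s. 0 \<le> s} = {tree_path_ext d i t | i t. t \<noteq> \<infinity>}"
proof (intro equalityI subsetI)
  fix y assume "y \<in> {\<chi> j. trop_log (max s (d i j)) | i s. 0 \<le> s}"
  then obtain i s where "0 \<le> s" "y = (\<chi> j. trop_log (max s (d i j)))"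
    by blast
  then have "y = tree_path_ext d i (trop_log s)" "trop_log s \<noteq> \<infinity>"
    by (simp_all add: tree_path_ext_def trop_log_max d_nonneg) (simp add: trop_log_def)
  then show "y \<in> {tree_path_ext d i t | i t. t \<noteq> \<infinity>}"
    by blast
next
  fix y assume "y \<in> {tree_path_ext d i t | i t. t \<noteq> \<infinity>}"
  then obtain i t where t: "t \<noteq> \<infinity>" "y = tree_path_ext d i t"
    by blast
  then obtain s where "0 \<le> s" "trop_log s = t"
    by (cases t) (auto simp: trop_log_def intro: that[of "exp _"] that[of 0])
  then have "y = (\<chi> j. trop_log (max s (d i j)))"
    using t by (simp add: tree_path_ext_def trop_log_max d_nonneg)
  then show "y \<in> {\<chi> j. trop_log (max s (d i j)) | i s. 0 \<le> s}"
    using \<open>0 \<le> s\<close> by blast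
qed

text \<open>The extended paths, with both infinite parameters, form a closed set, and the finite
  points are dense in it by continuity. Intersecting with the tropical space removes just the
  parameter \<open>\<infinity>\<close>.\<close>

lemma curve_tree: "curve (tree_complex d T) = {tree_path_ext d i t | i t. t \<noteq> \<infinity>}"
proof -
  let ?A = "\<Union>i. tree_path_ext d i ` UNIV"
  have cont: "continuous_on UNIV (tree_path_ext d i)" for i
    unfolding tree_path_ext_def by (intro continuous_on_vec_lambda continuous_intros)
  have fin: "finite_point ` support (tree_complex d T) = (\<Union>i. tree_path_ext d i ` range ereal)"
    unfolding support_eq image_image finite_point_path[symmetric] by blast
  \<comment> \<open>As the parameter is the \<open>i\<close>-th coordinate, the image is the
    solution set of equations between continuous functions, hence closed.\<close>
  have "tree_path_ext d i ` UNIV = (\<Inter>j. {y. y $ j = max (y $ i) (trop_log (d i j))})" for i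
  proof (intro equalityI subsetI)
    fix y assume y: "y \<in> (\<Inter>j. {y. y $ j = max (y $ i) (trop_log (d i j))})"
    then have "y $ j = max (y $ i) (trop_log (d i j))" for j
      by blast
    then have "y = tree_path_ext d i (y $ i)"
      unfolding vec_eq_iff tree_path_ext_def vec_lambda_beta by blast
    then show "y \<in> tree_path_ext d i ` UNIV"
      by (rule image_eqI) (rule UNIV_I)
  qed (auto simp: tree_path_ext_def trop_log_def)
  moreover have "closed {y :: ereal ^ 'r. y $ j = max (y $ i) c}" for i j c
    by (intro closed_Collect_eq continuous_intros)
  ultimately have "closed ?A"
    by (intro closed_UN) auto
  then have sub: "closure (finite_point ` support (tree_complex d T)) \<subseteq> ?A"
    unfolding fin by (intro closure_minimal) auto
  have "(\<lambda>n. ereal (- real n)) \<longlonglongrightarrow> - \<infinity>"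
    unfolding tendsto_MInfty eventually_sequentially
    by (metis ereal_less_eq(3) less_ereal.simps(1) minus_less_iff of_nat_le_iff order_less_le_trans
        reals_Archimedean2)
  then have minus: "- \<infinity> \<in> closure (range ereal)"
    by (rule Lim_in_closed_set[OF closed_closure, rotated 2])
      (auto intro!: always_eventually closure_subset[THEN subsetD])
  have "(\<lambda>n. ereal (real n)) \<longlonglongrightarrow> \<infinity>"
    unfolding tendsto_PInfty eventually_sequentially
    by (metis less_ereal.simps(1) of_nat_le_iff order_less_le_trans reals_Archimedean2)
  then have plus: "\<infinity> \<in> closure (range ereal)"
    by (rule Lim_in_closed_set[OF closed_closure, rotated 2])
      (auto intro!: always_eventually closure_subset[THEN subsetD])
  have "t \<in> closure (range ereal)" for t
    using minus plus closure_subset[THEN subsetD, of "ereal _" "range ereal"] by (cases t) auto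
  then have dense: "closure (range ereal) = UNIV"
    by blast
  have "tree_path_ext d i ` UNIV \<subseteq> closure (finite_point ` support (tree_complex d T))" for i
  proof -
    have "tree_path_ext d i ` closure (range ereal) \<subseteq> closure (tree_path_ext d i ` range ereal)"
      by (intro image_closure_subset closed_closure closure_subset
          continuous_on_subset[OF cont subset_UNIV])
    then show ?thesis
      unfolding fin dense by (rule order_trans) (intro closure_mono, auto)
  qed
  then have "closure (finite_point ` support (tree_complex d T)) = ?A"
    using sub by blast
  moreover have "tree_path_ext d i t \<in> tropical_space \<longleftrightarrow> t \<noteq> \<infinity>" for i t
  proof -
    have "trop_log (d i j) < \<infinity>" for j
      by (simp add: trop_log_def)
    then show ?thesis
      by (auto simp: tropical_space_def tree_path_ext_def max_def) 
  qed
  ultimately show ?thesis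
    unfolding curve_def by blast
qed

end

section \<open>Multiplicities\<close>

text \<open>Operations on fractions are defined as unions over all representatives; once the result
  is independent of the choice, the union collapses to a single class.\<close>

lemma UN_pairs_const:
  assumes "x \<in> X" "y \<in> Y"
    and "\<And>a s b t. (a, s) \<in> X \<Longrightarrow> (b, t) \<in> Y \<Longrightarrow> f a s b t = Z"
  shows "(\<Union>(a, s)\<in>X. \<Union>(b, t)\<in>Y. f a s b t) = Z"
proof (intro equalityI subsetI)
  fix z assume "z \<in> (\<Union>(a, s)\<in>X. \<Union>(b, t)\<in>Y. f a s b t)"
  then obtain a s b t where "(a, s) \<in> X" "(b, t) \<in> Y" "z \<in> f a s b t"
    by auto
  then show "z \<in> Z"
    using assms(3) by blast
next
  fix z assume "z \<in> Z"
  then have "z \<in> f (fst x) (snd x) (fst y) (snd y)"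
    using assms by simp
  then show "z \<in> (\<Union>(a, s)\<in>X. \<Union>(b, t)\<in>Y. f a s b t)"
    using assms(1,2) by (auto simp: case_prod_beta)
qed

section \<open>The localization of a domain at its zero ideal\<close>

context domain
begin

abbreviation "fc \<equiv> frac_class R {\<zero>}"
abbreviation "FR \<equiv> localization R {\<zero>}"

text \<open>In a domain the auxiliary factor \<open>u\<close> in the equality of fractions can be
  cancelled.\<close>

lemma mem_fc_iff:
  assumes "a \<in> carrier R" "s \<in> carrier R - {\<zero>}"
  shows "(b, t) \<in> fc a s \<longleftrightarrow> b \<in> carrier R \<and> t \<in> carrier R - {\<zero>} \<and> a \<otimes> t = b \<otimes> s"
proof
  assume "(b, t) \<in> fc a s"
  then obtain u where u: "u \<in> carrier R - {\<zero>}" "u \<otimes> (a \<otimes> t) = u \<otimes> (b \<otimes> s)"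
    and bt: "b \<in> carrier R" "t \<in> carrier R - {\<zero>}"
    by (auto simp: frac_class_def)
  then have "a \<otimes> t = b \<otimes> s"
    using m_lcancel[of u "a \<otimes> t" "b \<otimes> s"] assms by auto
  then show "b \<in> carrier R \<and> t \<in> carrier R - {\<zero>} \<and> a \<otimes> t = b \<otimes> s"
    using bt by simp
next
  assume "b \<in> carrier R \<and> t \<in> carrier R - {\<zero>} \<and> a \<otimes> t = b \<otimes> s"
  then show "(b, t) \<in> fc a s"
    unfolding frac_class_def by (auto intro: bexI[of _ \<one>])
qed

lemma self_mem_fc: "a \<in> carrier R \<Longrightarrow> s \<in> carrier R - {\<zero>} \<Longrightarrow> (a, s) \<in> fc a s"
  by (simp add: mem_fc_iff)

lemma fc_eqI:
  assumes "a \<in> carrier R" "s \<in> carrier R - {\<zero>}" "b \<in> carrier R" "t \<in> carrier R - {\<zero>}"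
    and "a \<otimes> t = b \<otimes> s"
  shows "fc a s = fc b t"
proof -
  have sub: "fc a s \<subseteq> fc b t"
    if c: "a \<in> carrier R" "s \<in> carrier R - {\<zero>}" "b \<in> carrier R" "t \<in> carrier R - {\<zero>}"
      "a \<otimes> t = b \<otimes> s" for a s b t
  proof
    fix x assume "x \<in> fc a s"
    moreover obtain c r where x: "x = (c, r)"
      by (cases x)
    ultimately have cr: "c \<in> carrier R" "r \<in> carrier R - {\<zero>}" "a \<otimes> r = c \<otimes> s"
      using mem_fc_iff[OF c(1,2)] by auto
    have carr: "a \<in> carrier R" "b \<in> carrier R" "c \<in> carrier R" "s \<in> carrier R" "t \<in> carrier R"
      "r \<in> carrier R"
      using c cr by auto
    have "s \<otimes> (b \<otimes> r) = (b \<otimes> s) \<otimes> r"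
      by (simp add: m_ac carr)
    also have "\<dots> = (a \<otimes> r) \<otimes> t"
      unfolding c(5)[symmetric] by (simp add: m_ac carr)
    also have "\<dots> = s \<otimes> (c \<otimes> t)"
      unfolding cr(3) by (simp add: m_ac carr)
    finally have "b \<otimes> r = c \<otimes> t"
      using m_lcancel[of s "b \<otimes> r" "c \<otimes> t"] c cr by auto
    then show "x \<in> fc b t"
      using mem_fc_iff[OF c(3,4)] cr x by simp
  qed
  show ?thesis
    using sub[OF assms] sub[OF assms(3,4,1,2) assms(5)[symmetric]] by blast
qed

lemma fc_eq_iff:
  assumes "a \<in> carrier R" "s \<in> carrier R - {\<zero>}" "b \<in> carrier R" "t \<in> carrier R - {\<zero>}"
  shows "fc a s = fc b t \<longleftrightarrow> a \<otimes> t = b \<otimes> s"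
  using fc_eqI[OF assms] self_mem_fc[OF assms(3,4)] mem_fc_iff[OF assms(1,2), of b t] by blast

lemma denominator_mult:
  "s \<in> carrier R - {\<zero>} \<Longrightarrow> t \<in> carrier R - {\<zero>} \<Longrightarrow> s \<otimes> t \<in> carrier R - {\<zero>}"
  using integral[of s t] by auto

lemma fc_mult:
  assumes "a \<in> carrier R" "s \<in> carrier R - {\<zero>}" "b \<in> carrier R" "t \<in> carrier R - {\<zero>}"
  shows "fc a s \<otimes>\<^bsub>FR\<^esub> fc b t = fc (a \<otimes> b) (s \<otimes> t)"
proof -
  have "fc (a' \<otimes> b') (s' \<otimes> t') = fc (a \<otimes> b) (s \<otimes> t)"
    if "(a', s') \<in> fc a s" "(b', t') \<in> fc b t" for a' s' b' t'
  proof -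
    note a = that(1)[unfolded mem_fc_iff[OF assms(1,2)]]
    note b = that(2)[unfolded mem_fc_iff[OF assms(3,4)]]
    have carr: "a \<in> carrier R" "b \<in> carrier R" "a' \<in> carrier R" "b' \<in> carrier R"
      "s \<in> carrier R" "t \<in> carrier R" "s' \<in> carrier R" "t' \<in> carrier R"
      using a b assms by auto
    have "(a' \<otimes> b') \<otimes> (s \<otimes> t) = (a' \<otimes> s) \<otimes> (b' \<otimes> t)"
      by (simp add: m_ac carr)
    also have "\<dots> = (a \<otimes> s') \<otimes> (b \<otimes> t')"
      using a b by simp
    also have "\<dots> = (a \<otimes> b) \<otimes> (s' \<otimes> t')"
      by (simp add: m_ac carr)
    finally show ?thesis
      using a b assms denominator_mult by (intro fc_eqI) simp_all
  qed
  then show ?thesis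
    unfolding localization_def monoid.simps ring.simps
    by (rule UN_pairs_const[OF self_mem_fc[OF assms(1,2)] self_mem_fc[OF assms(3,4)]])
qed

lemma fc_add:
  assumes "a \<in> carrier R" "s \<in> carrier R - {\<zero>}" "b \<in> carrier R" "t \<in> carrier R - {\<zero>}"
  shows "fc a s \<oplus>\<^bsub>FR\<^esub> fc b t = fc ((a \<otimes> t) \<oplus> (b \<otimes> s)) (s \<otimes> t)"
proof -
  have "fc ((a' \<otimes> t') \<oplus> (b' \<otimes> s')) (s' \<otimes> t') = fc ((a \<otimes> t) \<oplus> (b \<otimes> s)) (s \<otimes> t)"
    if "(a', s') \<in> fc a s" "(b', t') \<in> fc b t" for a' s' b' t'
  proof -
    note a = that(1)[unfolded mem_fc_iff[OF assms(1,2)]]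
    note b = that(2)[unfolded mem_fc_iff[OF assms(3,4)]]
    have carr: "a \<in> carrier R" "b \<in> carrier R" "a' \<in> carrier R" "b' \<in> carrier R"
      "s \<in> carrier R" "t \<in> carrier R" "s' \<in> carrier R" "t' \<in> carrier R"
      using a b assms by auto
    have "((a' \<otimes> t') \<oplus> (b' \<otimes> s')) \<otimes> (s \<otimes> t) =
      (a' \<otimes> s) \<otimes> (t \<otimes> t') \<oplus> (b' \<otimes> t) \<otimes> (s \<otimes> s')"
      by (simp add: m_ac l_distr r_distr carr)
    also have "\<dots> = (a \<otimes> s') \<otimes> (t \<otimes> t') \<oplus> (b \<otimes> t') \<otimes> (s \<otimes> s')"
      using a b by simp
    also have "\<dots> = ((a \<otimes> t) \<oplus> (b \<otimes> s)) \<otimes> (s' \<otimes> t')"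
      by (simp add: m_ac l_distr r_distr carr)
    finally show ?thesis
      using a b assms denominator_mult by (intro fc_eqI) simp_all
  qed
  then show ?thesis
    unfolding localization_def monoid.simps ring.simps
    by (rule UN_pairs_const[OF self_mem_fc[OF assms(1,2)] self_mem_fc[OF assms(3,4)]])
qed

lemma FR_carrierE:
  assumes "x \<in> carrier FR"
  obtains a s where "a \<in> carrier R" "s \<in> carrier R - {\<zero>}" "x = fc a s"
  using assms by (auto simp: localization_def)

lemma FR_carrierI: "a \<in> carrier R \<Longrightarrow> s \<in> carrier R - {\<zero>} \<Longrightarrow> fc a s \<in> carrier FR"
  by (auto simp: localization_def)

lemma FR_zero: "\<zero>\<^bsub>FR\<^esub> = fc \<zero> \<one>" and FR_one: "\<one>\<^bsub>FR\<^esub> = fc \<one> \<one>"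
  by (simp_all add: localization_def)

lemma FR_abelian_group: "abelian_group FR"
proof (rule abelian_groupI)
  fix x y assume "x \<in> carrier FR" "y \<in> carrier FR"
  then obtain a s b t where "a \<in> carrier R" "s \<in> carrier R - {\<zero>}" "x = fc a s"
    "b \<in> carrier R" "t \<in> carrier R - {\<zero>}" "y = fc b t"
    by (metis FR_carrierE)
  then show "x \<oplus>\<^bsub>FR\<^esub> y \<in> carrier FR" "x \<oplus>\<^bsub>FR\<^esub> y = y \<oplus>\<^bsub>FR\<^esub> x"
    using denominator_mult by (auto simp: fc_add m_comm a_comm intro!: FR_carrierI)
next
  show "\<zero>\<^bsub>FR\<^esub> \<in> carrier FR"
    by (auto simp: FR_zero intro!: FR_carrierI)
next
  fix x y z assume "x \<in> carrier FR" "y \<in> carrier FR" "z \<in> carrier FR"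
  then obtain a s b t c r where *: "a \<in> carrier R" "s \<in> carrier R - {\<zero>}" "x = fc a s"
    "b \<in> carrier R" "t \<in> carrier R - {\<zero>}" "y = fc b t"
    "c \<in> carrier R" "r \<in> carrier R - {\<zero>}" "z = fc c r"
    by (metis FR_carrierE)
  then have "(x \<oplus>\<^bsub>FR\<^esub> y) \<oplus>\<^bsub>FR\<^esub> z =
      fc ((a \<otimes> t \<oplus> b \<otimes> s) \<otimes> r \<oplus> c \<otimes> (s \<otimes> t)) (s \<otimes> t \<otimes> r)"
    using denominator_mult[of s t] by (simp add: fc_add)
  also have "\<dots> = fc (a \<otimes> (t \<otimes> r) \<oplus> (b \<otimes> r \<oplus> c \<otimes> t) \<otimes> s) (s \<otimes> (t \<otimes> r))"
    using * by (intro arg_cong2[where f = fc]) (auto simp: m_ac l_distr r_distr a_ac)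
  also have "\<dots> = x \<oplus>\<^bsub>FR\<^esub> (y \<oplus>\<^bsub>FR\<^esub> z)"
    using * denominator_mult[of t r] by (simp add: fc_add)
  finally show "(x \<oplus>\<^bsub>FR\<^esub> y) \<oplus>\<^bsub>FR\<^esub> z = x \<oplus>\<^bsub>FR\<^esub> (y \<oplus>\<^bsub>FR\<^esub> z)" .
next
  fix x assume "x \<in> carrier FR"
  then obtain a s where *: "a \<in> carrier R" "s \<in> carrier R - {\<zero>}" "x = fc a s"
    by (metis FR_carrierE)
  then show "\<zero>\<^bsub>FR\<^esub> \<oplus>\<^bsub>FR\<^esub> x = x"
    using fc_add[of "\<zero>" "\<one>" a s] by (simp add: FR_zero)
  have "fc (\<ominus> a) s \<oplus>\<^bsub>FR\<^esub> x = \<zero>\<^bsub>FR\<^esub>"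
    using * fc_add[of "\<ominus> a" s a s] denominator_mult[of s s]
    by (auto simp: FR_zero l_minus l_neg fc_eq_iff)
  then show "\<exists>y\<in>carrier FR. y \<oplus>\<^bsub>FR\<^esub> x = \<zero>\<^bsub>FR\<^esub>"
    using * FR_carrierI[of "\<ominus> a" s] by blast
qed

lemma FR_cring: "cring FR"
proof (rule cringI[OF FR_abelian_group])
  show "comm_monoid FR"
  proof (rule comm_monoidI)
    fix x y assume "x \<in> carrier FR" "y \<in> carrier FR"
    then obtain a s b t where "a \<in> carrier R" "s \<in> carrier R - {\<zero>}" "x = fc a s"
      "b \<in> carrier R" "t \<in> carrier R - {\<zero>}" "y = fc b t"
      by (metis FR_carrierE)
    then show "x \<otimes>\<^bsub>FR\<^esub> y \<in> carrier FR" "x \<otimes>\<^bsub>FR\<^esub> y = y \<otimes>\<^bsub>FR\<^esub> x"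
      using denominator_mult by (auto simp: fc_mult m_comm intro!: FR_carrierI)
  next
    fix x y z assume "x \<in> carrier FR" "y \<in> carrier FR" "z \<in> carrier FR"
    then obtain a s b t c r where *: "a \<in> carrier R" "s \<in> carrier R - {\<zero>}" "x = fc a s"
      "b \<in> carrier R" "t \<in> carrier R - {\<zero>}" "y = fc b t"
      "c \<in> carrier R" "r \<in> carrier R - {\<zero>}" "z = fc c r"
      by (metis FR_carrierE)
    then show "(x \<otimes>\<^bsub>FR\<^esub> y) \<otimes>\<^bsub>FR\<^esub> z = x \<otimes>\<^bsub>FR\<^esub> (y \<otimes>\<^bsub>FR\<^esub> z)"
      using denominator_mult[of s t] denominator_mult[of t r] by (simp add: fc_mult m_assoc)
  next
    fix x assume "x \<in> carrier FR"
    then obtain a s where *: "a \<in> carrier R" "s \<in> carrier R - {\<zero>}" "x = fc a s"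
      by (metis FR_carrierE)
    then show "\<one>\<^bsub>FR\<^esub> \<otimes>\<^bsub>FR\<^esub> x = x"
      using fc_mult[of "\<one>" "\<one>" a s] by (simp add: FR_one)
  qed (auto simp: FR_one intro!: FR_carrierI)
next
  fix x y z assume "x \<in> carrier FR" "y \<in> carrier FR" "z \<in> carrier FR"
  then obtain a s b t c r where *: "a \<in> carrier R" "s \<in> carrier R - {\<zero>}" "x = fc a s"
    "b \<in> carrier R" "t \<in> carrier R - {\<zero>}" "y = fc b t"
    "c \<in> carrier R" "r \<in> carrier R - {\<zero>}" "z = fc c r"
    by (metis FR_carrierE)
  have d: "s \<otimes> t \<in> carrier R - {\<zero>}" "s \<otimes> r \<in> carrier R - {\<zero>}" "t \<otimes> r \<in> carrier R - {\<zero>}"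
    using * denominator_mult by blast+
  have "(x \<oplus>\<^bsub>FR\<^esub> y) \<otimes>\<^bsub>FR\<^esub> z = fc ((a \<otimes> t \<oplus> b \<otimes> s) \<otimes> c) (s \<otimes> t \<otimes> r)"
    using * d by (simp add: fc_add fc_mult)
  also have "\<dots> = fc (a \<otimes> c \<otimes> (t \<otimes> r) \<oplus> b \<otimes> c \<otimes> (s \<otimes> r)) (s \<otimes> r \<otimes> (t \<otimes> r))"
  proof (rule fc_eqI)
    show "s \<otimes> t \<otimes> r \<in> carrier R - {\<zero>}" "s \<otimes> r \<otimes> (t \<otimes> r) \<in> carrier R - {\<zero>}"
      using * d denominator_mult by blast+
  qed (use * in \<open>auto simp: m_ac l_distr r_distr a_ac\<close>)
  also have "\<dots> = x \<otimes>\<^bsub>FR\<^esub> z \<oplus>\<^bsub>FR\<^esub> y \<otimes>\<^bsub>FR\<^esub> z"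
    using * d by (simp add: fc_add fc_mult)
  finally show "(x \<oplus>\<^bsub>FR\<^esub> y) \<otimes>\<^bsub>FR\<^esub> z = x \<otimes>\<^bsub>FR\<^esub> z \<oplus>\<^bsub>FR\<^esub> y \<otimes>\<^bsub>FR\<^esub> z" .
qed

text \<open>This is the field of fractions; the inverse of \<open>a/s\<close> is
  \<open>s/a\<close>.\<close>

lemma localization_zero_field: "field FR"
proof -
  interpret F: cring FR
    by (rule FR_cring)
  show ?thesis
  proof (rule F.cring_fieldI2)
    show "\<zero>\<^bsub>FR\<^esub> \<noteq> \<one>\<^bsub>FR\<^esub>"
      using fc_eq_iff[of \<zero> \<one> \<one> \<one>] by (simp add: FR_zero FR_one)
  next
    fix x assume "x \<in> carrier FR" and nz: "x \<noteq> \<zero>\<^bsub>FR\<^esub>"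
    then obtain a s where *: "a \<in> carrier R" "s \<in> carrier R - {\<zero>}" "x = fc a s"
      by (metis FR_carrierE)
    then have "a \<noteq> \<zero>"
      using nz fc_eq_iff[of a s \<zero> \<one>] by (auto simp: FR_zero)
    then have "x \<otimes>\<^bsub>FR\<^esub> fc s a = \<one>\<^bsub>FR\<^esub>"
      using * denominator_mult[of s a] by (auto simp: fc_mult FR_one fc_eq_iff m_comm)
    then show "\<exists>y\<in>carrier FR. x \<otimes>\<^bsub>FR\<^esub> y = \<one>\<^bsub>FR\<^esub>"
      using * \<open>a \<noteq> \<zero>\<close> FR_carrierI[of s a] by blast
  qed
qed

lemma minimal_primes_domain: "minimal_primes R = {{\<zero>}}"
proof -
  have "\<zero> \<in> q" if "primeideal q R" for q
    using that by (meson additive_subgroup.zero_closed ideal.axioms(1) primeideal.axioms(1))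
  then show ?thesis
    using zeroprimeideal unfolding minimal_primes_def by (auto; blast)
qed

end

text \<open>The only ideals are zero and the whole ring. The length counts strict inclusions, not
  members, of a chain.\<close>

lemma ring_length_field:
  assumes "field B"
  shows "ring_length B = 1"
proof -
  interpret field B by fact
  have ideals: "ideal I B \<longleftrightarrow> I = {\<zero>\<^bsub>B\<^esub>} \<or> I = carrier B" for I
    using all_ideals by auto
  have ne: "{\<zero>\<^bsub>B\<^esub>} \<subset> carrier B"
    using carrier_one_not_zero by auto
  let ?C = "\<lambda>n (c :: nat \<Rightarrow> 'a set). (\<forall>i\<le>n. ideal (c i) B) \<and> (\<forall>i<n. c i \<subset> c (Suc i))"
  have "n \<le> 1" if "?C n c" for n c
  proof (rule ccontr)
    assume "\<not> n \<le> 1"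
    then have "0 < n" "1 < n" "Suc 0 \<le> n" "Suc 1 \<le> n"
      by auto
    then have "c 0 \<subset> c 1" "c 1 \<subset> c (Suc 1)" "ideal (c 0) B" "ideal (c 1) B" "ideal (c (Suc 1)) B"
      using that by auto
    then show False
      using ne unfolding ideals by auto
  qed
  then have "x \<le> enat 1" if "x \<in> {enat n | n. \<exists>c. ?C n c}" for x
    using that by auto
  moreover have "\<exists>c. ?C 1 c"
    using ne by (intro exI[of _ "\<lambda>i. if i = 0 then {\<zero>\<^bsub>B\<^esub>} else carrier B"]) (auto simp: ideals)
  then have "enat 1 \<in> {enat n | n. \<exists>c. ?C n c}"
    by (intro CollectI exI[of _ "1::nat"] conjI refl)
  ultimately have "Sup {enat n | n. \<exists>c. ?C n c} = enat 1"
    by (intro antisym Sup_least Sup_upper)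
  then show ?thesis
    unfolding ring_length_def one_enat_def .
qed

text \<open>An integral scheme has one component, and its local ring at the generic point is a
  field.\<close>

lemma component_multiplicity_sum_domain:
  assumes "domain A"
  shows "component_multiplicity_sum A = 1"
proof -
  interpret domain A by fact
  show ?thesis
    by (simp add: component_multiplicity_sum_def minimal_primes_domain
        ring_length_field[OF localization_zero_field])
qed

section \<open>Evaluation of Laurent polynomials\<close>

lemma poly_mapping_sum_single:
  "f = (\<Sum>u\<in>Poly_Mapping.keys f. Poly_Mapping.single u (Poly_Mapping.lookup f u))"
  by (rule poly_mapping_eqI) (auto simp: lookup_sum lookup_single when_def in_keys_iff)

lemma mult_eq_sum_single:
  "f * g = (\<Sum>u\<in>Poly_Mapping.keys f. \<Sum>w\<in>Poly_Mapping.keys g.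
    Poly_Mapping.single (u + w) (Poly_Mapping.lookup f u * Poly_Mapping.lookup g w))"
  by (subst poly_mapping_sum_single[of f], subst poly_mapping_sum_single[of g])
    (simp add: sum_product mult_single)

lemma laurent_eval_0 [simp]: "laurent_eval 0 y = 0"
  by (simp add: laurent_eval_def)

lemma laurent_eval_single: "laurent_eval (Poly_Mapping.single u c) y = c * (\<Prod>i\<in>UNIV. y i powi (u $ i))"
  by (simp add: laurent_eval_def)

lemma laurent_eval_one [simp]: "laurent_eval 1 y = 1"
  using laurent_eval_single[of 0 1 y] by simp

lemma laurent_eval_add: "laurent_eval (f + g) y = laurent_eval f y + laurent_eval g y"
  unfolding laurent_eval_def by (rule setsum_keys_plus_distrib) (auto simp: algebra_simps)

lemma laurent_eval_sum: "laurent_eval (\<Sum>x\<in>A. f x) y = (\<Sum>x\<in>A. laurent_eval (f x) y)"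
  by (induction A rule: infinite_finite_induct) (auto simp: laurent_eval_add)

lemma laurent_eval_uminus: "laurent_eval (- f) y = - laurent_eval f y"
  by (simp add: laurent_eval_def sum_negf)

lemma laurent_eval_diff: "laurent_eval (f - g) y = laurent_eval f y - laurent_eval g y"
  using laurent_eval_add[of f "- g"] by (simp add: laurent_eval_uminus)

text \<open>Nonzero coordinates make powers additive in exponents of both signs.\<close>

lemma laurent_eval_mult:
  assumes "\<And>i. y i \<noteq> 0"
  shows "laurent_eval (f * g) y = laurent_eval f y * laurent_eval g y"
proof -
  have "laurent_eval (f * g) y = (\<Sum>u\<in>Poly_Mapping.keys f. \<Sum>w\<in>Poly_Mapping.keys g.
    Poly_Mapping.lookup f u * (\<Prod>i\<in>UNIV. y i powi (u $ i)) *
      (Poly_Mapping.lookup g w * (\<Prod>i\<in>UNIV. y i powi (w $ i))))"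
    unfolding mult_eq_sum_single laurent_eval_sum laurent_eval_single
    by (intro sum.cong refl) (simp add: power_int_add assms prod.distrib)
  then show ?thesis
    by (simp add: laurent_eval_def sum_product)
qed

lemma prod_powi_axis: "(\<Prod>k\<in>UNIV. y k powi (axis i m $ k)) = y i powi m"
  for y :: "'n::finite \<Rightarrow> 'l::field"
proof -
  have "(\<Prod>k\<in>UNIV. y k powi (axis i m $ k)) = (\<Prod>k\<in>UNIV. if k = i then y i powi m else 1)"
    by (intro prod.cong) (auto simp: axis_def)
  then show ?thesis
    by simp
qed

lemma axis_zero: "axis i 0 = (0 :: int ^ 'n::finite)"
  by (simp add: axis_def zero_vec_def)

lemma axis_add: "axis i k + axis i l = (axis i (k + l) :: int ^ 'n::finite)"
  by (simp add: vec_eq_iff axis_def)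

text \<open>The unit vectors generate the group of exponents. A property of Laurent monomials stable
  under products and inverses thus needs checking only for the variables.\<close>

lemma int_vec_subgroup_induct:
  fixes u :: "int ^ 'n::finite"
  assumes gen: "\<And>i. P (axis i 1)" and zero: "P 0" and add: "\<And>u w. P u \<Longrightarrow> P w \<Longrightarrow> P (u + w)"
    and neg: "\<And>u. P u \<Longrightarrow> P (- u)"
  shows "P u"
proof -
  have axis: "P (axis i k)" for i and k :: int
  proof (induction k rule: int_induct[where k = 0])
    case base
    then show ?case
      using zero by (simp add: axis_def zero_vec_def)
  next
    case (step1 k)
    have "axis i (k + 1) = axis i k + (axis i 1 :: int ^ 'n)"
      by (simp add: vec_eq_iff axis_def)
    then show ?case
      using add[OF step1(2) gen[of i]] by simp
  next
    case (step2 k)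
    have "axis i (k - 1) = axis i k + - (axis i 1 :: int ^ 'n)"
      by (simp add: vec_eq_iff axis_def)
    then show ?case
      using add[OF step2(2) neg[OF gen[of i]]] by simp
  qed
  have "P (\<Sum>i\<in>A. axis i (u $ i))" for A
    by (induction A rule: infinite_finite_induct) (auto intro: zero add axis)
  moreover have "(\<Sum>i\<in>UNIV. axis i (u $ i)) = u"
    by (simp add: vec_eq_iff axis_def)
  ultimately show ?thesis
    by metis
qed

context nonarch_valuation
begin

lemma laurent_mult_le_1:
  assumes "\<And>u. v (Poly_Mapping.lookup f u) \<le> 1" "\<And>u. v (Poly_Mapping.lookup g u) \<le> 1"
  shows "v (Poly_Mapping.lookup (f * g) w) \<le> 1"
  unfolding mult_eq_sum_single lookup_sum lookup_single
  by (intro sum_le) (auto simp: when_def mult intro!: mult_le_one assms)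

lemma laurent_mult_less_1:
  assumes "\<And>u. v (Poly_Mapping.lookup f u) \<le> 1" "\<And>u. v (Poly_Mapping.lookup g u) < 1"
  shows "v (Poly_Mapping.lookup (f * g) w) < 1"
proof -
  have "v (Poly_Mapping.lookup f u) * v (Poly_Mapping.lookup g x) < 1" for u x
    using mult_left_le_one_le[of "v (Poly_Mapping.lookup g x)" "v (Poly_Mapping.lookup f u)"] assms
    by (metis nonneg order_le_less_trans)
  then show ?thesis
    unfolding mult_eq_sum_single lookup_sum lookup_single
    by (intro sum_less) (auto simp: when_def mult)
qed

abbreviation "LR \<equiv> laurent_valuation_ring v"

lemma LR_simps:
  "f \<in> carrier LR \<longleftrightarrow> (\<forall>u. v (Poly_Mapping.lookup f u) \<le> 1)"
  "f \<otimes>\<^bsub>LR\<^esub> g = f * g" "f \<oplus>\<^bsub>LR\<^esub> g = f + g" "\<one>\<^bsub>LR\<^esub> = 1" "\<zero>\<^bsub>LR\<^esub> = 0"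
  by (simp_all add: laurent_valuation_ring_def)

lemma LR_closed:
  "f \<in> carrier LR \<Longrightarrow> g \<in> carrier LR \<Longrightarrow> f * g \<in> carrier LR"
  "f \<in> carrier LR \<Longrightarrow> g \<in> carrier LR \<Longrightarrow> f + g \<in> carrier LR"
  "f \<in> carrier LR \<Longrightarrow> g \<in> carrier LR \<Longrightarrow> f - g \<in> carrier LR"
  "f \<in> carrier LR \<Longrightarrow> - f \<in> carrier LR"
  "1 \<in> carrier LR" "0 \<in> carrier LR"
  "v c \<le> 1 \<Longrightarrow> Poly_Mapping.single u c \<in> carrier LR"
proof -
  assume fg: "f \<in> carrier LR" "g \<in> carrier LR"
  then show "f * g \<in> carrier LR"
    by (simp add: LR_simps laurent_mult_le_1)
  show "f + g \<in> carrier LR"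
    using fg ultra[of "Poly_Mapping.lookup f _" "Poly_Mapping.lookup g _"]
    unfolding LR_simps lookup_add by (meson max.boundedI order_trans)
  show "f - g \<in> carrier LR"
    using fg ultra_diff[of "Poly_Mapping.lookup f _" "Poly_Mapping.lookup g _"]
    unfolding LR_simps lookup_minus by (meson max.boundedI order_trans)
qed (auto simp: LR_simps lookup_one lookup_single when_def)

lemma LR_cring: "cring LR"
proof (rule cringI)
  show "abelian_group LR"
  proof (rule abelian_groupI; unfold LR_simps(2-5))
    fix f assume "f \<in> carrier LR"
    then show "\<exists>g\<in>carrier LR. g + f = 0"
      by (intro bexI[of _ "- f"] LR_closed) auto
  qed (auto intro: LR_closed simp: add_ac)
  show "comm_monoid LR"
    by (rule comm_monoidI; unfold LR_simps(2-5)) (auto intro: LR_closed simp: mult_ac)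
qed (simp add: LR_simps(2-5) distrib_right)

end

section \<open>The ideal of the special fibre and generic units\<close>

locale alg_closed_valuation = nonarch_valuation v for v :: "'l::alg_closed_field \<Rightarrow> real"
begin

lemma special_fibre_idealE:
  assumes "f \<in> special_fibre_ideal v X t"
  obtains f0 g where "f = f0 + g" "f0 \<in> carrier LR"
    "\<forall>y\<in>X. laurent_eval f0 (\<lambda>i. y i / t i) = 0" "\<forall>u. v (Poly_Mapping.lookup g u) < 1"
  using assms by (auto simp: special_fibre_ideal_def)

lemma special_fibre_idealI:
  assumes "f0 \<in> carrier LR" "\<And>y. y \<in> X \<Longrightarrow> laurent_eval f0 (\<lambda>i. y i / t i) = 0"
    "\<And>u. v (Poly_Mapping.lookup g u) < 1"
  shows "f0 + g \<in> special_fibre_ideal v X t"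
  unfolding special_fibre_ideal_def using assms by blast

lemma special_fibre_ideal_subset: "special_fibre_ideal v X t \<subseteq> carrier LR"
proof
  fix f assume "f \<in> special_fibre_ideal v X t"
  then obtain f0 g where "f = f0 + g" "f0 \<in> carrier LR" "\<forall>u. v (Poly_Mapping.lookup g u) < 1"
    by (rule special_fibre_idealE) blast
  then show "f \<in> carrier LR"
    using LR_closed(2)[of f0 g] by (simp add: LR_simps less_imp_le)
qed

lemma special_fibre_ideal_add:
  assumes "f \<in> special_fibre_ideal v X t" "g \<in> special_fibre_ideal v X t"
  shows "f + g \<in> special_fibre_ideal v X t"
proof -
  obtain f0 f1 where f: "f = f0 + f1" "f0 \<in> carrier LR"
    "\<forall>y\<in>X. laurent_eval f0 (\<lambda>i. y i / t i) = 0" "\<forall>u. v (Poly_Mapping.lookup f1 u) < 1"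
    using assms(1) by (rule special_fibre_idealE)
  obtain g0 g1 where g: "g = g0 + g1" "g0 \<in> carrier LR"
    "\<forall>y\<in>X. laurent_eval g0 (\<lambda>i. y i / t i) = 0" "\<forall>u. v (Poly_Mapping.lookup g1 u) < 1"
    using assms(2) by (rule special_fibre_idealE)
  have "v (Poly_Mapping.lookup (f1 + g1) u) < 1" for u
    using ultra[of "Poly_Mapping.lookup f1 u" "Poly_Mapping.lookup g1 u"] spec[OF f(4), of u] spec[OF g(4), of u]
    unfolding lookup_add by linarith
  then have "(f0 + g0) + (f1 + g1) \<in> special_fibre_ideal v X t"
    using f g by (intro special_fibre_idealI LR_closed) (auto simp: laurent_eval_add)
  then show ?thesis
    by (simp add: f g add_ac)
qed

text \<open>The points of \<open>X\<close> are assumed to lie in the torus after division by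
  \<open>t\<close>, so that evaluation is multiplicative and vanishing is inherited by
  multiples.\<close>

lemma special_fibre_ideal_mult:
  assumes "f \<in> special_fibre_ideal v X t" "h \<in> carrier LR"
    and X: "\<And>y i. y \<in> X \<Longrightarrow> y i / t i \<noteq> 0"
  shows "h * f \<in> special_fibre_ideal v X t"
proof -
  obtain f0 f1 where f: "f = f0 + f1" "f0 \<in> carrier LR"
    "\<forall>y\<in>X. laurent_eval f0 (\<lambda>i. y i / t i) = 0" "\<forall>u. v (Poly_Mapping.lookup f1 u) < 1"
    using assms(1) by (rule special_fibre_idealE)
  have "h * f0 + h * f1 \<in> special_fibre_ideal v X t"
  proof (rule special_fibre_idealI)
    fix y assume "y \<in> X"
    then show "laurent_eval (h * f0) (\<lambda>i. y i / t i) = 0"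
      using f(3) X by (subst laurent_eval_mult) auto
  next
    fix u
    show "v (Poly_Mapping.lookup (h * f1) u) < 1"
      using assms(2) f(4) by (intro laurent_mult_less_1) (auto simp: LR_simps)
  qed (use f assms LR_closed in auto)
  then show ?thesis
    by (simp add: f distrib_left)
qed

lemma special_fibre_ideal_small:
  assumes "\<And>u. v (Poly_Mapping.lookup g u) < 1"
  shows "g \<in> special_fibre_ideal v X t"
  using special_fibre_idealI[of 0 X t g] assms LR_closed(6) by simp

lemma special_fibre_ideal_sum:
  assumes "\<And>x. x \<in> A \<Longrightarrow> f x \<in> special_fibre_ideal v X t"
  shows "(\<Sum>x\<in>A. f x) \<in> special_fibre_ideal v X t"
  using assms
  by (induction A rule: infinite_finite_induct)
    (auto intro: special_fibre_ideal_add special_fibre_ideal_small)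

lemma special_fibre_ideal_ideal:
  fixes X :: "('n::finite \<Rightarrow> 'l) set"
  assumes X: "\<And>y i. y \<in> X \<Longrightarrow> y i / t i \<noteq> 0"
  shows "ideal (special_fibre_ideal v X t) LR"
proof -
  interpret cring "LR :: ((int ^ 'n) \<Rightarrow>\<^sub>0 'l) ring"
    by (rule LR_cring)
  show ?thesis
  proof (rule idealI[OF ring_axioms])
    show "subgroup (special_fibre_ideal v X t) (add_monoid LR)"
    proof (rule subgroup.intro)
      fix f assume f: "f \<in> special_fibre_ideal v X t"
      then have "f \<in> carrier LR"
        using special_fibre_ideal_subset by blast
      then have "\<ominus>\<^bsub>LR\<^esub> f = - f"
        by (intro minus_equality) (auto simp: LR_simps(2-5) intro: LR_closed)
      then have "inv\<^bsub>add_monoid LR\<^esub> f = (- 1) * f"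
        by (simp add: a_inv_def)
      then show "inv\<^bsub>add_monoid LR\<^esub> f \<in> special_fibre_ideal v X t"
        using special_fibre_ideal_mult[OF f LR_closed(4)[OF LR_closed(5)]] X by simp
    qed (use special_fibre_ideal_subset special_fibre_ideal_add special_fibre_ideal_small[of 0]
        in \<open>auto simp: LR_simps(2-5)\<close>)
  next
    fix f h :: "(int ^ 'n) \<Rightarrow>\<^sub>0 'l"
    assume "f \<in> special_fibre_ideal v X t" "h \<in> carrier LR"
    then show "h \<otimes>\<^bsub>LR\<^esub> f \<in> special_fibre_ideal v X t"
      unfolding LR_simps(2) by (rule special_fibre_ideal_mult) (rule X)
    then show "f \<otimes>\<^bsub>LR\<^esub> h \<in> special_fibre_ideal v X t"
      by (simp add: LR_simps(2-5) mult.commute)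
  qed
qed

text \<open>A root of \<open>x \<Prod> (x - r) + 1\<close>, where \<open>r\<close> runs through the integral elements of \<open>R\<close>, does not
  reduce to any of them modulo the maximal ideal.\<close>

lemma generic_unit:
  assumes "finite R"
  shows "\<exists>z. v z = 1 \<and> (\<forall>r\<in>R. v (z - r) = max 1 (v r))"
proof -
  let ?S = "{r\<in>R. v r \<le> 1}"
  let ?P = "\<Prod>r\<in>?S. [:- r, 1:]"
  have fin: "finite ?S"
    using assms by simp
  have "?P \<noteq> 0"
    using fin by simp
  \<comment> \<open>\<open>pCons 1 ?P\<close> is \<open>1 + x * ?P\<close>. The factor
    \<open>x\<close> makes it nonconstant even if no integral element is given, and it brings
    \<open>z\<close> itself into a product of absolute value 1.\<close>
  then have "0 < degree (pCons 1 ?P)"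
    by simp
  then obtain z where "poly (pCons 1 ?P) z = 0"
    using alg_closed_imp_poly_has_root by blast
  then have "z * (\<Prod>r\<in>?S. z - r) = - 1"
    by (simp add: poly_prod eq_neg_iff_add_eq_0 add.commute)
  then have prod1: "v z * (\<Prod>r\<in>?S. v (z - r)) = 1"
    by (metis mult prod minus one)
  \<comment> \<open>If \<open>z\<close> were not integral, all factors would have absolute value
    above 1. Once every factor has absolute value at most 1, a product of absolute value 1 forces
    each to equal 1.\<close>
  have "v z \<le> 1"
  proof (rule ccontr)
    assume "\<not> v z \<le> 1"
    then have z: "1 < v z"
      by simp
    have "1 \<le> (\<Prod>r\<in>?S. v (z - r))"
    proof (rule prod_ge_1)
      fix r assume "r \<in> ?S"
      then have "v (z + - r) = v z"
        using z by (intro add_eq_left) auto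
      then show "1 \<le> v (z - r)"
        using z by simp
    qed
    then have "v z * 1 \<le> v z * (\<Prod>r\<in>?S. v (z - r))"
      by (intro mult_left_mono) auto
    then show False
      using prod1 z by simp
  qed
  have le: "v (z - r) \<le> 1" if "r \<in> ?S" for r
    using ultra_diff[of z r] that \<open>v z \<le> 1\<close> by auto
  have "(\<Prod>r\<in>?S. v (z - r)) \<le> 1"
    using le by (intro prod_le_1) auto
  then have vz: "v z = 1"
    using prod1 \<open>v z \<le> 1\<close> mult_left_le[of "\<Prod>r\<in>?S. v (z - r)" "v z"] by (metis mult.commute nonneg order_antisym mult_1)
  have "v (z - r) = max 1 (v r)" if "r \<in> R" for r
  proof (cases "v r \<le> 1")
    case True
    then have r: "r \<in> ?S"
      using that by simp
    have "(\<Prod>s\<in>?S. v (z - s)) = v (z - r) * (\<Prod>s\<in>?S - {r}. v (z - s))"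
      using fin r by (rule prod.remove)
    moreover have "(\<Prod>s\<in>?S - {r}. v (z - s)) \<le> 1"
      using le by (intro prod_le_1) auto
    ultimately have "1 \<le> v (z - r)"
      using prod1 vz mult_left_le[of "\<Prod>s\<in>?S - {r}. v (z - s)" "v (z - r)"] by simp
    then show ?thesis
      using le[OF r] True by simp
  next
    case False
    then show ?thesis
      using add_eq_left[of z "- r"] vz minus_commute[of z r] by (simp add: add.commute)
  qed
  then show ?thesis
    using vz by blast
qed

text \<open>The exceptional set consists of the roots. Away from their residue classes a factor
  \<open>z - r\<close> has absolute value \<open>max 1 (v r)\<close>, the Gauss norm of
  \<open>x - r\<close> at radius 1, and multiplying the factors bounds every coefficient.\<close>

lemma coeff_bound_at_generic:
  "\<exists>R. finite R \<and> (\<forall>z. v z = 1 \<longrightarrow> (\<forall>r\<in>R. v (z - r) = max 1 (v r)) \<longrightarrow>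
    (\<forall>k. v (coeff p k) \<le> v (poly p z)))"
proof (cases "p = 0")
  case True
  then show ?thesis
    by (intro exI[of _ "{}"]) auto
next
  case False
  then obtain A where p: "p = smult (lead_coeff p) (\<Prod>x\<in>#A. [:- x, 1:])"
    using alg_closed_imp_factorization by blast
  have "v (coeff (\<Prod>x\<in>#A. [:- x, 1:]) k) \<le> v (poly (\<Prod>x\<in>#A. [:- x, 1:]) z)"
    if z: "v z = 1" "\<forall>r\<in>set_mset A. v (z - r) = max 1 (v r)" for z k
    using z(2)
  proof (induction A arbitrary: k)
    case empty
    then show ?case
      by (cases k) auto
  next
    case (add x A)
    let ?p = "\<Prod>x\<in>#A. [:- x, 1:]"
    have IH: "v (coeff ?p k) \<le> v (poly ?p z)" for k
      using add by simp
    have "v (coeff ([:- x, 1:] * ?p) k) \<le> max 1 (v x) * v (poly ?p z)"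
    proof (cases k)
      case 0
      then show ?thesis
        using IH[of 0] by (auto simp: mult intro!: mult_mono)
    next
      case (Suc l)
      have "v (coeff ([:- x, 1:] * ?p) k) \<le> max (v (x * coeff ?p k)) (v (coeff ?p l))"
        using ultra_diff[of "coeff ?p l" "x * coeff ?p k"] by (simp add: Suc max.commute)
      also have "\<dots> \<le> max 1 (v x) * v (poly ?p z)"
      proof (rule max.boundedI)
        show "v (x * coeff ?p k) \<le> max 1 (v x) * v (poly ?p z)"
          unfolding mult using IH[of k] by (intro mult_mono) auto
        show "v (coeff ?p l) \<le> max 1 (v x) * v (poly ?p z)"
          using mult_mono[of 1 "max 1 (v x)" "v (coeff ?p l)" "v (poly ?p z)"] IH[of l] by simp
      qed
      finally show ?thesis .
    qed
    also have "max 1 (v x) * v (poly ?p z) = v (poly ([:- x, 1:] * ?p) z)"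
      using add.prems by (simp add: mult left_diff_distrib[symmetric] flip: minus_mult_left)
    finally show ?case
      by simp
  qed
  then have "v (coeff p k) \<le> v (poly p z)"
    if "v z = 1" "\<forall>r\<in>set_mset A. v (z - r) = max 1 (v r)" for z k
    using that by (subst (1 2) p) (auto simp: mult intro!: mult_left_mono)
  then show ?thesis
    by (intro exI[of _ "set_mset A"]) auto
qed

lemma generic_unit_coeff_bound:
  "\<exists>z. v z = 1 \<and> (\<forall>k. v (coeff p k) \<le> v (poly p z)) \<and> (\<forall>k. v (coeff q k) \<le> v (poly q z))"
proof -
  obtain R where R: "finite R" "\<And>z k. v z = 1 \<Longrightarrow> (\<forall>r\<in>R. v (z - r) = max 1 (v r)) \<Longrightarrow>
      v (coeff p k) \<le> v (poly p z)"
    using coeff_bound_at_generic[of p] by auto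
  obtain S where S: "finite S" "\<And>z k. v z = 1 \<Longrightarrow> (\<forall>r\<in>S. v (z - r) = max 1 (v r)) \<Longrightarrow>
      v (coeff q k) \<le> v (poly q z)"
    using coeff_bound_at_generic[of q] by auto
  obtain z where "v z = 1" "\<forall>r\<in>R \<union> S. v (z - r) = max 1 (v r)"
    using generic_unit[of "R \<union> S"] R S by auto
  then show ?thesis
    using R(2) S(2) by (intro exI[of _ z]) auto
qed

end

section \<open>The initial degeneration of a line\<close>

text \<open>The conditions say that the tropicalization of \<open>t\<close> lies on the
  \<open>i\<close>-th path, at a height that is not the logarithm of a distance from
  \<open>b i\<close>.\<close>

locale line_fibre = alg_closed_valuation v for v :: "'l::alg_closed_field \<Rightarrow> real" +
  fixes b t :: "'n::finite \<Rightarrow> 'l" and i :: 'n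
  assumes t_nz: "t m \<noteq> 0"
    and v_t: "v (t m) = max (v (t i)) (v (b i - b m))"
    and v_t_ne: "v (b i - b m) \<noteq> v (t i)"
begin

definition line :: "('n \<Rightarrow> 'l) set" where
  "line = {y. \<exists>c. \<forall>m. y m = c - b m \<and> y m \<noteq> 0}"

abbreviation "SF \<equiv> special_fibre_ideal v line t"

text \<open>The point of the line scaled by \<open>t\<close> whose \<open>i\<close>-th coordinate is
  \<open>z\<close>; the parameter on the unscaled line is \<open>b i + t i * z\<close>.\<close>

definition point :: "'l \<Rightarrow> 'n \<Rightarrow> 'l" where
  "point z m = (b i + t i * z - b m) / t m"

lemma point_i [simp]: "point z i = z"
  using t_nz by (simp add: point_def)

text \<open>The two summands \<open>t i * z\<close> and \<open>b i - b m\<close> have different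
  absolute values, so nothing cancels. Unit values of \<open>z\<close> therefore give points that
  reduce into the torus.\<close>

lemma v_point:
  assumes "v z = 1"
  shows "v (point z m) = 1"
proof -
  have "v (t i * z + (b i - b m)) = max (v (t i * z)) (v (b i - b m))"
    using v_t_ne[of m] assms by (intro add_eq_max) (simp add: mult)
  also have "\<dots> = v (t m)"
    by (simp add: mult assms v_t[of m])
  finally show ?thesis
    using t_nz[of m] by (simp add: point_def divide algebra_simps)
qed

lemma point_nz: "v z = 1 \<Longrightarrow> point z m \<noteq> 0"
  using v_point[of z m] by auto

lemma line_nz: "y \<in> line \<Longrightarrow> y m / t m \<noteq> 0"
  using t_nz by (auto simp: line_def)

lemma point_in_line:
  assumes "v z = 1"
  shows "\<exists>y\<in>line. point z = (\<lambda>m. y m / t m)"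
proof (rule bexI)
  show "(\<lambda>m. b i + t i * z - b m) \<in> line"
    using point_nz[OF assms] unfolding line_def point_def by auto
qed (auto simp: point_def)

lemma v_eval_small:
  assumes "\<And>u. v (Poly_Mapping.lookup g u) < 1" "\<And>m. v (y m) = 1"
  shows "v (laurent_eval g y) < 1"
  unfolding laurent_eval_def
  by (intro sum_less) (auto simp: mult prod power_int assms)

text \<open>Substitute for reduction modulo the maximal ideal: elements of the ideal vanish there at
  every unit point of the scaled line.\<close>

lemma v_eval_ideal:
  assumes "f \<in> SF" "v z = 1"
  shows "v (laurent_eval f (point z)) < 1"
proof -
  obtain f0 g where f: "f = f0 + g" "\<forall>y\<in>line. laurent_eval f0 (\<lambda>m. y m / t m) = 0"
    "\<forall>u. v (Poly_Mapping.lookup g u) < 1"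
    using assms(1) by (rule special_fibre_idealE) blast
  have "laurent_eval f0 (point z) = 0"
    using f(2) point_in_line[OF assms(2)] by auto
  then have "laurent_eval f (point z) = laurent_eval g (point z)"
    by (simp add: f(1) laurent_eval_add)
  then show ?thesis
    using v_eval_small[of g "point z"] f(3) v_point[OF assms(2)] by auto
qed

lemma laurent_eval_line:
  "laurent_eval (Poly_Mapping.single (axis m 1) c) y = c * y m"
  "laurent_eval (Poly_Mapping.single 0 c) y = c"
  by (simp_all add: laurent_eval_single prod_powi_axis)

text \<open>On the scaled line \<open>x_m = (t i / t m) * x_i + (b i - b m) / t m\<close>. Exactly
  one of the two coefficients has absolute value 1, and the other is in the maximal ideal, so
  \<open>k\<close> is 1 or 0.\<close>

lemma single_axis_mem_ideal:
  "\<exists>c k. v c = 1 \<and> Poly_Mapping.single (axis m 1) 1 - Poly_Mapping.single (axis i k) c \<in> SF"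
proof (cases "v (b i - b m) < v (t i)")
  case True
  then have vt: "v (t m) = v (t i)"
    by (simp add: v_t[of m])
  let ?c = "t i / t m" and ?a = "(b i - b m) / t m"
  let ?f = "Poly_Mapping.single (axis m 1) 1 - Poly_Mapping.single (axis i 1) ?c - Poly_Mapping.single 0 ?a"
  have c: "v ?c = 1" and a: "v ?a < 1"
    using t_nz[of i] True vt by (simp_all add: divide divide_less_eq_1)
  have "?f + Poly_Mapping.single 0 ?a \<in> SF"
  proof (rule special_fibre_idealI)
    show "?f \<in> carrier LR"
      using a c by (intro LR_closed) auto
    show "v (Poly_Mapping.lookup (Poly_Mapping.single 0 ?a) u) < 1" for u
      using a by (auto simp: lookup_single when_def)
    fix y assume "y \<in> line"
    then obtain c where "\<And>k. y k = c - b k"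
      by (auto simp: line_def)
    then show "laurent_eval ?f (\<lambda>k. y k / t k) = 0"
      using t_nz[of m] t_nz[of i] by (simp add: laurent_eval_diff laurent_eval_add laurent_eval_line field_simps)
  qed
  then show ?thesis
    using c by auto
next
  case False
  then have less: "v (t i) < v (b i - b m)"
    using v_t_ne[of m] by linarith
  then have vt: "v (t m) = v (b i - b m)"
    by (simp add: v_t[of m])
  let ?c = "t i / t m" and ?a = "(b i - b m) / t m"
  let ?f = "Poly_Mapping.single (axis m 1) 1 - Poly_Mapping.single (axis i 1) ?c - Poly_Mapping.single 0 ?a"
  have c: "v ?c < 1" and a: "v ?a = 1"
    using t_nz[of m] less vt by (auto simp: divide divide_less_eq_1)
  have "?f + Poly_Mapping.single (axis i 1) ?c \<in> SF"
  proof (rule special_fibre_idealI)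
    show "?f \<in> carrier LR"
      using a c by (intro LR_closed) auto
    show "v (Poly_Mapping.lookup (Poly_Mapping.single (axis i 1) ?c) u) < 1" for u
      using c by (auto simp: lookup_single when_def)
    fix y assume "y \<in> line"
    then obtain c where "\<And>k. y k = c - b k"
      by (auto simp: line_def)
    then show "laurent_eval ?f (\<lambda>k. y k / t k) = 0"
      using t_nz[of m] t_nz[of i] by (simp add: laurent_eval_diff laurent_eval_add laurent_eval_line field_simps)
  qed
  then show ?thesis
    using a by (intro exI[of _ ?a] exI[of _ "0 :: int"]) (simp add: axis_zero)
qed

text \<open>Being congruent to a unit times a power of the \<open>i\<close>-th variable is stable
  under products and inverses, so the case of a single variable suffices.\<close>

lemma single_mem_ideal:
  "\<exists>c k. v c = 1 \<and> Poly_Mapping.single u 1 - Poly_Mapping.single (axis i k) c \<in> SF"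
proof (induction u rule: int_vec_subgroup_induct)
  case 1
  then show ?case
    by (rule single_axis_mem_ideal)
next
  case 2
  show ?case
    using special_fibre_ideal_small[of 0]
    by (intro exI[of _ "1 :: 'l"] exI[of _ "0 :: int"]) (simp add: axis_zero)
next
  case (3 u w)
  then obtain c k c' k' where c: "v c = 1" "Poly_Mapping.single u 1 - Poly_Mapping.single (axis i k) c \<in> SF"
    and c': "v c' = 1" "Poly_Mapping.single w 1 - Poly_Mapping.single (axis i k') c' \<in> SF"
    by blast
  \<comment> \<open>The difference of two products is split by replacing one factor at a
    time.\<close>
  have "Poly_Mapping.single u 1 * (Poly_Mapping.single w 1 - Poly_Mapping.single (axis i k') c') +
    Poly_Mapping.single (axis i k') c' * (Poly_Mapping.single u 1 - Poly_Mapping.single (axis i k) c) \<in> SF"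
    using c c' by (intro special_fibre_ideal_add special_fibre_ideal_mult LR_closed line_nz) auto
  also have "Poly_Mapping.single u 1 * (Poly_Mapping.single w 1 - Poly_Mapping.single (axis i k') c') +
    Poly_Mapping.single (axis i k') c' * (Poly_Mapping.single u 1 - Poly_Mapping.single (axis i k) c) =
    Poly_Mapping.single (u + w) 1 - Poly_Mapping.single (axis i (k' + k)) (c' * c)"
    by (simp add: right_diff_distrib mult_single axis_add add.commute)
  finally show ?case
    using c c' by (intro exI[of _ "c' * c"] exI[of _ "k' + k"]) (simp add: mult)
next
  case (4 u)
  then obtain c k where c: "v c = 1" "Poly_Mapping.single u 1 - Poly_Mapping.single (axis i k) c \<in> SF"
    by blast
  then have "c \<noteq> 0"
    by auto
  have exps: "(- u + axis i (- k)) + axis i k = - u" "(- u + axis i (- k)) + u = axis i (- k)"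
    by (simp_all add: vec_eq_iff axis_def)
  \<comment> \<open>Multiplying by minus the inverse of both monomials turns the congruence for
    \<open>u\<close> into that for \<open>- u\<close>.\<close>
  have "Poly_Mapping.single (- u + axis i (- k)) (- inverse c) *
    (Poly_Mapping.single u 1 - Poly_Mapping.single (axis i k) c) \<in> SF"
    using c by (intro special_fibre_ideal_mult LR_closed line_nz) (auto simp: inverse)
  also have "Poly_Mapping.single (- u + axis i (- k)) (- inverse c) *
    (Poly_Mapping.single u 1 - Poly_Mapping.single (axis i k) c) =
    Poly_Mapping.single (- u) 1 - Poly_Mapping.single (axis i (- k)) (inverse c)"
    unfolding right_diff_distrib mult_single exps
    using \<open>c \<noteq> 0\<close> by (simp add: single_uminus)
  finally show ?case
    using c by (intro exI[of _ "inverse c"] exI[of _ "- k"]) (simp add: inverse)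
qed

text \<open>The polynomial \<open>q\<close> represents \<open>f\<close> up to a power of the \<open>i\<close>-th variable.\<close>

lemma polynomial_representative:
  assumes f: "f \<in> carrier LR"
  obtains q where "\<And>z. v z = 1 \<Longrightarrow> v (laurent_eval f (point z)) < 1 \<Longrightarrow> v (poly q z) < 1"
    and "(\<And>k. v (coeff q k) < 1) \<Longrightarrow> f \<in> SF"
proof -
  obtain c :: "int ^ 'n \<Rightarrow> 'l" and e where c: "\<And>u. v (c u) = 1"
    "\<And>u. Poly_Mapping.single u 1 - Poly_Mapping.single (axis i (e u)) (c u) \<in> SF"
    using single_mem_ideal by metis
  let ?K = "Poly_Mapping.keys f" and ?f = "Poly_Mapping.lookup f"
  \<comment> \<open>\<open>h\<close> replaces each monomial of \<open>f\<close> by its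
    representative in the \<open>i\<close>-th variable, so it agrees with \<open>f\<close> modulo
    the ideal.\<close>
  define h where "h = (\<Sum>u\<in>?K. Poly_Mapping.single (axis i (e u)) (?f u * c u))"
  \<comment> \<open>A shift that makes all exponents \<open>N + e u\<close> nonnegative; the
    inserted 0 covers the case that \<open>f\<close> has no monomials.\<close>
  define N where "N = Max (insert 0 ((\<lambda>u. \<bar>e u\<bar>) ` ?K))"
  have N: "0 \<le> N + e u" if "u \<in> ?K" for u
  proof -
    have "\<bar>e u\<bar> \<le> N"
      unfolding N_def using that by (intro Max_ge) auto
    then show ?thesis
      by linarith
  qed
  define q where "q = (\<Sum>u\<in>?K. monom (?f u * c u) (nat (N + e u)))"
  have "f - h = (\<Sum>u\<in>?K. Poly_Mapping.single 0 (?f u) *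
      (Poly_Mapping.single u 1 - Poly_Mapping.single (axis i (e u)) (c u)))"
    by (subst poly_mapping_sum_single[of f])
      (simp add: h_def right_diff_distrib mult_single sum_subtractf)
  also have "\<dots> \<in> SF"
    using f c(2) by (intro special_fibre_ideal_sum special_fibre_ideal_mult LR_closed line_nz)
      (auto simp: LR_simps)
  finally have fh: "f - h \<in> SF" .
  have eval_q: "poly q z = z powi N * laurent_eval h (point z)" if "v z = 1" for z
  proof -
    have "z \<noteq> 0"
      using that by auto
    have "z powi N * laurent_eval h (point z) =
        (\<Sum>u\<in>?K. z powi N * (?f u * c u * z powi e u))"
      by (simp add: h_def laurent_eval_sum laurent_eval_single prod_powi_axis sum_distrib_left)
    also have "\<dots> = (\<Sum>u\<in>?K. ?f u * c u * z ^ nat (N + e u))"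
    proof (rule sum.cong[OF refl])
      fix u assume "u \<in> ?K"
      then have "z powi (N + e u) = z ^ nat (N + e u)"
        using N by (simp add: power_int_def)
      then have "z ^ nat (N + e u) = z powi N * z powi e u"
        using \<open>z \<noteq> 0\<close> by (simp add: power_int_add)
      then show "z powi N * (?f u * c u * z powi e u) = ?f u * c u * z ^ nat (N + e u)"
        by simp
    qed
    finally show ?thesis
      by (simp add: q_def poly_sum poly_monom)
  qed
  show thesis
  proof (rule that)
    fix z assume z: "v z = 1" and small: "v (laurent_eval f (point z)) < 1"
    \<comment> \<open>This difference is the value of \<open>h\<close>. The remaining factor
      \<open>z powi N\<close> has absolute value 1 and does not affect the bound.\<close>
    have "v (laurent_eval f (point z) - laurent_eval (f - h) (point z)) < 1"
      using ultra_diff[of "laurent_eval f (point z)" "laurent_eval (f - h) (point z)"] small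
        v_eval_ideal[OF fh z] by linarith
    then show "v (poly q z) < 1"
      by (simp add: laurent_eval_diff eval_q[OF z] mult power_int z)
  next
    assume coeffs: "\<And>k. v (coeff q k) < 1"
    have "v (Poly_Mapping.lookup h w) < 1" for w
    proof (cases "\<exists>u\<in>?K. axis i (e u) = w")
      case True
      then obtain u0 where u0: "u0 \<in> ?K" "axis i (e u0) = w"
        by blast
      \<comment> \<open>Several monomials of \<open>f\<close> may share a representative exponent;
        \<open>h\<close> and \<open>q\<close> collect them in the same way, so their coefficients
        correspond.\<close>
      have "axis i (e u) = w \<longleftrightarrow> nat (N + e u) = nat (N + e u0)" if "u \<in> ?K" for u
        using N[OF that] N[OF u0(1)] u0(2) by (auto simp: axis_eq_axis)
      then have "Poly_Mapping.lookup h w = coeff q (nat (N + e u0))"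
        unfolding h_def q_def lookup_sum coeff_sum
        by (intro sum.cong refl) (auto simp: lookup_single when_def)
      then show ?thesis
        using coeffs by simp
    next
      case False
      then have "Poly_Mapping.lookup h w = 0"
        unfolding h_def lookup_sum by (intro sum.neutral) (auto simp: lookup_single when_def)
      then show ?thesis
        by simp
    qed
    then have "h \<in> SF"
      by (rule special_fibre_ideal_small)
    then show "f \<in> SF"
      using special_fibre_ideal_add[OF fh] by fastforce
  qed
qed

lemma special_fibre_prime: "primeideal SF LR"
proof (rule primeidealI[OF _ LR_cring])
  show "ideal SF LR"
    by (rule special_fibre_ideal_ideal) (rule line_nz)
next
  have "(1 :: (int ^ 'n) \<Rightarrow>\<^sub>0 'l) \<notin> SF"
    using v_eval_ideal[of 1 1] by auto
  then show "carrier LR \<noteq> SF"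
    using LR_closed(5) by blast
next
  fix f g :: "(int ^ 'n) \<Rightarrow>\<^sub>0 'l"
  assume f: "f \<in> carrier LR" and g: "g \<in> carrier LR" and fg: "f \<otimes>\<^bsub>LR\<^esub> g \<in> SF"
  obtain p where p: "\<And>z. v z = 1 \<Longrightarrow> v (laurent_eval f (point z)) < 1 \<Longrightarrow> v (poly p z) < 1"
    "(\<And>k. v (coeff p k) < 1) \<Longrightarrow> f \<in> SF"
    using polynomial_representative[OF f] by metis
  obtain q where q: "\<And>z. v z = 1 \<Longrightarrow> v (laurent_eval g (point z)) < 1 \<Longrightarrow> v (poly q z) < 1"
    "(\<And>k. v (coeff q k) < 1) \<Longrightarrow> g \<in> SF"
    using polynomial_representative[OF g] by metis
  \<comment> \<open>One \<open>z\<close> serves both representatives. It is chosen before it is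
    known which factor is small at it; for that factor, one small value bounds all
    coefficients.\<close>
  obtain z where z: "v z = 1" "\<And>k. v (coeff p k) \<le> v (poly p z)" "\<And>k. v (coeff q k) \<le> v (poly q z)"
    using generic_unit_coeff_bound by blast
  have "v (laurent_eval (f * g) (point z)) < 1"
    using v_eval_ideal[OF _ z(1)] fg by (simp add: LR_simps(2))
  then have less: "v (laurent_eval f (point z)) * v (laurent_eval g (point z)) < 1"
    by (simp add: laurent_eval_mult point_nz[OF z(1)] mult)
  have "v (laurent_eval f (point z)) < 1 \<or> v (laurent_eval g (point z)) < 1"
  proof (rule ccontr)
    assume "\<not> ?thesis"
    then have "1 * 1 \<le> v (laurent_eval f (point z)) * v (laurent_eval g (point z))"
      by (intro mult_mono) auto
    then show False
      using less by simp
  qed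
  then show "f \<in> SF \<or> g \<in> SF"
    using p q z by (meson order_le_less_trans)
qed

lemma tropical_multiplicity_line: "tropical_multiplicity v line t = 1"
  unfolding tropical_multiplicity_def initial_degeneration_def
  by (rule component_multiplicity_sum_domain, rule primeideal.quotient_is_domain, rule special_fibre_prime)

end

section \<open>Canonical weights on the edges of the tree\<close>

text \<open>Roots of an element with positive logarithm of its absolute value give steps shorter
  than the interval, and the multiples of such a step cannot jump over it.\<close>

lemma (in alg_closed_valuation) value_group_dense:
  assumes "nontrivial_absolute_value v" "\<alpha> < \<beta>"
  shows "\<exists>x. x \<noteq> 0 \<and> \<alpha> < ln (v x) \<and> ln (v x) < \<beta>"
proof -
  obtain y where y: "y \<noteq> 0" "v y \<noteq> 1"
    using assms(1) by (auto simp: nontrivial_absolute_value_def)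
  obtain x where x: "x \<noteq> 0" "0 < ln (v x)"
  proof (cases "1 < v y")
    case True
    then show ?thesis
      using y that[of y] by simp
  next
    case False
    then have "ln (v y) < 0"
      using y by simp
    then show ?thesis
      using y that[of "inverse y"] by (simp add: inverse ln_inverse)
  qed
  obtain n where n: "ln (v x) < real n * (\<beta> - \<alpha>)"
    using reals_Archimedean3[of "\<beta> - \<alpha>"] assms(2) by auto
  then have "0 < n"
    using x(2) by (cases n) auto
  then obtain r where r: "r ^ n = x"
    using nth_root_exists by blast
  then have "r \<noteq> 0"
    using x(1) \<open>0 < n\<close> by auto
  define e where "e = ln (v r)"
  have "ln (v x) = real n * e"
    using \<open>r \<noteq> 0\<close> by (simp add: e_def power ln_realpow flip: r)
  then have e: "0 < e" "e < \<beta> - \<alpha>"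
    using x(2) n \<open>0 < n\<close> by (auto simp: zero_less_mult_iff)
  \<comment> \<open>The least integer with \<open>\<alpha> < of_int k * e\<close>; one step
    \<open>e\<close> is shorter than \<open>\<beta> - \<alpha>\<close>, so this multiple stays below
    \<beta>.\<close>
  define k where "k = \<lfloor>\<alpha> / e\<rfloor> + 1"
  have "\<alpha> / e < of_int k" "of_int k \<le> \<alpha> / e + 1"
    unfolding k_def by linarith+
  then have "\<alpha> < of_int k * e" "of_int k * e \<le> \<alpha> + e"
    using e(1) by (simp_all add: field_simps)
  moreover have "ln (v (r powi k)) = of_int k * e"
    using \<open>r \<noteq> 0\<close> by (simp add: power_int e_def ln_powr flip: powr_real_of_int')
  ultimately show ?thesis
    using e(2) \<open>r \<noteq> 0\<close> by (intro exI[of _ "r powi k"]) simp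
qed

lemma ultrametric_tree_represents_Trop:
  fixes v :: "'k::field \<Rightarrow> real" and vL :: "'l::alg_closed_field \<Rightarrow> real"
    and a :: "'r::finite \<Rightarrow> 'k"
  assumes ext: "valued_extension v vL j" and nontrivial: "nontrivial_absolute_value vL"
    and \<phi>: "\<And>i. \<phi> i = [:- a i, 1:]"
    and tree: "ultrametric_tree (\<lambda>i m. v (a i - a m)) T"
  shows "represents_Trop v vL j \<phi> (tree_complex (\<lambda>i m. v (a i - a m)) T)"
proof -
  let ?d = "\<lambda>i m. v (a i - a m)"
  interpret v: nonarch_valuation v
    using ext by unfold_locales (simp add: valued_extension_def)
  interpret L: alg_closed_valuation vL
    using ext by unfold_locales (simp add: valued_extension_def)
  interpret tree: ultrametric_tree ?d T
    by (rule tree)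
  have j_add: "j (x + y) = j x + j y" and j_1: "j 1 = 1" and v_j: "vL (j x) = v x" for x y
    using ext by (auto simp: valued_extension_def)
  have j_0: "j 0 = 0"
    using j_add[of 0 0] by (metis add.right_neutral add_left_cancel)
  have j_diff: "j (x - y) = j x - j y" for x y
    using j_add[of "x - y" y] by simp
  have j_uminus: "j (- x) = - j x" for x
    using j_diff[of 0 x] j_0 by simp
  have map_\<phi>: "map_poly j (\<phi> i) = [:- j (a i), 1:]" for i
    by (simp add: \<phi> map_poly_pCons j_0 j_1 j_uminus)
  have dist: "vL (j (a i) - j (a m)) = ?d i m" for i m
    using v_j[of "a i - a m"] by (simp add: j_diff)
  have curve: "curve (tree_complex ?d T) = Trop v \<phi>"
    unfolding tree.curve_tree tree.trop_paths_eq[symmetric] using v.Trop_linear[of \<phi> a, OF \<phi>] by simp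
  have "(\<exists>t. (\<forall>i. t i \<noteq> 0) \<and> log_abs vL t \<in> rel_interior \<sigma>)" (is ?A)
    and "\<forall>t. (\<forall>i. t i \<noteq> 0) \<and> log_abs vL t \<in> rel_interior \<sigma> \<longrightarrow>
      tropical_multiplicity vL (torus_points (\<lambda>i. map_poly j (\<phi> i))) t = 1" (is ?B)
    if \<sigma>: "\<sigma> \<in> edges (tree_complex ?d T)" for \<sigma>
  proof -
    obtain i x where x: "x \<notin> T i" and \<sigma>_eq: "\<sigma> = tree_path ?d i ` cell (T i) x"
      using \<sigma> by (rule tree.edgeE)
    have interior: "rel_interior \<sigma> = tree_path ?d i ` (cell (T i) x - T i)"
      unfolding \<sigma>_eq by (rule tree.rel_interior_edge[OF x])
    show ?A
    proof -
      obtain e where e: "0 < e" "ball x e \<subseteq> interior (cell (T i) x)"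
        using cell_interior[OF tree.finite_T x self_in_cell x] open_contains_ball[of "interior (cell (T i) x)"]
        by blast
      obtain y where y: "y \<noteq> 0" "x < ln (vL y)" "ln (vL y) < x + e"
        using L.value_group_dense[OF nontrivial, of x "x + e"] e(1) by auto
      define w where "w = ln (vL y)"
      have "w \<in> interior (cell (T i) x)"
        using e(2) y by (auto simp: w_def dist_real_def subset_eq)
      then have w: "w \<in> cell (T i) x - T i"
        using cell_not_interior[OF x] interior_subset by blast
      \<comment> \<open>Coordinates inside the ball all have absolute value \<open>exp w\<close>,
        realised by \<open>y\<close>; those outside equal distances of the ground field, which are
        values already.\<close>
      define t where "t m = (if ?d i m \<le> exp w then y else j (a i - a m))" for m
      have "t m \<noteq> 0" for m
      proof (cases "?d i m \<le> exp w")
        case False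
        then have "0 < ?d i m"
          using exp_gt_zero[of w] by linarith
        then have "vL (t m) \<noteq> 0"
          using False by (simp add: t_def v_j)
        then show ?thesis
          by auto
      qed (simp add: t_def y)
      moreover have "log_abs vL t = tree_path ?d i w"
        using y(1) by (auto simp: log_abs_def tree_path_def vec_eq_iff t_def v_j w_def max_def)
      ultimately show ?thesis
        unfolding interior using w by (intro exI[of _ t]) auto
    qed
    show ?B
    proof (intro allI impI)
      fix t :: "'r \<Rightarrow> 'l" assume t: "(\<forall>i. t i \<noteq> 0) \<and> log_abs vL t \<in> rel_interior \<sigma>"
      then obtain w where w: "w \<notin> T i" "log_abs vL t = tree_path ?d i w"
        unfolding interior by auto
      have vt: "vL (t m) = max (exp w) (?d i m)" for m
      proof -
        have "log_abs vL t $ m = tree_path ?d i w $ m"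
          by (simp add: w(2))
        then have "ln (vL (t m)) = ln (max (exp w) (?d i m))"
          by (simp add: log_abs_def tree_path_def)
        moreover have "0 < vL (t m)" "0 < max (exp w) (?d i m)"
          using t by (auto simp: less_max_iff_disj)
        ultimately show ?thesis
          by (metis ln_inj_iff)
      qed
      have vti: "vL (t i) = exp w"
        by (simp add: vt)
      interpret F: line_fibre vL "\<lambda>m. j (a m)" t i
      proof
        fix m
        show "t m \<noteq> 0"
          using t by blast
        show "vL (t m) = max (vL (t i)) (vL (j (a i) - j (a m)))"
          unfolding dist vti by (rule vt)
        show "vL (j (a i) - j (a m)) \<noteq> vL (t i)"
          unfolding dist vti
        \<comment> \<open>Equality would make \<open>w\<close> the logarithm of a distance from the
          \<open>i\<close>-th point, hence the parameter of a vertex.\<close>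
        proof
          assume "?d i m = exp w"
          then have "w \<in> T i"
            using tree.T_dist[of i m] by simp
          then show False
            using w(1) by contradiction
        qed
      qed
      have "torus_points (\<lambda>i. map_poly j (\<phi> i)) = F.line"
        by (simp add: torus_points_def F.line_def map_\<phi> conj_commute cong: conj_cong)
      then show "tropical_multiplicity vL (torus_points (\<lambda>i. map_poly j (\<phi> i))) t = 1"
        by (simp add: F.tropical_multiplicity_line)
    qed
  qed
  moreover have "weight (tree_complex ?d T) \<sigma> = 1" for \<sigma>
    by (simp add: tree_complex_def)
  ultimately show ?thesis
    unfolding represents_Trop_def using tree.tropical_structure_tree curve
    by (simp add: one_enat_def)
qed

section \<open>Adding a point\<close>

lemma ln_max: "0 < x \<Longrightarrow> 0 < y \<Longrightarrow> max (ln x) (ln y) = ln (max x y)" for x y :: real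
  by (simp add: max_def)

lemma open_small_step:
  fixes z u :: "'a::real_normed_vector"
  assumes "open U" "z \<in> U" "0 < e"
  shows "\<exists>h>0. h < e \<and> z + h *\<^sub>R u \<in> U"
proof -
  obtain r where r: "0 < r" "ball z r \<subseteq> U"
    using assms(1,2) open_contains_ball by blast
  define h where "h = min (e / 2) (r / (2 * (norm u + 1)))"
  have "0 < norm u + 1"
    using norm_ge_zero[of u] by linarith
  then have h: "0 < h" "h < e"
    using r(1) assms(3) by (auto simp: h_def)
  have "h * norm u \<le> r / (2 * (norm u + 1)) * norm u"
    by (intro mult_right_mono) (auto simp: h_def)
  also have "\<dots> < r"
    using r(1) \<open>0 < norm u + 1\<close> by (simp add: field_simps add_nonneg_pos)
  finally have "dist z (z + h *\<^sub>R u) < r"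
    using h(1) by (simp add: dist_norm)
  then show ?thesis
    using r(2) h by (intro exI[of _ h]) auto
qed

lemma same_tropical_curve_refl: "tropical_structure C \<Longrightarrow> same_tropical_curve C C"
  by (auto simp: same_tropical_curve_def subdivision_def tropical_structure_def)

text \<open>Here \<open>k\<close> is the index of the new coordinate, and \<open>i0\<close> that of an old point nearest to the
  new one.\<close>

locale tree_modification =
  fixes d :: "'s::finite \<Rightarrow> 's \<Rightarrow> real" and \<iota> :: "'r::finite \<Rightarrow> 's" and k :: 's and i0 :: 'r
  assumes d_nonneg: "0 \<le> d m n" and d_self: "d m m = 0" and d_sym: "d m n = d n m"
    and d_ultra: "d m l \<le> max (d m n) (d n l)"
    and inj: "inj \<iota>" and range: "range \<iota> = UNIV - {k}"
    and dist_pos: "0 < d (\<iota> i) k" and nearest: "d (\<iota> i0) k \<le> d (\<iota> i) k"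
begin

definition \<delta> :: real where "\<delta> = d (\<iota> i0) k"

text \<open>Distances to the new point are included. So the old tree has a vertex wherever the graph
  bends, and in particular where the ray is attached.\<close>

definition heights :: "real set" where
  "heights = {ln (d m n) | m n. 0 < d m n}"

definition TX :: "'r \<Rightarrow> real set" where "TX i = heights"

text \<open>Below \<open>ln \<delta>\<close> the new path is the vertical ray, which a modification does not subdivide.\<close>

definition TY :: "'s \<Rightarrow> real set" where
  "TY m = (if m = k then {t \<in> heights. ln \<delta> \<le> t} else heights)"

definition dX :: "'r \<Rightarrow> 'r \<Rightarrow> real" where "dX i j = d (\<iota> i) (\<iota> j)"

text \<open>On the curve the coordinate is below \<open>\<infinity>\<close>, and the maximum with a
  finite number excludes \<open>-\<infinity>\<close>, so the conversion to a real loses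
  nothing.\<close>

definition P :: "ereal ^ 'r \<Rightarrow> real" where
  "P y = real_of_ereal (max (y $ i0) (ereal (ln \<delta>)))"

abbreviation "CX \<equiv> tree_complex dX TX"
abbreviation "CY \<equiv> tree_complex d TY"
abbreviation "z0 \<equiv> tree_path dX i0 (ln \<delta>)"

lemma \<delta>_pos: "0 < \<delta>"
  by (simp add: \<delta>_def dist_pos)

lemma \<iota>_ne [simp]: "\<iota> i \<noteq> k"
  using range by auto

lemma index_cases:
  obtains "m = k" | i where "m = \<iota> i"
  using range by (cases "m = k") auto

lemma TY_\<iota> [simp]: "TY (\<iota> i) = heights"
  by (simp add: TY_def)

lemma finite_heights: "finite heights"
proof (rule finite_subset)
  show "heights \<subseteq> (\<lambda>(m, n). ln (d m n)) ` UNIV"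
    by (auto simp: heights_def)
qed simp

lemma ln_\<delta>_height: "ln \<delta> \<in> heights"
  using dist_pos[of i0] unfolding heights_def \<delta>_def by blast

text \<open>As \<open>i0\<close> is nearest to the new point, its triangle with \<open>i\<close> and
  \<open>k\<close> has the side from \<open>i\<close> to \<open>k\<close> equal to the maximum of
  the other two. This expresses every distance to the new point by old ones and \<delta>.\<close>

lemma max_nearest: "max (dX i i0) \<delta> = d (\<iota> i) k"
  unfolding dX_def \<delta>_def
  using d_ultra[of "\<iota> i" k "\<iota> i0"] d_ultra[of "\<iota> i" "\<iota> i0" k] nearest[of i] d_sym[of k "\<iota> i0"] by linarith

sublocale X: ultrametric_tree dX TX
proof
  fix i j t assume "0 < dX i j"
  then show "ln (dX i j) \<in> TX i"
    unfolding TX_def heights_def dX_def by blast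
qed (use d_nonneg d_self d_sym d_ultra finite_heights in \<open>auto simp: dX_def TX_def\<close>)

sublocale Y: ultrametric_tree d TY
proof
  fix m n assume pos: "0 < d m n"
  then have h: "ln (d m n) \<in> heights"
    unfolding heights_def by blast
  show "ln (d m n) \<in> TY m"
  proof (cases m rule: index_cases)
    case 1
    then obtain i where "n = \<iota> i"
      using pos d_self by (cases n rule: index_cases) auto
    \<comment> \<open>No old point is nearer than \<delta>, so omitting the heights below
      \<open>ln \<delta>\<close> loses no bend of the new path.\<close>
    then have "\<delta> \<le> d m n"
      using nearest[of i] d_sym[of k "\<iota> i"] by (simp add: 1 \<delta>_def)
    then have "ln \<delta> \<le> ln (d m n)"
      using pos \<delta>_pos by simp
    then show ?thesis
      using h unfolding TY_def 1 by simp
  next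
    case 2
    then show ?thesis
      using h by simp
  qed
next
  fix t m n assume t: "t \<in> TY m" "d m n \<le> exp t"
  then have h: "t \<in> heights"
    by (auto simp: TY_def split: if_splits)
  show "t \<in> TY n"
  proof (cases n rule: index_cases)
    case 1
    show ?thesis
    proof (cases m rule: index_cases)
      case 2
      \<comment> \<open>An old path meets the new one only at radius \<delta> or more, where both
        carry the same heights.\<close>
      then have "\<delta> \<le> exp t"
        using nearest t(2) 1 unfolding \<delta>_def by (metis order_trans)
      then show ?thesis
        using h \<delta>_pos 1 by (simp add: TY_def le_exp_iff)
    qed (use t 1 in simp)
  qed (use h in simp)
qed (use d_nonneg d_self d_sym d_ultra finite_heights in \<open>auto simp: TY_def\<close>)

section \<open>The graph of the modification function and the vertical ray\<close>

lemma P_finite_point: "P (finite_point x) = max (x $ i0) (ln \<delta>)"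
  by (simp add: P_def finite_point_def max_def)

text \<open>Along the \<open>i\<close>-th path, P is the new coordinate of the corresponding path
  upstairs, although it is defined by the coordinate \<open>i0\<close> alone.\<close>

lemma P_path: "P (finite_point (tree_path dX i t)) = ln (max (exp t) (d (\<iota> i) k))"
proof -
  have "P (finite_point (tree_path dX i t)) = max (ln (max (exp t) (dX i i0))) (ln \<delta>)"
    by (simp add: P_finite_point tree_path_def)
  also have "\<dots> = ln (max (max (exp t) (dX i i0)) \<delta>)"
    using \<delta>_pos by (intro ln_max) (auto simp: less_max_iff_disj)
  finally show ?thesis
    by (simp add: max_nearest max.assoc)
qed

lemma add_coordinate_\<iota>: "add_coordinate \<iota> x t $ \<iota> i = x $ i"
  by (simp add: add_coordinate_def inv_into_f_f[OF inj])

lemma add_coordinate_k: "add_coordinate \<iota> x t $ k = t"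
  by (simp add: add_coordinate_def range)

lemma vec_eqI:
  assumes "x $ k = y $ k" "\<And>i. x $ \<iota> i = y $ \<iota> i"
  shows "x = y"
  unfolding vec_eq_iff using assms by (metis index_cases)

lemma graph_path: "graph_point \<iota> P (tree_path dX i t) = tree_path d (\<iota> i) t"
proof (rule vec_eqI)
  show "graph_point \<iota> P (tree_path dX i t) $ k = tree_path d (\<iota> i) t $ k"
    unfolding graph_point_def add_coordinate_k P_path by (simp add: tree_path_def)
next
  fix j
  show "graph_point \<iota> P (tree_path dX i t) $ \<iota> j = tree_path d (\<iota> i) t $ \<iota> j"
    unfolding graph_point_def add_coordinate_\<iota> by (simp add: tree_path_def dX_def)
qed

lemma d_k: "d k (\<iota> i) = max (dX i0 i) \<delta>"
  using max_nearest[of i] d_sym[of k "\<iota> i"] X.d_sym[of i i0] by simp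

text \<open>At radii below \<delta> no old point lies in the ball around the new one, so the old
  coordinates stay constant and only the new one moves.\<close>

lemma vertical_ray_z0: "vertical_ray \<iota> P z0 = tree_path d k ` {..ln \<delta>}"
proof -
  have P0: "P (finite_point z0) = ln \<delta>"
    using \<delta>_pos by (simp add: P_path \<delta>_def)
  have "add_coordinate \<iota> z0 t = tree_path d k t" if "t \<le> ln \<delta>" for t
  proof (rule vec_eqI)
    show "add_coordinate \<iota> z0 t $ k = tree_path d k t $ k"
      unfolding add_coordinate_k by simp
  next
    fix i
    have "exp t \<le> \<delta>"
      using that \<delta>_pos by (simp add: ln_ge_iff)
    then have "max \<delta> (dX i0 i) = max (exp t) (d k (\<iota> i))"
      unfolding d_k by linarith
    then show "add_coordinate \<iota> z0 t $ \<iota> i = tree_path d k t $ \<iota> i"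
      unfolding add_coordinate_\<iota> using \<delta>_pos by (simp add: tree_path_def)
  qed
  then have "add_coordinate \<iota> z0 ` {..ln \<delta>} = tree_path d k ` {..ln \<delta>}"
    by (intro image_cong) auto
  then show ?thesis
    unfolding vertical_ray_def P0 by (simp add: setcompr_eq_image atMost_def)
qed

lemma Y_edge_k:
  assumes "t < ln \<delta>"
  shows "tree_path d k ` cell (TY k) t = vertical_ray \<iota> P z0"
proof -
  have "ln \<delta> \<in> TY k"
    using ln_\<delta>_height by (simp add: TY_def)
  then have "cell (TY k) t = {..ln \<delta>}"
    using assms unfolding cell_def by (auto simp: TY_def)
  then show ?thesis
    by (simp add: vertical_ray_z0)
qed

lemma Y_path_k: "ln \<delta> \<le> t \<Longrightarrow> tree_path d k t = tree_path d (\<iota> i0) t"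
  using \<delta>_pos by (subst Y.path_eq_iff) (simp add: d_sym[of k] ln_ge_iff le_exp_iff flip: \<delta>_def)

lemma graph_edge: "graph_point \<iota> P ` tree_path dX i ` cell (TX i) t = tree_path d (\<iota> i) ` cell (TY (\<iota> i)) t"
  by (simp add: image_image graph_path TX_def)

lemma edges_CY: "edges CY = (\<lambda>\<sigma>. graph_point \<iota> P ` \<sigma>) ` edges CX \<union> {vertical_ray \<iota> P z0}"
proof (intro equalityI subsetI)
  fix \<sigma> assume "\<sigma> \<in> edges CY"
  then obtain m t where t: "t \<notin> TY m" "\<sigma> = tree_path d m ` cell (TY m) t"
    by (rule Y.edgeE)
  have X: "tree_path d (\<iota> i) ` cell (TY (\<iota> i)) t \<in> (\<lambda>\<sigma>. graph_point \<iota> P ` \<sigma>) ` edges CX"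
    if "t \<notin> heights" for i
    unfolding graph_edge[symmetric] using that by (intro imageI X.edgeI) (simp add: TX_def)
  show "\<sigma> \<in> (\<lambda>\<sigma>. graph_point \<iota> P ` \<sigma>) ` edges CX \<union> {vertical_ray \<iota> P z0}"
  proof (cases m rule: index_cases)
    case 1
    show ?thesis
    proof (cases "t < ln \<delta>")
      case True
      then show ?thesis
        using t(2) Y_edge_k by (simp add: 1)
    next
      case False
      \<comment> \<open>From \<open>ln \<delta>\<close> upwards the new path runs along that of
        \<open>i0\<close>, so its edges are already graphs of old ones.\<close>
      then have "t \<notin> heights" "d k (\<iota> i0) \<le> exp t"
        using t(1) \<delta>_pos by (auto simp: 1 TY_def d_sym[of k] le_exp_iff simp flip: \<delta>_def)
      then show ?thesis
        using X[of i0] Y.edge_cong[of t k "\<iota> i0"] t by (simp add: 1)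
    qed
  next
    case 2
    then show ?thesis
      using X t by simp
  qed
next
  fix \<sigma> assume "\<sigma> \<in> (\<lambda>\<sigma>. graph_point \<iota> P ` \<sigma>) ` edges CX \<union> {vertical_ray \<iota> P z0}"
  then consider \<tau> where "\<tau> \<in> edges CX" "\<sigma> = graph_point \<iota> P ` \<tau>" | "\<sigma> = vertical_ray \<iota> P z0"
    by auto
  then show "\<sigma> \<in> edges CY"
  proof cases
    case 1
    obtain i t where t: "t \<notin> TX i" "\<tau> = tree_path dX i ` cell (TX i) t"
      using 1(1) by (rule X.edgeE)
    have "\<sigma> = tree_path d (\<iota> i) ` cell (TY (\<iota> i)) t"
      using 1(2) unfolding t(2) graph_edge .
    then show ?thesis
      using Y.edgeI[of t "\<iota> i"] t(1) by (simp add: TX_def)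
  next
    case 2
    then show ?thesis
      \<comment> \<open>Any parameter below \<open>ln \<delta>\<close> names the ray, since
        \<open>ln \<delta>\<close> is the least vertex parameter of the new path.\<close>
      using Y.edgeI[of "ln \<delta> - 1" k] Y_edge_k[of "ln \<delta> - 1"] by (simp add: TY_def)
  qed
qed

lemma verts_CY: "verts CY = graph_point \<iota> P ` verts CX"
proof (intro equalityI subsetI)
  fix z assume "z \<in> verts CY"
  then obtain m t where t: "t \<in> TY m" "z = tree_path d m t"
    by (auto simp: tree_complex_def)
  obtain i where "t \<in> heights" "z = tree_path d (\<iota> i) t"
  proof (cases m rule: index_cases)
    case 1
    then show ?thesis
      using t that[of i0] Y_path_k[of t] by (simp add: TY_def)
  next
    case (2 i)
    then show ?thesis
      using t that[of i] by simp
  qed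
  then have "z = graph_point \<iota> P (tree_path dX i t)" "tree_path dX i t \<in> verts CX"
    by (simp_all add: graph_path X.verts_iff TX_def)
  then show "z \<in> graph_point \<iota> P ` verts CX"
    by blast
next
  fix z assume "z \<in> graph_point \<iota> P ` verts CX"
  then obtain i t where "t \<in> heights" "z = tree_path d (\<iota> i) t"
    by (auto simp: tree_complex_def graph_path TX_def)
  then show "z \<in> verts CY"
    by (simp add: Y.verts_iff)
qed

section \<open>The points where the function is not affine\<close>

text \<open>Off the level \<open>ln \<delta>\<close> of the coordinate \<open>i0\<close>, P is
  locally this coordinate or constant. Other points at this level lie on branches at distance
  \<delta> from \<open>i0\<close>, strictly below the branching height; there the coordinate
  \<open>i0\<close> is constant on the curve.\<close>

lemma affine_at_other:
  assumes "z \<in> support CX" "z \<noteq> z0"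
  shows "affine_at P CX z"
proof -
  consider "ln \<delta> < z $ i0" | "z $ i0 < ln \<delta>" | "z $ i0 = ln \<delta>"
    by linarith
  then show ?thesis
  proof cases
    case 1
    have "open {x :: real ^ 'r. ln \<delta> < x $ i0}"
      by (intro open_Collect_less continuous_intros)
    then show ?thesis
      unfolding affine_at_def using 1
      by (intro exI[of _ "{x. ln \<delta> < x $ i0}"] exI[of _ "\<lambda>x. x $ i0"] exI[of _ 0])
        (auto simp: P_finite_point intro: linearI)
  next
    case 2
    have "open {x :: real ^ 'r. x $ i0 < ln \<delta>}"
      by (intro open_Collect_less continuous_intros)
    then show ?thesis
      unfolding affine_at_def using 2
      by (intro exI[of _ "{x. x $ i0 < ln \<delta>}"] exI[of _ "\<lambda>x. 0"] exI[of _ "ln \<delta>"])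
        (auto simp: P_finite_point intro: linearI)
  next
    case 3
    obtain i t where z: "z = tree_path dX i t"
      using assms(1) unfolding X.support_eq by blast
    have "ln (max (exp t) (dX i i0)) = ln \<delta>"
      using 3 by (simp add: z tree_path_def)
    moreover have "0 < max (exp t) (dX i i0)"
      by (simp add: less_max_iff_disj)
    ultimately have max: "max (exp t) (dX i i0) = \<delta>"
      using \<delta>_pos by (metis ln_inj_iff)
    have "\<not> dX i i0 \<le> exp t"
    proof
      assume le: "dX i i0 \<le> exp t"
      then have "t = ln \<delta>"
        using max by (metis ln_exp max.absorb1)
      then have "z = z0"
        using le by (simp add: z X.path_eq_iff)
      then show False
        using assms(2) by contradiction
    qed
    then have dX: "dX i i0 = \<delta>" "exp t < \<delta>"
      using max by auto
    \<comment> \<open>This open condition keeps to the open ball of radius \<delta> around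
      \<open>i\<close>, all of whose members have distance \<delta> from \<open>i0\<close>.\<close>
    let ?U = "{x :: real ^ 'r. x $ i < ln \<delta>}"
    have "x $ i0 = ln \<delta>" if "x \<in> ?U" "x \<in> support CX" for x
    proof -
      obtain j u where x: "x = tree_path dX j u"
        using \<open>x \<in> support CX\<close> unfolding X.support_eq by blast
      have "ln (max (exp u) (dX j i)) < ln \<delta>"
        using \<open>x \<in> ?U\<close> by (simp add: x tree_path_def)
      moreover have "0 < max (exp u) (dX j i)"
        by (simp add: less_max_iff_disj)
      ultimately have "max (exp u) (dX j i) < \<delta>"
        using \<delta>_pos by simp
      then have "max (exp u) (dX j i0) = \<delta>"
        using X.d_ultra[of j i0 i] X.d_ultra[of i i0 j] X.d_sym[of i j] dX by linarith
      then show ?thesis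
        by (simp add: x tree_path_def)
    qed
    moreover have "open ?U"
      by (intro open_Collect_less continuous_intros)
    moreover have "z \<in> ?U"
      using dX(2) \<delta>_pos by (simp add: z) (metis ln_exp ln_less_cancel_iff exp_gt_zero)
    ultimately show ?thesis
      unfolding affine_at_def
      by (intro exI[of _ ?U] exI[of _ "\<lambda>x. 0"] exI[of _ "ln \<delta>"])
        (auto simp: P_finite_point intro: linearI)
  qed
qed

text \<open>An affine function on a neighbourhood would have slope \<open>1\<close> upwards and \<open>0\<close> along all other
  edges, contradicting balancing.\<close>

lemma not_affine_at_z0: "\<not> affine_at P CX z0"
proof
  let ?w = "ln \<delta>"
  assume "affine_at P CX z0"
  then obtain U l b where U: "open U" "z0 \<in> U" and l: "linear l"
    and P_eq: "\<And>x. x \<in> U \<Longrightarrow> x \<in> support CX \<Longrightarrow> P (finite_point x) = l x + b"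
    unfolding affine_at_def by blast
  have supp: "tree_path dX i t \<in> support CX" for i t
    unfolding X.support_eq by blast
  have P0: "P (finite_point z0) = ?w"
    using \<delta>_pos by (simp add: P_path \<delta>_def)
  have w: "?w \<in> TX i0"
    using ln_\<delta>_height by (simp add: TX_def)
  obtain e where e: "0 < e" and iso: "X.isolating ?w (?w - e) (?w + e)"
    using X.isolating_exists by blast
  have upper: "l (tree_dir dX i0 (?w + e)) = 1"
  proof -
    let ?u = "tree_dir dX i0 (?w + e)"
    obtain h where h: "0 < h" "h < e" "z0 + h *\<^sub>R ?u \<in> U"
      using open_small_step[OF U e] by blast
    have cell: "?w \<in> cell (TX i0) (?w + e)"
      using X.isolating_mem_cell(2)[OF iso] .
    then have "?w + h \<in> cell (TX i0) (?w + e)"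
      using h by (auto simp: cell_def)
    then have step: "tree_path dX i0 (?w + h) = z0 + h *\<^sub>R ?u"
      using X.path_step[OF X.isolating_not_mem(2)[OF iso] cell] by simp
    have "l (z0 + h *\<^sub>R ?u) + b = P (finite_point (tree_path dX i0 (?w + h)))"
      using P_eq[of "z0 + h *\<^sub>R ?u"] h(3) supp[of i0 "?w + h"] by (simp add: step)
    also have "\<dots> = ?w + h"
    proof -
      have "d (\<iota> i0) k \<le> exp (?w + h)"
        using \<delta>_pos h(1) by (simp add: le_exp_iff flip: \<delta>_def)
      then show ?thesis
        by (simp add: P_path max.absorb1)
    qed
    finally have "l z0 + h * l ?u + b = ?w + h"
      by (simp add: linear_add[OF l] linear_cmul[OF l])
    moreover have "l z0 + b = ?w"
      using P_eq[OF U(2) supp] P0 by simp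
    ultimately have "h * l ?u = h"
      by linarith
    then show ?thesis
      using h(1) by simp
  qed
  have lower: "l (tree_dir dX j (?w - e)) = 0" if j: "dX i0 j \<le> exp ?w" for j
  proof -
    let ?u = "tree_dir dX j (?w - e)"
    obtain h where h: "0 < h" "h < e" "z0 + h *\<^sub>R (- ?u) \<in> U"
      using open_small_step[OF U e] by blast
    have cell: "?w \<in> cell (TX j) (?w - e)"
      using X.isolating_mem_cell(1)[OF iso] .
    then have "?w - h \<in> cell (TX j) (?w - e)"
      using h by (auto simp: cell_def)
    moreover have "z0 = tree_path dX j ?w"
      using j by (simp add: X.path_eq_iff)
    ultimately have step: "tree_path dX j (?w - h) = z0 + h *\<^sub>R (- ?u)"
      using X.path_step[OF X.isolating_not_mem(1)[OF iso] cell, of "?w - h"] by simp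
    have "l (z0 + h *\<^sub>R (- ?u)) + b = P (finite_point (tree_path dX j (?w - h)))"
      using P_eq[of "z0 + h *\<^sub>R (- ?u)"] h(3) supp[of j "?w - h"] by (simp only: step)
    also have "\<dots> = ?w"
    proof -
      have "d (\<iota> j) k = \<delta>"
        using max_nearest[of j] j \<delta>_pos X.d_sym[of i0 j] by (simp add: max_def)
      moreover have "exp (?w - h) \<le> \<delta>"
        using \<delta>_pos h(1) by (simp add: flip: ln_ge_iff)
      ultimately show ?thesis
        by (simp add: P_path max.absorb2)
    qed
    finally have "l z0 - h * l ?u + b = ?w"
      by (simp add: linear_diff[OF l] linear_cmul[OF l])
    moreover have "l z0 + b = ?w"
      using P_eq[OF U(2) supp] P0 by simp
    ultimately have "h * l ?u = 0"
      by linarith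
    then show ?thesis
      using h(1) by simp
  qed
  let ?E = "(\<lambda>j. tree_path dX j ` cell (TX j) (?w - e)) ` {j. dX i0 j \<le> exp ?w}"
  have "l (tree_dir dX i0 ?w) = (\<Sum>\<sigma>\<in>?E. l (outward_primitive z0 \<sigma>))"
    unfolding X.lower_edges_sum[OF iso w, symmetric] by (rule linear_sum[OF l])
  also have "\<dots> = 0"
    using lower X.outward_lower[OF iso w] by (intro sum.neutral) auto
  finally have "l (tree_dir dX i0 ?w) = 0" .
  moreover have "tree_dir dX i0 ?w = tree_dir dX i0 (?w + e)"
    using X.isolating_d(1)[OF iso] by (simp add: tree_dir_def)
  ultimately show False
    using upper by simp
qed

lemma graph_completion_CX: "graph_completion \<iota> P CX CY"
proof -
  have "z0 \<in> support CX"
    unfolding X.support_eq by blast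
  then have "z \<in> support CX \<and> \<not> affine_at P CX z \<longleftrightarrow> z = z0" for z
    using affine_at_other not_affine_at_z0 by blast
  then have "{vertical_ray \<iota> P z | z. z \<in> support CX \<and> \<not> affine_at P CX z} = {vertical_ray \<iota> P z0}"
    by auto
  then show ?thesis
    unfolding graph_completion_def using verts_CY edges_CY Y.balanced_tree
    by (simp add: tree_complex_def)
qed

text \<open>The distance from \<open>i\<close> to the new point is among the cutting heights, so on
  each edge one of the two terms of the maximum wins throughout. The slope is accordingly that of
  the coordinate \<open>i\<close> or zero.\<close>

lemma integral_affine:
  assumes "\<sigma> \<in> edges CX"
  shows "integral_affine_on_edge P \<sigma>"
proof -
  obtain i t where t: "t \<notin> TX i" "\<sigma> = tree_path dX i ` cell (TX i) t"
    using assms by (rule X.edgeE)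
  have TY: "t \<notin> TY (\<iota> i)" "cell (TY (\<iota> i)) t = cell (TX i) t"
    using t(1) by (simp_all add: TX_def)
  show ?thesis
  proof (cases "d (\<iota> i) k \<le> exp t")
    case True
    have "P (finite_point x) = x $ i" if "x \<in> \<sigma>" for x
    proof -
      obtain w where w: "w \<in> cell (TX i) t" "x = tree_path dX i w"
        using \<open>x \<in> \<sigma>\<close> t(2) by blast
      have "d (\<iota> i) k \<le> exp w"
        using Y.d_le_exp_cell(1)[OF TY(1) _ True] w(1) TY(2) by simp
      then show ?thesis
        by (simp add: w(2) P_path max.absorb1)
    qed
    then show ?thesis
      unfolding integral_affine_on_edge_def
      by (intro exI[of _ "\<lambda>x. x $ i"] exI[of _ 0]) (auto intro: linearI simp: integral_vectors_def)
  next
    case False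
    have "P (finite_point x) = ln (d (\<iota> i) k)" if "x \<in> \<sigma>" for x
    proof -
      obtain w where w: "w \<in> cell (TX i) t" "x = tree_path dX i w"
        using \<open>x \<in> \<sigma>\<close> t(2) by blast
      have "exp w \<le> d (\<iota> i) k"
        using Y.d_le_exp_cell(2)[OF TY(1) _ False] w(1) TY(2) by simp
      then show ?thesis
        by (simp add: w(2) P_path max.absorb2)
    qed
    then show ?thesis
      unfolding integral_affine_on_edge_def
      by (intro exI[of _ "\<lambda>x. 0"] exI[of _ "ln (d (\<iota> i) k)"]) (auto intro: linearI)
  qed
qed

lemma continuous_on_P: "continuous_on (curve CX) P"
proof -
  have fin: "max (y $ i0) (ereal (ln \<delta>)) \<in> UNIV - {\<infinity>, - \<infinity>}" if "y \<in> curve CX" for y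
    using that by (auto simp: curve_def tropical_space_def max_def)
  have "continuous_on (curve CX) (\<lambda>y. max (y $ i0) (ereal (ln \<delta>)))"
    by (intro continuous_intros)
  then show ?thesis
    unfolding P_def by (rule continuous_on_compose2[OF continuous_on_real], intro image_subsetI fin)
qed

text \<open>The new path projects to that of \<open>i0\<close> with parameter raised to at least
  \<open>ln \<delta>\<close>; the ray and its end at infinity collapse to one point.\<close>

lemma trop_proj_curve: "trop_proj \<iota> \<in> curve CY \<rightarrow> curve CX"
proof
  fix y assume "y \<in> curve CY"
  then obtain m t where t: "t \<noteq> \<infinity>" "y = tree_path_ext d m t"
    unfolding Y.curve_tree by blast
  have "\<exists>i u. u \<noteq> \<infinity> \<and> trop_proj \<iota> y = tree_path_ext dX i u"
  proof (cases m rule: index_cases)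
    case 1
    have "trop_proj \<iota> y = tree_path_ext dX i0 (max t (trop_log \<delta>))"
      unfolding t(2) 1 trop_proj_def tree_path_ext_def
      using \<delta>_pos X.d_nonneg
      by (simp add: d_k trop_log_max vec_eq_iff max.commute max.left_commute max.assoc)
    moreover have "max t (trop_log \<delta>) \<noteq> \<infinity>"
      using t(1) by (auto simp: max_def trop_log_def)
    ultimately show ?thesis
      by blast
  next
    case (2 i)
    then have "trop_proj \<iota> y = tree_path_ext dX i t"
      by (simp add: t(2) trop_proj_def tree_path_ext_def dX_def)
    then show ?thesis
      using t(1) by blast
  qed
  then show "trop_proj \<iota> y \<in> curve CX"
    unfolding X.curve_tree by blast
qed

lemma tropical_modification_tree:
  assumes "CARD('s) = CARD('r) + 1"
  shows "tropical_modification (trop_proj \<iota>) CY CX"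
  unfolding tropical_modification_def
  using assms inj continuous_on_P integral_affine graph_completion_CX trop_proj_curve
    same_tropical_curve_refl[OF X.tropical_structure_tree] same_tropical_curve_refl[OF Y.tropical_structure_tree]
  by (intro exI[of _ \<iota>] exI[of _ P] exI[of _ CX] exI[of _ CY]) simp

end

theorem theorem3p7:
  fixes v :: "'k::alg_closed_field \<Rightarrow> real"
    and vL :: "'l::alg_closed_field \<Rightarrow> real"
    and j :: "'k \<Rightarrow> 'l"
    and \<phi> :: "'r::finite \<Rightarrow> 'k poly"
    and \<phi>' :: "'s::finite \<Rightarrow> 'k poly"
    and \<iota> :: "'r \<Rightarrow> 's"
  assumes "nonarch_absolute_value v"
    and "complete_absolute_value v"
    and "valued_extension v vL j"
    and "nontrivial_absolute_value vL"
    and "CARD('s) = CARD('r) + 1"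
    and "linear_embedding \<phi>"
    and "linear_refinement \<iota> \<phi>' \<phi>"
    and "\<And>k. k \<notin> range \<iota> \<Longrightarrow> \<phi>' k \<notin> range \<phi>"
  shows "\<exists>X Y. represents_Trop v vL j \<phi> X \<and> represents_Trop v vL j \<phi>' Y \<and>
           tropical_modification (trop_proj \<iota>) Y X"
proof -
  interpret v: nonarch_valuation v
    by unfold_locales fact
  obtain a where a: "\<And>m. \<phi>' m = [:- a m, 1:]"
    using assms(7) by (auto simp: linear_refinement_def linear_embedding_def)
  have inj: "inj \<iota>" and \<phi>: "\<And>i. \<phi> i = [:- a (\<iota> i), 1:]"
    using assms(7) a by (auto simp: linear_refinement_def)
  let ?d = "\<lambda>m n. v (a m - a n)"
  have "card (UNIV - range \<iota>) = 1"
    using assms(5) by (subst card_Diff_subset) (auto simp: card_image[OF inj])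
  then obtain k where k: "UNIV - range \<iota> = {k}"
    by (auto simp: card_1_singleton_iff)
  then have range: "range \<iota> = UNIV - {k}"
    by blast
  \<comment> \<open>Distinctness of the new coordinate makes all distances to the new point
    positive, so \<open>ln \<delta>\<close> is a genuine height and the graph is finite.\<close>
  have new: "a (\<iota> i) \<noteq> a k" for i
    using assms(8)[of k] k a[of k] \<phi>[of i] by (metis DiffD2 rangeI singletonI)
  have "Min (range (\<lambda>i. ?d (\<iota> i) k)) \<in> range (\<lambda>i. ?d (\<iota> i) k)"
    by (intro Min_in) auto
  then obtain i0 where "Min (range (\<lambda>i. ?d (\<iota> i) k)) = ?d (\<iota> i0) k"
    by (rule rangeE)
  then have i0: "?d (\<iota> i0) k \<le> ?d (\<iota> i) k" for i
    by (metis Min_le finite rangeI finite_imageI)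
  interpret M: tree_modification ?d \<iota> k i0
  proof
    show "?d m l \<le> max (?d m n) (?d n l)" for m n l
      by (rule v.dist_triangle)
    show "?d m n = ?d n m" for m n
      by (rule v.minus_commute)
  qed (use inj range new i0 in auto)
  have dX: "M.dX = (\<lambda>i j. v (a (\<iota> i) - a (\<iota> j)))"
    by (simp add: M.dX_def fun_eq_iff)
  have "represents_Trop v vL j \<phi> (tree_complex M.dX M.TX)"
    using ultrametric_tree_represents_Trop[OF assms(3,4), of \<phi> "\<lambda>i. a (\<iota> i)" M.TX] \<phi>
      M.X.ultrametric_tree_axioms unfolding dX by simp
  moreover have "represents_Trop v vL j \<phi>' (tree_complex ?d M.TY)"
    using ultrametric_tree_represents_Trop[OF assms(3,4), of \<phi>' a M.TY] a
      M.Y.ultrametric_tree_axioms by simp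
  moreover have "tropical_modification (trop_proj \<iota>) (tree_complex ?d M.TY) (tree_complex M.dX M.TX)"
    using M.tropical_modification_tree[OF assms(5)] .
  ultimately show ?thesis
    by blast
qed

end
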